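(* Let $\mathcal F\in\{A\mathrm J,B\mathrm J,A\mathrm M,B\mathrm M\}$ be any of the four families of interpolation polynomials, let $\lambda,\mu,\nu\in\mathcal P_n$ and put $k=|\lambda|-|\mu|$. Then the Littlewood–Richardson coefficient $c_{\mu\nu}^\lambda$ satisfies $$c_{\mu\nu}^\lambda=\sum_{\zeta\in\mathfrak C_{\lambda\mu}}\mathrm{wt}_\nu^{\mathrm{LR}}(\zeta)\prod_{i=0}^{k-1}\binom{\zeta_i}{\zeta_{i+1}},\qquad \mathrm{wt}_\nu^{\mathrm{LR}}(\zeta)=\sum_{j=0}^k\frac{\prod_{0\leqslant i\leqslant k-1}\bigl(\|\overline{\zeta_i}\|-\|\overline{\zeta_{i+1}}\|\bigr)}{\prod_{0\leqslant i\leqslant k,\,i\ne j}\bigl(\|\overline{\zeta_j}\|-\|\overline{\zeta_i}\|\bigr)}\binom{\zeta_j}{\nu},$$ where $\mathfrak C_{\lambda\mu}$ is the set of saturated chains $\zeta=(\zeta_0,\dots,\zeta_k)$ from $\lambda$ to $\mu$ (an empty sum being $0$ and an empty product $1$).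
   Context: Fix $n\geqslant1$. $\mathcal P_n=\{\lambda\in\mathbb Z^n:\lambda_1\geqslant\cdots\geqslant\lambda_n\geqslant0\}$, $|\lambda|=\lambda_1+\dots+\lambda_n$; $\lambda\supseteq\mu$ means $\lambda_i\geqslant\mu_i$ for all $i$; $\lambda\gtrdot\mu$ means $\lambda\supseteq\mu$ and $|\lambda|=|\mu|+1$. A saturated chain from $\lambda$ to $\mu$ is a sequence in $\mathcal P_n$ with $\lambda=\zeta_0\gtrdot\zeta_1\gtrdot\cdots\gtrdot\zeta_k=\mu$. The four families $\mathcal F$ have the following data (base field $\mathbb F$, ring $\Lambda$, shifting map $\mathcal P_n\to\mathbb F^n$, $\lambda\mapsto\overline\lambda$, and "norm" $\|x\|$), with indeterminate parameters: - $A\mathrm J$: $\mathbb F=\mathbb Q(\tau)$; $\Lambda=\mathbb F[x_1,\dots,x_n]^{S_n}$; $\overline\lambda_i=\lambda_i+(n-i)\tau$; $\|x\|=\sum_i x_i$. - $B\mathrm J$: $\mathbb F=\mathbb Q(\tau,\alpha)$; $\Lambda=\mathbb F[x_1^2,\dots,x_n^2]^{S_n}$; $\overline\lambda_i=\lambda_i+(n-i)\tau+\alpha$; $\|x\|=\sum_i x_i^2$. - $A\mathrm M$: $\mathbb F=\mathbb Q(q,t)$; $\Lambda=\mathbb F[x_1,\dots,x_n]^{S_n}$; $\overline\lambda_i=q^{\lambda_i}t^{n-i}$; $\|x\|=\sum_i x_i$. - $B\mathrm M$: $\mathbb F=\mathbb Q(q,t,a)$; $\Lambda=\mathbb F[x_1+x_1^{-1},\dots,x_n+x_n^{-1}]^{S_n}$;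 $\overline\lambda_i=aq^{\lambda_i}t^{n-i}$; $\|x\|=\sum_i(x_i+x_i^{-1})$. The degree of a Laurent polynomial is the maximum of $|\alpha_1|+\dots+|\alpha_n|$ over monomials $x^\alpha$ occurring in it. For $\mu\in\mathcal P_n$, the (unital) interpolation polynomial $h_\mu$ is the unique element of $\Lambda$ of degree at most $|\mu|$ (at most $2|\mu|$ when $\mathcal F=B\mathrm J$) with $h_\mu(\overline\lambda)=\delta_{\lambda\mu}$ for all $\lambda\in\mathcal P_n$ with $|\lambda|\leqslant|\mu|$ (existence and uniqueness are known). The binomial coefficients are $\binom{\lambda}{\mu}=h_\mu(\overline\lambda)\in\mathbb F$. The $h_\lambda$, $\lambda\in\mathcal P_n$, form an $\mathbb F$-basis of $\Lambda$, and the Littlewood–Richardson coefficients $c_{\mu\nu}^\lambda\in\mathbb F$ are defined by $h_\mu h_\nu=\sum_{\lambda}c_{\mu\nu}^\lambda h_\lambda$. *)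

theory Defs
  imports
    Complex_Main
    "HOL-Library.Poly_Mapping"
    "HOL-Combinatorics.Permutations"
    "HOL-Computational_Algebra.Computational_Algebra"
begin

text \<open>An element of \<open>\<P>\<^sub>n\<close> is a weakly decreasing list of \<open>n\<close> natural numbers. Indices start
  at \<open>0\<close> throughout, so that the usual \<open>n - i\<close> appears as \<open>n - 1 - i\<close>. We write
  \<open>\<kappa>\<close> for a partition usually called lambda, since that letter is the abstraction symbol.\<close>

definition parts :: "nat \<Rightarrow> nat list set" where
  "parts n = {\<kappa>. length \<kappa> = n \<and> sorted_wrt (\<ge>) \<kappa>}"

definition contains :: "nat list \<Rightarrow> nat list \<Rightarrow> bool" where
  "contains \<kappa> \<mu> \<longleftrightarrow> list_all2 (\<ge>) \<kappa> \<mu>"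

definition covers :: "nat list \<Rightarrow> nat list \<Rightarrow> bool" where
  "covers \<kappa> \<mu> \<longleftrightarrow> contains \<kappa> \<mu> \<and> sum_list \<kappa> = sum_list \<mu> + 1"

text \<open>The chain \<open>\<zeta>\<^sub>0, \<dots>, \<zeta>\<^sub>k\<close> is a list of length \<open>k + 1\<close>.\<close>

definition sat_chains :: "nat \<Rightarrow> nat list \<Rightarrow> nat list \<Rightarrow> nat list list set" where
  "sat_chains n \<kappa> \<mu> = {\<zeta>. \<zeta> \<noteq> [] \<and> set \<zeta> \<subseteq> parts n \<and> hd \<zeta> = \<kappa> \<and> last \<zeta> = \<mu> \<and>
     (\<forall>i. i + 1 < length \<zeta> \<longrightarrow> covers (\<zeta> ! i) (\<zeta> ! (i + 1)))}"

text \<open>Laurent polynomials in \<open>x\<^sub>0, x\<^sub>1, \<dots>\<close>: an exponent vector is a finitely supported function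
  into the integers. Polynomials in \<open>n\<close> variables only involve \<open>x\<^sub>i\<close> with \<open>i < n\<close>.\<close>

type_synonym 'f laurent = "(nat \<Rightarrow>\<^sub>0 int) \<Rightarrow>\<^sub>0 'f"

definition const :: "'f::field \<Rightarrow> 'f laurent" where
  "const c = Poly_Mapping.single 0 c"

definition xpow :: "nat \<Rightarrow> int \<Rightarrow> 'f::field laurent" where
  "xpow i e = Poly_Mapping.single (Poly_Mapping.single i e) 1"

definition ldegree :: "'f::field laurent \<Rightarrow> nat" where
  "ldegree p = Max (insert 0
     ((\<lambda>m. \<Sum>i\<in>Poly_Mapping.keys m. nat \<bar>Poly_Mapping.lookup m i\<bar>) ` Poly_Mapping.keys p))"

text \<open>In the families below, evaluation is used either at points with nonzero coordinates or on
  polynomials without negative exponents, so the convention \<open>inverse 0 = 0\<close> plays no role.\<close>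

definition leval :: "'f::field laurent \<Rightarrow> (nat \<Rightarrow> 'f) \<Rightarrow> 'f" where
  "leval p x = (\<Sum>m\<in>Poly_Mapping.keys p. Poly_Mapping.lookup p m *
     (\<Prod>i\<in>Poly_Mapping.keys m. x i powi Poly_Mapping.lookup m i))"

definition symmetric_laurent :: "nat \<Rightarrow> 'f::field laurent \<Rightarrow> bool" where
  "symmetric_laurent n p \<longleftrightarrow> (\<forall>\<pi>. \<pi> permutes {..<n} \<longrightarrow>
     (\<forall>m. Poly_Mapping.lookup p (Poly_Mapping.map_key \<pi> m) = Poly_Mapping.lookup p m))"

text \<open>The subalgebra generated by a set of Laurent polynomials over the coefficient field.\<close>

inductive_set gen_algebra :: "'f::field laurent set \<Rightarrow> 'f laurent set"
  for G :: "'f laurent set" where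
  "const c \<in> gen_algebra G"
| "g \<in> G \<Longrightarrow> g \<in> gen_algebra G"
| "p \<in> gen_algebra G \<Longrightarrow> r \<in> gen_algebra G \<Longrightarrow> p + r \<in> gen_algebra G"
| "p \<in> gen_algebra G \<Longrightarrow> r \<in> gen_algebra G \<Longrightarrow> p * r \<in> gen_algebra G"

text \<open>The data of a family: generators \<open>g\<^sub>i\<close> with \<open>\<Lambda> = K[g\<^sub>1, \<dots>, g\<^sub>n]\<^bsup>S\<^sub>n\<^esup>\<close>, the factor
  \<open>d\<close> in the degree bound \<open>d\<bar>\<mu>\<bar>\<close>, the shifting map and the norm (both depending on \<open>n\<close>).\<close>

record (overloaded) 'f interp_family =
  fgen :: "nat \<Rightarrow> 'f laurent"
  fdeg :: nat
  fshift :: "nat \<Rightarrow> nat list \<Rightarrow> nat \<Rightarrow> 'f"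
  fnorm :: "nat \<Rightarrow> (nat \<Rightarrow> 'f) \<Rightarrow> 'f"

definition Lam :: "'f::field interp_family \<Rightarrow> nat \<Rightarrow> 'f laurent set" where
  "Lam F n = {p \<in> gen_algebra (fgen F ` {..<n}). symmetric_laurent n p}"

definition interp_poly :: "'f::field interp_family \<Rightarrow> nat \<Rightarrow> nat list \<Rightarrow> 'f laurent" where
  "interp_poly F n \<mu> = (THE h. h \<in> Lam F n \<and> ldegree h \<le> fdeg F * sum_list \<mu> \<and>
     (\<forall>\<kappa>\<in>parts n. sum_list \<kappa> \<le> sum_list \<mu> \<longrightarrow>
        leval h (fshift F n \<kappa>) = (if \<kappa> = \<mu> then 1 else 0)))"

definition binom :: "'f::field interp_family \<Rightarrow> nat \<Rightarrow> nat list \<Rightarrow> nat list \<Rightarrow> 'f" where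
  "binom F n \<kappa> \<mu> = leval (interp_poly F n \<mu>) (fshift F n \<kappa>)"

text \<open>The coordinates of \<open>h\<^sub>\<mu> h\<^sub>\<nu>\<close> with respect to the basis \<open>(h\<^sub>\<kappa>)\<close>, \<open>\<kappa> \<in> \<P>\<^sub>n\<close>.\<close>

definition LR_expansion ::
    "'f::field interp_family \<Rightarrow> nat \<Rightarrow> nat list \<Rightarrow> nat list \<Rightarrow> (nat list \<Rightarrow>\<^sub>0 'f)" where
  "LR_expansion F n \<mu> \<nu> = (THE c. Poly_Mapping.keys c \<subseteq> parts n \<and>
     interp_poly F n \<mu> * interp_poly F n \<nu> =
       (\<Sum>\<kappa>\<in>Poly_Mapping.keys c. const (Poly_Mapping.lookup c \<kappa>) * interp_poly F n \<kappa>))"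

text \<open>\<open>LR_coeff F n \<kappa> \<mu> \<nu>\<close> is \<open>c\<^bsub>\<mu>\<nu>\<^esub>\<^bsup>\<kappa>\<^esup>\<close>.\<close>

definition LR_coeff ::
    "'f::field interp_family \<Rightarrow> nat \<Rightarrow> nat list \<Rightarrow> nat list \<Rightarrow> nat list \<Rightarrow> 'f" where
  "LR_coeff F n \<kappa> \<mu> \<nu> = Poly_Mapping.lookup (LR_expansion F n \<mu> \<nu>) \<kappa>"

definition wt_LR :: "'f::field interp_family \<Rightarrow> nat \<Rightarrow> nat list \<Rightarrow> nat list list \<Rightarrow> 'f" where
  "wt_LR F n \<nu> \<zeta> =
     (let k = length \<zeta> - 1; s = (\<lambda>i. fnorm F n (fshift F n (\<zeta> ! i))) in
      \<Sum>j\<in>{0..k}. (\<Prod>i\<in>{..<k}. s i - s (i + 1)) / (\<Prod>i\<in>{0..k} - {j}. s j - s i) *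
        binom F n (\<zeta> ! j) \<nu>)"

text \<open>The fields of rational functions over the rationals in the parameters
  \<open>\<tau>\<close>; \<open>\<tau>, \<alpha>\<close>; \<open>q, t\<close>; and \<open>q, t, a\<close> are iterated polynomial rings followed by one fraction
  field; the first parameter is the innermost polynomial variable.\<close>

definition AJ :: "rat poly fract interp_family" where
  "AJ = (let \<tau> = to_fract [:0, 1:] in
     \<lparr>fgen = (\<lambda>i. xpow i 1),
      fdeg = 1,
      fshift = (\<lambda>n \<kappa> i. of_nat (\<kappa> ! i) + of_nat (n - 1 - i) * \<tau>),
      fnorm = (\<lambda>n x. \<Sum>i<n. x i)\<rparr>)"

definition BJ :: "rat poly poly fract interp_family" where
  "BJ = (let \<tau> = to_fract [:[:0, 1:]:]; \<alpha> = to_fract [:0, 1:] in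
     \<lparr>fgen = (\<lambda>i. xpow i 2),
      fdeg = 2,
      fshift = (\<lambda>n \<kappa> i. of_nat (\<kappa> ! i) + of_nat (n - 1 - i) * \<tau> + \<alpha>),
      fnorm = (\<lambda>n x. \<Sum>i<n. x i ^ 2)\<rparr>)"

definition AM :: "rat poly poly fract interp_family" where
  "AM = (let q = to_fract [:[:0, 1:]:]; t = to_fract [:0, 1:] in
     \<lparr>fgen = (\<lambda>i. xpow i 1),
      fdeg = 1,
      fshift = (\<lambda>n \<kappa> i. q ^ (\<kappa> ! i) * t ^ (n - 1 - i)),
      fnorm = (\<lambda>n x. \<Sum>i<n. x i)\<rparr>)"

definition BM :: "rat poly poly poly fract interp_family" where
  "BM = (let q = to_fract [:[:[:0, 1:]:]:]; t = to_fract [:[:0, 1:]:]; a = to_fract [:0, 1:] in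
     \<lparr>fgen = (\<lambda>i. xpow i 1 + xpow i (-1)),
      fdeg = 1,
      fshift = (\<lambda>n \<kappa> i. a * q ^ (\<kappa> ! i) * t ^ (n - 1 - i)),
      fnorm = (\<lambda>n x. \<Sum>i<n. x i + inverse (x i))\<rparr>)"

end

(*
Evaluating N h_mu, where N is the norm, at the grid points gives a Pieri rule
N h_mu = s_mu h_mu + sum (s_rho - s_mu) binom(rho, mu) h_rho over the rho covering mu. Multiplying
h_mu h_nu by N in two ways then gives a recursion for c_{mu nu}^kappa in |kappa| - |mu|, which is the
recursion of divided differences along saturated chains.

The Pieri rule needs the extra vanishing binom(rho, mu) = 0 for |rho| = |mu| + 1, rho not containing mu.
It follows from an operator D f = sum over I of w_I f(rows in I lowered), a common form of the
operators of Knop-Sahi and Rains, in general between two different grids: it preserves symmetric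
polynomials and degrees, is triangular on the grids, and a free parameter of its weights can be
chosen such that the image of the interpolation polynomial of mu vanishes at rho.

Uniqueness of h_mu is a dimension count: a symmetric element is determined by its coefficients
at dominant exponents.
*)

theory Submission
  imports Defs
begin

section \<open>Polynomial functions and Newton interpolation\<close>

text \<open>The conditions that define h_mu stop at size |mu|, so they cannot show that h_mu
  vanishes at a larger rho; a second construction of h_mu is needed, which uniqueness identifies
  with the first. At a rho of size |mu|+1 that does not contain mu, only the term that keeps all
  rows is left of the operator, because lowering lands where the interpolant is zero. This last term
  has no reason to vanish, which is why the weights carry a parameter: it is placed at a row of rho
  that differs from the same row of mu, where the weight for keeping becomes zero. Two grids are
  forced by the families with reflection or inversion symmetry. A step in one direction does not
  respect functions of x^2 or x + 1/x; a balanced pair of opposite half steps does, and it displaces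
  the point set by half a step. Polynomials enter as functions with a degree bound, since the
  arguments concern values at grid points; symmetric Laurent polynomials are recovered by
  substituting generators and averaging.\<close>

inductive polyfun :: "nat \<Rightarrow> nat \<Rightarrow> ((nat \<Rightarrow> 'f::field) \<Rightarrow> 'f) \<Rightarrow> bool" for n where
  polyfun_const: "polyfun n 0 (\<lambda>_. c)"
| polyfun_var: "i < n \<Longrightarrow> polyfun n 1 (\<lambda>y. y i)"
| polyfun_mono: "polyfun n m f \<Longrightarrow> m \<le> m' \<Longrightarrow> polyfun n m' f"
| polyfun_add: "polyfun n m f \<Longrightarrow> polyfun n m g \<Longrightarrow> polyfun n m (\<lambda>y. f y + g y)"
| polyfun_mult: "polyfun n m f \<Longrightarrow> polyfun n m' g \<Longrightarrow> polyfun n (m + m') (\<lambda>y. f y * g y)"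

lemma polyfun_const': "polyfun n m (\<lambda>_. c)"
  using polyfun_mono[OF polyfun_const] by simp

lemma polyfun_var': "i < n \<Longrightarrow> 1 \<le> m \<Longrightarrow> polyfun n m (\<lambda>y. y i)"
  using polyfun_mono[OF polyfun_var] by simp

lemma polyfun_cmult: "polyfun n m f \<Longrightarrow> polyfun n m (\<lambda>y. c * f y)"
  using polyfun_mult[OF polyfun_const[of n c], of m f] by simp

lemma polyfun_diff: "polyfun n m f \<Longrightarrow> polyfun n m g \<Longrightarrow> polyfun n m (\<lambda>y. f y - g y)"
  using polyfun_add[of n m f "\<lambda>y. (-1) * g y"] polyfun_cmult[of n m g "-1"] by simp

lemma polyfun_sum: "(\<And>i. i \<in> A \<Longrightarrow> polyfun n m (f i)) \<Longrightarrow> polyfun n m (\<lambda>y. \<Sum>i\<in>A. f i y)"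
  by (induction A rule: infinite_finite_induct)
    (auto intro: polyfun_const' polyfun_add)

lemma polyfun_prod:
  "(\<And>i. i \<in> A \<Longrightarrow> polyfun n 1 (f i)) \<Longrightarrow> polyfun n (card A) (\<lambda>y. \<Prod>i\<in>A. f i y)"
proof (induction A rule: infinite_finite_induct)
  case (insert a A)
  have "polyfun n (1 + card A) (\<lambda>y. f a y * (\<Prod>i\<in>A. f i y))"
    using insert by (intro polyfun_mult) auto
  then show ?case using insert by simp
qed (auto intro: polyfun_const')

lemma polyfun_cong: "polyfun n m f \<Longrightarrow> (\<And>i. i < n \<Longrightarrow> x i = y i) \<Longrightarrow> f x = f y"
  by (induction rule: polyfun.induct) auto

lemma polyfun_subst:
  assumes "polyfun n m f" and "\<And>i. i < n \<Longrightarrow> polyfun n' 1 (u i)"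
  shows "polyfun n' m (\<lambda>v. f (\<lambda>i. u i v))"
  using assms by (induction rule: polyfun.induct)
    (auto intro: polyfun.intros polyfun_const')

text \<open>Restricting to one coordinate gives an honest polynomial, so that finiteness of the root
  set becomes available for functions known only through their values.\<close>

lemma polyfun_univariate: "polyfun n m f \<Longrightarrow> \<exists>p. \<forall>s. f (y(a := s)) = poly p s"
proof (induction rule: polyfun.induct)
  case (polyfun_const c)
  show ?case by (rule exI[of _ "[:c:]"]) simp
next
  case (polyfun_var i)
  show ?case by (rule exI[of _ "if i = a then [:0, 1:] else [:y i:]"]) simp
next
  case (polyfun_add m f g)
  then obtain p q where "\<forall>s. f (y(a := s)) = poly p s" "\<forall>s. g (y(a := s)) = poly q s" by blast
  then show ?case by (intro exI[of _ "p + q"]) (simp add: fun_upd_def)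
next
  case (polyfun_mult m f m' g)
  then obtain p q where "\<forall>s. f (y(a := s)) = poly p s" "\<forall>s. g (y(a := s)) = poly q s" by blast
  then show ?case by (intro exI[of _ "p * q"]) (simp add: fun_upd_def)
qed auto

lemma polyfun_zero_if_infinite:
  assumes "polyfun n m f" "infinite S" "\<And>s. s \<in> S \<Longrightarrow> f (y(a := s)) = 0"
  shows "f y = 0"
proof -
  obtain p where p: "\<forall>s. f (y(a := s)) = poly p s"
    using polyfun_univariate[OF assms(1)] by blast
  have "S \<subseteq> {s. poly p s = 0}" using assms(3) p by auto
  then have "p = 0" using assms(2) poly_roots_finite infinite_super by blast
  then have "f (y(a := y a)) = 0" using p by (simp del: fun_upd_triv)
  then show ?thesis by (simp only: fun_upd_triv)
qed

text \<open>Degree strictly below \<open>m\<close>, the zero function having degree minus infinity.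
  A truncated \<open>m - 1\<close> would be wrong for \<open>m = 0\<close>, where a quotient has to
  be zero and not merely constant.\<close>

definition low_polyfun :: "nat \<Rightarrow> nat \<Rightarrow> ((nat \<Rightarrow> 'f::field) \<Rightarrow> 'f) \<Rightarrow> bool" where
  "low_polyfun n m f \<longleftrightarrow> f = (\<lambda>_. 0) \<or> (\<exists>m'<m. polyfun n m' f)"

lemma low_polyfun_zero: "low_polyfun n m (\<lambda>_. 0)"
  by (simp add: low_polyfun_def)

lemma low_polyfun_Suc: "low_polyfun n (Suc m) f \<Longrightarrow> polyfun n m f"
  by (auto simp: low_polyfun_def less_Suc_eq_le intro: polyfun_mono polyfun_const')

lemma low_polyfun_mono: "low_polyfun n m f \<Longrightarrow> m \<le> m' \<Longrightarrow> low_polyfun n m' f"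
  by (auto simp: low_polyfun_def intro: less_le_trans)

lemma low_polyfun_add:
  assumes "low_polyfun n m f" "low_polyfun n m g"
  shows "low_polyfun n m (\<lambda>y. f y + g y)"
proof (cases "f = (\<lambda>_. 0) \<or> g = (\<lambda>_. 0)")
  case True
  then show ?thesis using assms by auto
next
  case False
  then obtain a b where "a < m" "b < m" "polyfun n a f" "polyfun n b g"
    using assms unfolding low_polyfun_def by blast
  then have "max a b < m" "polyfun n (max a b) (\<lambda>y. f y + g y)"
    by (auto intro!: polyfun_add intro: polyfun_mono)
  then show ?thesis unfolding low_polyfun_def by blast
qed

lemma low_polyfun_mult:
  assumes "low_polyfun n m f" "polyfun n m' g"
  shows "low_polyfun n (m + m') (\<lambda>y. f y * g y)"
proof (cases "f = (\<lambda>_. 0)")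
  case True
  then show ?thesis by (simp add: low_polyfun_def)
next
  case False
  then obtain a where "a < m" "polyfun n a f"
    using assms unfolding low_polyfun_def by blast
  then have "a + m' < m + m'" "polyfun n (a + m') (\<lambda>y. f y * g y)"
    using assms by (auto intro: polyfun_mult)
  then show ?thesis unfolding low_polyfun_def by blast
qed

lemma low_polyfun_mult':
  assumes "polyfun n m f" "low_polyfun n m' g"
  shows "low_polyfun n (m + m') (\<lambda>y. f y * g y)"
  using low_polyfun_mult[OF assms(2,1)] by (simp add: mult.commute add.commute)

lemma low_polyfun_linear_mult:
  assumes "polyfun n 1 l" "low_polyfun n m f"
  shows "polyfun n m (\<lambda>y. l y * f y)"
  using low_polyfun_Suc low_polyfun_mult'[OF assms] by simp

lemma low_polyfun_imp_polyfun: "low_polyfun n m f \<Longrightarrow> polyfun n m f"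
  by (rule low_polyfun_Suc) (auto intro: low_polyfun_mono)

text \<open>The quotient is a divided difference, built along the derivation of \<open>f\<close>.
  For a product the Leibniz rule applies: the difference of the first factor times the second, plus
  the substituted first factor times the difference of the second.\<close>

lemma polyfun_divided_difference:
  assumes "polyfun n m f" "a < n" "b < n"
  shows "\<exists>g. low_polyfun n m g \<and> (\<forall>y. f y - f (y(a := y b)) = (y a - y b) * g y)"
  using assms(1)
proof (induction rule: polyfun.induct)
  case (polyfun_const c)
  show ?case by (rule exI[of _ "\<lambda>_. 0"]) (simp add: low_polyfun_zero)
next
  case (polyfun_var i)
  show ?case
    by (rule exI[of _ "\<lambda>_. if i = a then 1 else 0"])
      (auto simp: low_polyfun_def intro: polyfun_const')
next
  case (polyfun_mono m f m')
  then show ?case by (auto intro: low_polyfun_mono)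
next
  case (polyfun_add m f g)
  then obtain f' g' where "low_polyfun n m f'" "low_polyfun n m g'"
    "\<forall>y. f y - f (y(a := y b)) = (y a - y b) * f' y" "\<forall>y. g y - g (y(a := y b)) = (y a - y b) * g' y"
    by blast
  then show ?case
    by (intro exI[of _ "\<lambda>y. f' y + g' y"] conjI low_polyfun_add)
      (simp_all add: distrib_left add_diff_add flip: fun_upd_def)
next
  case (polyfun_mult m f m' g)
  then obtain f' g' where *: "low_polyfun n m f'" "low_polyfun n m' g'"
    "\<forall>y. f y - f (y(a := y b)) = (y a - y b) * f' y" "\<forall>y. g y - g (y(a := y b)) = (y a - y b) * g' y"
    by blast
  have "polyfun n m (\<lambda>y. f (\<lambda>i. (if i = a then y b else y i)))"
  proof (rule polyfun_subst[OF polyfun_mult.hyps(1), of n "\<lambda>i v. if i = a then v b else v i"])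
    show "polyfun n 1 (\<lambda>v. if i = a then v b else v i)" if "i < n" for i
      using assms that by (cases "i = a") (auto intro: polyfun_var')
  qed
  also have "(\<lambda>y. f (\<lambda>i. (if i = a then y b else y i))) = (\<lambda>y. f (y(a := y b)))"
    by (simp add: fun_upd_def)
  finally have **: "polyfun n m (\<lambda>y. f (y(a := y b)))" .
  show ?case
  proof (intro exI[of _ "\<lambda>y. f' y * g y + f (y(a := y b)) * g' y"] conjI low_polyfun_add allI)
    show "low_polyfun n (m + m') (\<lambda>y. f' y * g y)"
      using * polyfun_mult by (intro low_polyfun_mult)
    show "low_polyfun n (m + m') (\<lambda>y. f (y(a := y b)) * g' y)"
      using * ** by (intro low_polyfun_mult')
    fix y
    have 1: "f y = f (y(a := y b)) + (y a - y b) * f' y" "g (y(a := y b)) = g y - (y a - y b) * g' y"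
      using *(3,4)[THEN spec, of y] by (simp_all add: algebra_simps)
    show "f y * g y - f (y(a := y b)) * g (y(a := y b)) =
      (y a - y b) * (f' y * g y + f (y(a := y b)) * g' y)"
      unfolding 1 by (simp add: algebra_simps)
  qed
qed

text \<open>One linear factor is divided out at a time. The quotient must still vanish on the
  remaining diagonals: this is clear off the removed diagonal, and a point on that diagonal is
  handled by moving a single coordinate through infinitely many values. Vanishing is known only for
  coordinates in \<open>T\<close>, so the factorization is claimed only there.\<close>

lemma polyfun_divide_by_differences:
  fixes f :: "(nat \<Rightarrow> 'f::field) \<Rightarrow> 'f"
  assumes "finite P" "polyfun n (m + card P) f" "infinite T" "P \<subseteq> {(a, b). a < b \<and> b < n}"
    and "\<And>y a b. (\<And>i. y i \<in> T) \<Longrightarrow> (a, b) \<in> P \<Longrightarrow> y a = y b \<Longrightarrow> f y = 0"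
  shows "\<exists>g. polyfun n m g \<and> (\<forall>y. (\<forall>i. y i \<in> T) \<longrightarrow> f y = (\<Prod>(a, b)\<in>P. y a - y b) * g y)"
  using assms
proof (induction P arbitrary: f rule: finite_induct)
  case empty
  then show ?case by auto
next
  case (insert p P)
  obtain a b where p: "p = (a, b)" by (cases p)
  have ab: "a < b" "b < n" using insert.prems p by auto
  obtain g where g: "low_polyfun n (m + card (insert p P)) g"
    "\<forall>y. f y - f (y(a := y b)) = (y a - y b) * g y"
    using polyfun_divided_difference[OF insert.prems(1), of a b] ab by (meson less_trans)
  have g_deg: "polyfun n (m + card P) g"
    using g(1) insert.hyps by (intro low_polyfun_Suc) simp
  have f_eq: "f y = (y a - y b) * g y" if "\<And>i. y i \<in> T" for y
  proof -
    have "f (y(a := y b)) = 0"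
      using that p ab by (intro insert.prems(4)[of _ a b]) auto
    then show ?thesis using g(2) by (metis diff_zero)
  qed
  have zero_off: "g y = 0"
    if "\<And>i. y i \<in> T" "(c, d) \<in> P" "y c = y d" "y a \<noteq> y b" for y c d
    using f_eq[OF that(1)] insert.prems(4)[of y c d] that by auto
  have "g y = 0" if y: "\<And>i. y i \<in> T" and cd: "(c, d) \<in> P" "y c = y d" for y c d
  proof -
    have "c < d" using cd insert.prems by auto
    \<comment> \<open>Two different increasing pairs share at most one index, so one of
      \<open>a\<close>, \<open>b\<close> can move without disturbing
      \<open>y c = y d\<close>.\<close>
    have "\<exists>e. e \<notin> {c, d} \<and> e \<in> {a, b}"
      using \<open>c < d\<close> ab cd p insert.hyps by (metis insertCI insertE less_asym nat_neq_iff singletonD)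
    then obtain e where e: "e \<noteq> c" "e \<noteq> d" "e = a \<or> e = b" by auto
    define o' where "o' = (if e = a then b else a)"
    \<comment> \<open>Avoiding the value of the other coordinate keeps the moved point off the
      diagonal of \<open>a\<close> and \<open>b\<close>.\<close>
    have "infinite (T - {y o'})" using insert.prems by simp
    then show ?thesis
    proof (rule polyfun_zero_if_infinite[OF g_deg, where a = e])
      fix s assume "s \<in> T - {y o'}"
      then show "g (y(e := s)) = 0"
        using y cd e ab by (intro zero_off[of _ c d]) (auto simp: o'_def)
    qed
  qed
  then obtain h where h: "polyfun n m h"
    "\<forall>y. (\<forall>i. y i \<in> T) \<longrightarrow> g y = (\<Prod>(a, b)\<in>P. y a - y b) * h y"
    using insert.IH[OF g_deg insert.prems(2)] insert.prems(3) by blast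
  then show ?case
    using f_eq insert.hyps p by (intro exI[of _ h]) (auto simp: algebra_simps)
qed

section \<open>Symmetric polynomial functions and Newton interpolation at partitions\<close>

text \<open>The coefficients of the product of the X + \<open>y i\<close> are the elementary
  symmetric functions, coefficient \<open>j\<close> having degree \<open>n - j\<close>. Generating
  by them, instead of demanding invariance, provides the induction needed to add a variable.\<close>

inductive sfun :: "nat \<Rightarrow> nat \<Rightarrow> ((nat \<Rightarrow> 'f::field) \<Rightarrow> 'f) \<Rightarrow> bool" for n where
  sfun_const: "sfun n 0 (\<lambda>_. c)"
| sfun_gen: "j \<le> n \<Longrightarrow> sfun n (n - j) (\<lambda>y. coeff (\<Prod>i<n. [:y i, 1:]) j)"
| sfun_mono: "sfun n m f \<Longrightarrow> m \<le> m' \<Longrightarrow> sfun n m' f"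
| sfun_add: "sfun n m f \<Longrightarrow> sfun n m g \<Longrightarrow> sfun n m (\<lambda>y. f y + g y)"
| sfun_mult: "sfun n m f \<Longrightarrow> sfun n m' g \<Longrightarrow> sfun n (m + m') (\<lambda>y. f y * g y)"

lemma sfun_const': "sfun n m (\<lambda>_. c)"
  using sfun_mono[OF sfun_const] by simp

lemma sfun_cmult: "sfun n m f \<Longrightarrow> sfun n m (\<lambda>y. c * f y)"
  using sfun_mult[OF sfun_const[of n c], of m f] by simp

lemma sfun_sum: "(\<And>i. i \<in> A \<Longrightarrow> sfun n m (f i)) \<Longrightarrow> sfun n m (\<lambda>y. \<Sum>i\<in>A. f i y)"
  by (induction A rule: infinite_finite_induct)
    (auto intro: sfun_const' sfun_add)

lemma sfun_symmetric:
  assumes "sfun n m f" "\<pi> permutes {..<n}"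
  shows "f (\<lambda>i. y (\<pi> i)) = f y"
  using assms(1)
proof (induction rule: sfun.induct)
  case (sfun_gen j)
  have "(\<Prod>i<n. [:y (\<pi> i), 1:]) = (\<Prod>i<n. [:y i, 1:])"
    using prod.permute[OF assms(2), of "\<lambda>i. [:y i, 1:]"] by (simp add: o_def)
  then show ?case by simp
qed auto

lemma degree_prod_linear:
  fixes y :: "nat \<Rightarrow> 'f::field"
  shows "degree (\<Prod>i<n. [:y i, 1:]) = n"
  by (subst degree_prod_eq_sum_degree) auto

lemma coeff_prod_linear_Suc:
  fixes y :: "nat \<Rightarrow> 'f::field"
  shows "coeff (\<Prod>i<Suc n. [:y i, 1:]) j = y n * coeff (\<Prod>i<n. [:y i, 1:]) j +
    (if j = 0 then 0 else coeff (\<Prod>i<n. [:y i, 1:]) (j - 1))"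
  by (cases j) (auto simp: mult.commute)

text \<open>\<open>N\<close> is kept apart from \<open>n\<close> because the induction shortens the
  product while the ambient number of variables stays fixed.\<close>

lemma polyfun_coeff_prod_linear:
  assumes "n \<le> N" "j \<le> n"
  shows "polyfun N (n - j) (\<lambda>y :: nat \<Rightarrow> 'f::field. coeff (\<Prod>i<n. [:y i, 1:]) j)"
  using assms
proof (induction n arbitrary: j)
  case 0
  then show ?case by (auto intro: polyfun_const')
next
  case (Suc n)
  have "polyfun N (Suc n - j) (\<lambda>y :: nat \<Rightarrow> 'f. y n * coeff (\<Prod>i<n. [:y i, 1:]) j)"
  proof (cases "j \<le> n")
    case True
    then have "polyfun N (1 + (n - j)) (\<lambda>y :: nat \<Rightarrow> 'f. y n * coeff (\<Prod>i<n. [:y i, 1:]) j)"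
      using Suc by (intro polyfun_mult polyfun_var) auto
    then show ?thesis using True by (simp add: Suc_diff_le)
  next
    case False
    then have "coeff (\<Prod>i<n. [:y i, 1:]) j = 0" for y :: "nat \<Rightarrow> 'f"
      using degree_prod_linear[of y n] by (intro coeff_eq_0) simp
    then show ?thesis by (simp add: polyfun_const')
  qed
  moreover have "polyfun N (Suc n - j)
      (\<lambda>y :: nat \<Rightarrow> 'f. if j = 0 then 0 else coeff (\<Prod>i<n. [:y i, 1:]) (j - 1))"
    using Suc.IH[of "j - 1"] Suc.prems by (cases "j = 0") (auto intro: polyfun_const')
  ultimately show ?case
    unfolding coeff_prod_linear_Suc by (rule polyfun_add)
qed

lemma sfun_imp_polyfun: "sfun n m f \<Longrightarrow> polyfun n m f"
  by (induction rule: sfun.induct)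
    (auto intro: polyfun.intros polyfun_const' polyfun_coeff_prod_linear[OF order_refl])

text \<open>The product is the generating polynomial evaluated at \<open>-c\<close>, hence a
  combination of elementary symmetric functions.\<close>

lemma sfun_prod_diff: "sfun n n (\<lambda>y. \<Prod>i<n. y i - c)"
proof -
  have "(\<Prod>i<n. y i - c) = (\<Sum>j\<le>n. (-c) ^ j * coeff (\<Prod>i<n. [:y i, 1:]) j)" for y
  proof -
    have "(\<Prod>i<n. y i - c) = poly (\<Prod>i<n. [:y i, 1:]) (-c)"
      by (simp add: poly_prod)
    then show ?thesis
      by (simp add: poly_altdef degree_prod_linear mult.commute)
  qed
  moreover have "sfun n n (\<lambda>y. \<Sum>j\<le>n. (-c) ^ j * coeff (\<Prod>i<n. [:y i, 1:]) j)"
    by (intro sfun_sum sfun_cmult) (auto intro: sfun_mono[OF sfun_gen])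
  ultimately show ?thesis by presburger
qed

text \<open>If the additional variable equals c, elementary symmetric functions satisfy e_k(old) =
  e_k(new) - c e_(k-1)(old). Iterating this expresses the old ones through the new ones without
  raising the degree.\<close>

lemma sfun_lift:
  assumes "sfun n m f"
  shows "\<exists>g. sfun (Suc n) m g \<and> (\<forall>y. y n = c \<longrightarrow> g y = f y)"
  using assms
proof (induction rule: sfun.induct)
  case (sfun_const d)
  show ?case by (rule exI[of _ "\<lambda>_. d"]) (auto intro: sfun_const')
next
  case (sfun_gen j)
  have "\<exists>g. sfun (Suc n) (n - j) g \<and> (\<forall>y. y n = c \<longrightarrow> g y = coeff (\<Prod>i<n. [:y i, 1:]) j)"
    using sfun_gen
  \<comment> \<open>Downward induction on \<open>j\<close> is upward induction on the degree
    \<open>n - j\<close>.\<close>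
  proof (induction rule: inc_induct)
    case base
    have "coeff (\<Prod>i<n. [:y i, 1:]) n = 1" for y :: "nat \<Rightarrow> 'a"
      by (induction n) (auto simp: coeff_prod_linear_Suc degree_prod_linear coeff_eq_0)
    then show ?case by (intro exI[of _ "\<lambda>_. 1"]) (auto intro: sfun_const')
  next
    case (step j)
    then obtain g where g: "sfun (Suc n) (n - Suc j) g"
      "\<forall>y. y n = c \<longrightarrow> g y = coeff (\<Prod>i<n. [:y i, 1:]) (Suc j)" by auto
    have "sfun (Suc n) (Suc n - Suc j) (\<lambda>y. coeff (\<Prod>i<Suc n. [:y i, 1:]) (Suc j))"
      using step by (intro sfun.sfun_gen) simp
    then have "sfun (Suc n) (n - j)
        (\<lambda>y. coeff (\<Prod>i<Suc n. [:y i, 1:]) (Suc j) + (- c) * g y)"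
      using g(1) by (intro sfun_add sfun_cmult) (auto intro: sfun_mono)
    then show ?case
      using g(2) by (intro exI conjI) (auto simp del: prod.lessThan_Suc simp: coeff_prod_linear_Suc)
  qed
  then show ?case .
next
  case (sfun_mono m f m')
  then show ?case by (auto intro: sfun.sfun_mono)
next
  case (sfun_add m f g)
  then obtain f' g' where "sfun (Suc n) m f'" "sfun (Suc n) m g'"
    "\<forall>y. y n = c \<longrightarrow> f' y = f y" "\<forall>y. y n = c \<longrightarrow> g' y = g y" by blast
  then show ?case by (intro exI[of _ "\<lambda>y. f' y + g' y"]) (auto intro: sfun.sfun_add)
next
  case (sfun_mult m f m' g)
  then obtain f' g' where "sfun (Suc n) m f'" "sfun (Suc n) m' g'"
    "\<forall>y. y n = c \<longrightarrow> f' y = f y" "\<forall>y. y n = c \<longrightarrow> g' y = g y" by blast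
  then show ?case by (intro exI[of _ "\<lambda>y. f' y * g' y"]) (auto intro: sfun.sfun_mult)
qed

lemma parts_snoc: "\<kappa> @ [0] \<in> parts (Suc n) \<longleftrightarrow> \<kappa> \<in> parts n"
  by (auto simp: parts_def sorted_wrt_append)

lemma parts_map_Suc: "map Suc \<kappa> \<in> parts n \<longleftrightarrow> \<kappa> \<in> parts n"
  by (auto simp: parts_def sorted_wrt_map)

lemma sum_list_map_Suc: "sum_list (map Suc \<kappa>) = sum_list \<kappa> + length \<kappa>"
  by (induction \<kappa>) auto

text \<open>These cases drive the interpolation: delete an empty last row, or delete the first
  column.\<close>

lemma parts_Suc_cases:
  assumes "\<kappa> \<in> parts (Suc n)"
  obtains \<rho> where "\<kappa> = \<rho> @ [0]" "\<rho> \<in> parts n"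
  | \<rho> where "\<kappa> = map Suc \<rho>" "\<rho> \<in> parts (Suc n)"
proof -
  have len: "length \<kappa> = Suc n" and "sorted_wrt (\<ge>) \<kappa>" using assms by (auto simp: parts_def)
  then have min: "\<forall>x\<in>set \<kappa>. last \<kappa> \<le> x"
    by (cases \<kappa> rule: rev_cases) (auto simp: sorted_wrt_append)
  have ne: "\<kappa> \<noteq> []" using len by auto
  show thesis
  proof (cases "last \<kappa> = 0")
    case True
    then have *: "\<kappa> = butlast \<kappa> @ [0]" using ne by (metis append_butlast_last_id)
    then have "butlast \<kappa> \<in> parts n" using assms parts_snoc by metis
    then show thesis using that(1) * by blast
  next
    case False
    then have "\<forall>x\<in>set \<kappa>. x \<noteq> 0" using min by fastforce
    then have *: "\<kappa> = map Suc (map (\<lambda>x. x - 1) \<kappa>)"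
      by (induction \<kappa>) auto
    then have "map (\<lambda>x. x - 1) \<kappa> \<in> parts (Suc n)" using assms parts_map_Suc by metis
    then show thesis using that(2) * by blast
  qed
qed

text \<open>Newton interpolation: first match the values at partitions with last part \<open>0\<close> by lifting a
  function in one variable less, then correct by a multiple of \<open>\<Prod>\<^sub>i (y\<^sub>i - c)\<close>, which vanishes there.\<close>

lemma interpolation_sfun:
  fixes W :: "nat \<Rightarrow> nat \<Rightarrow> 'f::field"
  assumes inj: "\<And>r s r' s'. W r s = W r' s' \<Longrightarrow> r = r' \<and> s = s'"
  shows "\<exists>f. sfun n m f \<and> (\<forall>\<kappa>\<in>parts n. sum_list \<kappa> \<le> m \<longrightarrow>
           f (\<lambda>i. W (r + \<kappa> ! i) (s + (n - 1 - i))) = v \<kappa>)"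
proof (induction n arbitrary: m r s v)
  case 0
  show ?case by (rule exI[of _ "\<lambda>_. v []"]) (auto simp: parts_def intro: sfun_const')
next
  case (Suc n)
  show ?case
  proof (induction m arbitrary: r v rule: less_induct)
    case (less m)
    \<comment> \<open>The offsets \<open>r\<close> and \<open>s\<close> record stripped columns and
      rows. Without the empty last row, each remaining row has one row more below it than its
      position tells, hence \<open>Suc s\<close>.\<close>
    obtain f0 where f0: "sfun n m f0"
      "\<forall>\<kappa>\<in>parts n. sum_list \<kappa> \<le> m \<longrightarrow>
        f0 (\<lambda>i. W (r + \<kappa> ! i) (Suc s + (n - 1 - i))) = v (\<kappa> @ [0])"
      using Suc.IH[of m r "Suc s" "\<lambda>\<kappa>. v (\<kappa> @ [0])"] by blast
    obtain g where g: "sfun (Suc n) m g" "\<forall>y. y n = W r s \<longrightarrow> g y = f0 y"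
      using sfun_lift[OF f0(1), of "W r s"] by blast
    define pt where "pt = (\<lambda>r \<kappa> i. W (r + \<kappa> ! i) (s + (Suc n - 1 - i)))"
    have g_val: "g (pt r (\<rho> @ [0])) = v (\<rho> @ [0])" if "\<rho> \<in> parts n" "sum_list \<rho> \<le> m" for \<rho>
    proof -
      have len: "length \<rho> = n" using that by (simp add: parts_def)
      then have "pt r (\<rho> @ [0]) n = W r s" by (simp add: pt_def nth_append)
      then have "g (pt r (\<rho> @ [0])) = f0 (pt r (\<rho> @ [0]))" using g(2) by blast
      also have "\<dots> = f0 (\<lambda>i. W (r + \<rho> ! i) (Suc s + (n - 1 - i)))"
        by (rule polyfun_cong[OF sfun_imp_polyfun[OF f0(1)]])
          (use len in \<open>auto simp: pt_def nth_append Suc_diff_Suc\<close>)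
      finally show ?thesis using f0(2) that by simp
    qed
    show ?case
    proof (cases "m < Suc n")
      case True
      have "g (pt r \<kappa>) = v \<kappa>" if \<kappa>: "\<kappa> \<in> parts (Suc n)" "sum_list \<kappa> \<le> m" for \<kappa>
        using \<kappa>(1)
      proof (cases rule: parts_Suc_cases)
        case (1 \<rho>)
        then show ?thesis using g_val[of \<rho>] \<kappa> by simp
      next
        case (2 \<rho>)
        then have "sum_list \<kappa> \<ge> Suc n" by (simp add: sum_list_map_Suc parts_def)
        then show ?thesis using True \<kappa> by simp
      qed
      then show ?thesis using g(1) by (auto simp: pt_def intro!: exI[of _ g])
    next
      case False
      define c where "c = W r s"
      \<comment> \<open>At these points every row is longer than \<open>r\<close>, so injectivity of
        \<open>W\<close> makes all factors of the denominator nonzero.\<close>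
      define u where "u = (\<lambda>\<rho>. (v (map Suc \<rho>) - g (pt (Suc r) \<rho>)) / (\<Prod>i<Suc n. pt (Suc r) \<rho> i - c))"
      obtain h where h: "sfun (Suc n) (m - Suc n) h"
        "\<forall>\<rho>\<in>parts (Suc n). sum_list \<rho> \<le> m - Suc n \<longrightarrow> h (pt (Suc r) \<rho>) = u \<rho>"
        using less.IH[of "m - Suc n" "Suc r" u] False unfolding pt_def by auto
      define f where "f = (\<lambda>y. g y + (\<Prod>i<Suc n. y i - c) * h y)"
      have "sfun (Suc n) (Suc n + (m - Suc n)) (\<lambda>y. (\<Prod>i<Suc n. y i - c) * h y)"
        by (intro sfun_mult sfun_prod_diff h)
      then have "sfun (Suc n) m f" unfolding f_def
        using False by (intro sfun_add g) simp
      moreover have "f (pt r \<kappa>) = v \<kappa>" if \<kappa>: "\<kappa> \<in> parts (Suc n)" "sum_list \<kappa> \<le> m" for \<kappa>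
        using \<kappa>(1)
      proof (cases rule: parts_Suc_cases)
        case (1 \<rho>)
        have "pt r \<kappa> n = c" using 1 by (simp add: pt_def c_def nth_append parts_def)
        then show ?thesis using 1 g_val[of \<rho>] \<kappa> by (simp add: f_def)
      next
        case (2 \<rho>)
        then have len: "length \<rho> = Suc n" by (simp add: parts_def)
        have sz: "sum_list \<rho> \<le> m - Suc n" using \<kappa> 2 len by (simp add: sum_list_map_Suc)
        have eq: "pt r \<kappa> i = pt (Suc r) \<rho> i" if "i < Suc n" for i
          using that len 2 by (simp add: pt_def)
        have "f (pt r \<kappa>) = f (pt (Suc r) \<rho>)"
          by (rule polyfun_cong[OF sfun_imp_polyfun[OF \<open>sfun (Suc n) m f\<close>]]) (rule eq)
        moreover have "(\<Prod>i<Suc n. pt (Suc r) \<rho> i - c) \<noteq> 0"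
          using inj[of "Suc r + _" _ r s] by (auto simp: pt_def c_def simp del: prod.lessThan_Suc)
        ultimately show ?thesis
          using h(2) sz 2 by (simp add: f_def u_def del: prod.lessThan_Suc)
      qed
      ultimately show ?thesis by (auto simp: pt_def)
    qed
  qed
qed

section \<open>The lowering operator\<close>

text \<open>Reduction modulo z^2 = S z - P, where z is the variable \<open>N\<close>. Since
  \<open>S\<close> and \<open>P\<close> have degree at most one, replacing z^2 never raises the
  total degree, and the coefficient of z stays one degree lower.\<close>

lemma polyfun_mod_quadratic:
  assumes "polyfun (Suc N) m F" "polyfun N 1 S" "polyfun N 1 P"
  shows "\<exists>F0 F1. polyfun N m F0 \<and> low_polyfun N m F1 \<and>
           (\<forall>v. v N * v N = S v * v N - P v \<longrightarrow> F v = F0 v + v N * F1 v)"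
  using assms(1)
proof (induction rule: polyfun.induct)
  case (polyfun_const c)
  show ?case
    by (rule exI[of _ "\<lambda>_. c"], rule exI[of _ "\<lambda>_. 0"])
      (auto intro: polyfun_const' low_polyfun_zero)
next
  case (polyfun_var i)
  show ?case
  proof (cases "i = N")
    case True
    have "low_polyfun N 1 (\<lambda>_. 1 :: 'a)"
      unfolding low_polyfun_def by (auto intro: polyfun_const')
    then show ?thesis using True
      by (intro exI[of _ "\<lambda>_. 0"] exI[of _ "\<lambda>_. 1"]) (auto intro: polyfun_const')
  next
    case False
    then show ?thesis using polyfun_var
      by (intro exI[of _ "\<lambda>v. v i"] exI[of _ "\<lambda>_. 0"]) (auto intro: polyfun_var' low_polyfun_zero)
  qed
next
  case (polyfun_mono m f m')
  then show ?case by (meson polyfun.polyfun_mono low_polyfun_mono)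
next
  case (polyfun_add m f g)
  then obtain f0 f1 g0 g1 where *: "polyfun N m f0" "low_polyfun N m f1"
    "\<forall>v. v N * v N = S v * v N - P v \<longrightarrow> f v = f0 v + v N * f1 v"
    "polyfun N m g0" "low_polyfun N m g1"
    "\<forall>v. v N * v N = S v * v N - P v \<longrightarrow> g v = g0 v + v N * g1 v" by blast
  show ?case
    by (intro exI[of _ "\<lambda>v. f0 v + g0 v"] exI[of _ "\<lambda>v. f1 v + g1 v"] conjI
        polyfun.polyfun_add low_polyfun_add *) (use * in \<open>auto simp: distrib_left\<close>)
next
  case (polyfun_mult m f m' g)
  then obtain f0 f1 g0 g1 where *: "polyfun N m f0" "low_polyfun N m f1"
    "\<forall>v. v N * v N = S v * v N - P v \<longrightarrow> f v = f0 v + v N * f1 v"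
    "polyfun N m' g0" "low_polyfun N m' g1"
    "\<forall>v. v N * v N = S v * v N - P v \<longrightarrow> g v = g0 v + v N * g1 v" by blast
  have low: "low_polyfun N (m + m') (\<lambda>v. l v * f1 v * g1 v)" if "polyfun N 1 l" for l
    by (intro low_polyfun_mult' low_polyfun_linear_mult that *)
  show ?case
  proof (rule exI[of _ "\<lambda>v. f0 v * g0 v - P v * f1 v * g1 v"],
      rule exI[of _ "\<lambda>v. f0 v * g1 v + f1 v * g0 v + S v * f1 v * g1 v"], intro conjI allI impI)
    show "polyfun N (m + m') (\<lambda>v. f0 v * g0 v - P v * f1 v * g1 v)"
      by (intro polyfun_diff polyfun.polyfun_mult low_polyfun_imp_polyfun low assms *)
    show "low_polyfun N (m + m') (\<lambda>v. f0 v * g1 v + f1 v * g0 v + S v * f1 v * g1 v)"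
      by (intro low_polyfun_add low assms low_polyfun_mult low_polyfun_mult' *)
    fix v assume v: "v N * v N = S v * v N - P v"
    have "f v * g v = f0 v * g0 v + v N * (f0 v * g1 v + f1 v * g0 v) + (v N * v N) * (f1 v * g1 v)"
      using * v by (simp add: algebra_simps)
    then show "f v * g v = f0 v * g0 v - P v * f1 v * g1 v +
        v N * (f0 v * g1 v + f1 v * g0 v + S v * f1 v * g1 v)"
      unfolding v by (simp add: algebra_simps)
  qed
qed

lemma sum_Pow_insert:
  assumes "finite A" "k \<notin> A"
  shows "(\<Sum>I\<in>Pow (insert k A). f I) = (\<Sum>I\<in>Pow A. f I + f (insert k I))"
proof -
  have "inj_on (insert k) (Pow A)" using assms by (auto simp: inj_on_def)
  then show ?thesis using assms
    by (subst Pow_insert, subst sum.union_disjoint) (auto simp: sum.reindex sum.distrib)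
qed

definition index_pairs :: "nat \<Rightarrow> (nat \<times> nat) set" where
  "index_pairs n = {(i, j). i < j \<and> j < n}"

lemma finite_index_pairs [simp]: "finite (index_pairs n)"
  by (rule finite_subset[of _ "{..<n} \<times> {..<n}"]) (auto simp: index_pairs_def)

text \<open>An adjacent swap reverses exactly one pair and permutes the others among the increasing
  pairs.\<close>

lemma prod_pairs_adjacent_transpose:
  fixes u :: "nat \<Rightarrow> 'f::field"
  assumes "Suc k < n" "tr = transpose k (Suc k)"
  shows "(\<Prod>(i, j)\<in>index_pairs n. u (tr i) - u (tr j)) = - (\<Prod>(i, j)\<in>index_pairs n. u i - u j)"
proof -
  define Q where "Q = index_pairs n - {(k, Suc k)}"
  have fin: "finite Q" "(k, Suc k) \<notin> Q" by (auto simp: Q_def)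
  have split: "index_pairs n = insert (k, Suc k) Q"
    using assms by (auto simp: Q_def index_pairs_def)
  have "(\<Prod>(i, j)\<in>Q. u (tr i) - u (tr j)) = (\<Prod>(i, j)\<in>Q. u i - u j)"
    by (rule prod.reindex_bij_witness[of _ "\<lambda>(i, j). (tr i, tr j)" "\<lambda>(i, j). (tr i, tr j)"])
      (use assms in \<open>auto simp: Q_def index_pairs_def transpose_def split: if_splits\<close>)
  then show ?thesis
    using fin assms by (simp add: split algebra_simps)
qed

definition symmetric_fun :: "nat \<Rightarrow> ((nat \<Rightarrow> 'f) \<Rightarrow> 'f) \<Rightarrow> bool" where
  "symmetric_fun n f \<longleftrightarrow> (\<forall>\<pi> y. \<pi> permutes {..<n} \<longrightarrow> f (\<lambda>i. y (\<pi> i)) = f y)"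

text \<open>A site \<open>(r, s)\<close> is a row of length \<open>r\<close> with \<open>s\<close> rows below it. The two roots \<open>z0\<close>, \<open>z1\<close> of a
  quadratic equation over the polynomials in \<open>Y\<close> mark a kept and a lowered row, with weights
  \<open>\<phi>0\<close>, \<open>\<phi>1\<close>; the moment conditions turn the weighted sum over both roots into a polynomial in \<open>Y\<close>
  without raising the degree. The free parameter \<open>\<sigma>\<close> is the only site that has to be lowered.\<close>

locale lowering_operator =
  fixes Y W z0 z1 \<phi>0 \<phi>1 :: "nat \<times> nat \<Rightarrow> 'f::field"
    and A B \<eta> \<theta> c \<beta>0 \<beta>1 S0 S1 P0 P1 :: 'f and \<sigma> :: "nat \<times> nat"
  assumes Y_inj: "inj Y"
    and z_sum: "z0 p + z1 p = S0 + S1 * Y p"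
    and z_prod: "z0 p * z1 p = P0 + P1 * Y p"
    and \<phi>_sum: "\<phi>0 p + \<phi>1 p = c"
    and \<phi>_moment: "\<phi>0 p * z0 p + \<phi>1 p * z1 p = \<beta>0 + \<beta>1 * Y p"
    and W_stay: "A * Y p + B * z0 p = W p"
    and W_lower: "A * Y (Suc r, s) + B * z1 (Suc r, s) = W (r, s)"
    and pair_zero: "\<eta> * (Y (r, Suc s) - Y (r, s)) + \<theta> * (z1 (r, Suc s) - z0 (r, s)) = 0"
    and pair_nonzero: "s \<noteq> s' \<Longrightarrow> \<eta> * (Y (r, s) - Y (r', s')) + \<theta> * (z0 (r, s) - z0 (r', s')) \<noteq> 0"
    and \<phi>1_origin: "\<phi>1 (0, 0) = 0"
    and \<phi>0_zero_iff: "\<phi>0 p = 0 \<longleftrightarrow> p = \<sigma>"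
begin

definition zval :: "nat set \<Rightarrow> (nat \<Rightarrow> nat \<times> nat) \<Rightarrow> nat \<Rightarrow> 'f" where
  "zval I w i = (if i \<in> I then z1 (w i) else z0 (w i))"

definition weight :: "nat set \<Rightarrow> (nat \<Rightarrow> nat \<times> nat) \<Rightarrow> nat \<Rightarrow> 'f" where
  "weight I w i = (if i \<in> I then \<phi>1 (w i) else \<phi>0 (w i))"

definition pair_factor :: "nat set \<Rightarrow> (nat \<Rightarrow> nat \<times> nat) \<Rightarrow> nat \<Rightarrow> nat \<Rightarrow> 'f" where
  "pair_factor I w i j = \<eta> * (Y (w i) - Y (w j)) + \<theta> * (zval I w i - zval I w j)"

text \<open>The summand for lowering the rows in \<open>I\<close>, multiplied by the Vandermonde
  product; the quotients of pair factors by differences of \<open>Y\<close> are the interaction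
  coefficients of the operator.\<close>

definition numer_term :: "nat \<Rightarrow> ((nat \<Rightarrow> 'f) \<Rightarrow> 'f) \<Rightarrow> (nat \<Rightarrow> nat \<times> nat) \<Rightarrow> nat set \<Rightarrow> 'f" where
  "numer_term n f w I = (\<Prod>i<n. weight I w i) * ((\<Prod>(i, j)\<in>index_pairs n. pair_factor I w i j) *
     f (\<lambda>i. A * Y (w i) + B * zval I w i))"

definition numer :: "nat \<Rightarrow> ((nat \<Rightarrow> 'f) \<Rightarrow> 'f) \<Rightarrow> (nat \<Rightarrow> nat \<times> nat) \<Rightarrow> 'f" where
  "numer n f w = (\<Sum>I\<in>Pow {..<n}. numer_term n f w I)"

definition vandermonde :: "nat \<Rightarrow> (nat \<Rightarrow> nat \<times> nat) \<Rightarrow> 'f" where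
  "vandermonde n w = (\<Prod>(i, j)\<in>index_pairs n. Y (w i) - Y (w j))"

lemma vandermonde_nonzero:
  assumes "inj_on w {..<n}"
  shows "vandermonde n w \<noteq> 0"
proof -
  have "Y (w i) - Y (w j) \<noteq> 0" if "(i, j) \<in> index_pairs n" for i j
    using that inj_onD[OF assms, of i j] injD[OF Y_inj, of "w i" "w j"]
    by (auto simp: index_pairs_def)
  then show ?thesis unfolding vandermonde_def by (subst prod_zero_iff) auto
qed

text \<open>The root variables are eliminated one by one. Once F is reduced to F0 + z F1, the
  weighted sum over both roots is c F0 + (\<beta>0 + \<beta>1 Y) F1, and the linear factor is paid
  for by the lower degree of F1. Coordinates below \<open>n\<close> hold the \<open>Y\<close>
  values, coordinate \<open>n + i\<close> the root chosen for row i.\<close>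

lemma polyfun_eliminate:
  assumes "polyfun (n + k) m F" "k \<le> n"
  shows "\<exists>q. polyfun n m q \<and> (\<forall>w. q (\<lambda>i. Y (w i)) = (\<Sum>I\<in>Pow {..<k}.
           (\<Prod>i<k. weight I w i) * F (\<lambda>i. if i < n then Y (w i) else zval I w (i - n))))"
  using assms
proof (induction k arbitrary: F)
  case 0
  have "F (\<lambda>i. Y (w i)) = F (\<lambda>i. if i < n then Y (w i) else zval {} w (i - n))" for w
    by (rule polyfun_cong[OF 0(1)]) simp
  then show ?case using 0 unfolding lessThan_0 Pow_empty by (intro exI[of _ F]) auto
next
  case (Suc k)
  then have k: "k < n" by simp
  obtain F0 F1 where F: "polyfun (n + k) m F0" "low_polyfun (n + k) m F1"
    "\<And>v. v (n + k) * v (n + k) = (S0 + S1 * v k) * v (n + k) - (P0 + P1 * v k) \<Longrightarrow>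
      F v = F0 v + v (n + k) * F1 v"
  proof -
    have "polyfun (n + k) 1 (\<lambda>v. a + b * v k)" for a b :: 'f
      using k by (intro polyfun_add polyfun_cmult polyfun_const' polyfun_var') auto
    then show thesis
      using polyfun_mod_quadratic[of "n + k" m F "\<lambda>v. S0 + S1 * v k" "\<lambda>v. P0 + P1 * v k"] Suc.prems that
      by (metis add_Suc_right)
  qed
  define F' where "F' = (\<lambda>v. c * F0 v + (\<beta>0 + \<beta>1 * v k) * F1 v)"
  have "polyfun (n + k) m F'"
    unfolding F'_def using k
    by (intro polyfun_add polyfun_cmult low_polyfun_linear_mult polyfun_const' polyfun_var' F) auto
  then obtain q where q: "polyfun n m q" "\<And>w. q (\<lambda>i. Y (w i)) = (\<Sum>I\<in>Pow {..<k}.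
      (\<Prod>i<k. weight I w i) * F' (\<lambda>i. if i < n then Y (w i) else zval I w (i - n)))"
    using Suc.IH[of F'] k by auto
  have "q (\<lambda>i. Y (w i)) = (\<Sum>I\<in>Pow {..<Suc k}. (\<Prod>i<Suc k. weight I w i) *
      F (\<lambda>i. if i < n then Y (w i) else zval I w (i - n)))" for w
  proof -
    define vec where "vec = (\<lambda>I i. if i < n then Y (w i) else zval I w (i - n))"
    \<comment> \<open>Whether the row is kept or lowered, its value is a root of the quadratic with
      coefficients from \<open>z_sum\<close> and \<open>z_prod\<close>.\<close>
    have quad: "F (vec I) = F0 (vec I) + vec I (n + k) * F1 (vec I)" for I
      using z_sum[of "w k"] z_prod[of "w k"] k
      by (intro F) (auto simp: vec_def zval_def algebra_simps simp flip: z_sum z_prod)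
    have "(\<Prod>i<Suc k. weight I w i) * F (vec I) +
        (\<Prod>i<Suc k. weight (insert k I) w i) * F (vec (insert k I)) =
        (\<Prod>i<k. weight I w i) * F' (vec I)" if I: "I \<in> Pow {..<k}" for I
    proof -
      have [simp]: "k \<notin> I" using I by auto
      have same: "vec (insert k I) i = vec I i" if "i < n + k" for i
        using that by (auto simp: vec_def zval_def)
      have 0: "F0 (vec (insert k I)) = F0 (vec I)" "F1 (vec (insert k I)) = F1 (vec I)"
        using polyfun_cong[OF F(1) same] polyfun_cong[OF low_polyfun_imp_polyfun[OF F(2)] same] by auto
      have 1: "(\<Prod>i<k. weight (insert k I) w i) = (\<Prod>i<k. weight I w i)"
        by (intro prod.cong) (auto simp: weight_def)
      have 2: "vec I (n + k) = z0 (w k)" "vec (insert k I) (n + k) = z1 (w k)" "vec I k = Y (w k)"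
        using k by (auto simp: vec_def zval_def)
      have 3: "weight I w k = \<phi>0 (w k)" "weight (insert k I) w k = \<phi>1 (w k)"
        by (auto simp: weight_def)
      show ?thesis
        unfolding F'_def quad 0 prod.lessThan_Suc 1 2 3
        by (simp add: \<phi>_sum[of "w k", symmetric] \<phi>_moment[of "w k", symmetric] algebra_simps)
    qed
    moreover have "(\<lambda>i. if i < n then Y (w i) else zval I w (i - n)) = vec I" for I
      by (simp add: vec_def)
    ultimately show ?thesis
      unfolding q(2) lessThan_Suc by (subst sum_Pow_insert) (auto simp: lessThan_Suc)
  qed
  then show ?case using q(1) by blast
qed

text \<open>Pair factors and arguments of \<open>f\<close> are linear in the \<open>Y\<close> values
  and the roots, so the degree is that of \<open>f\<close> plus one for each pair.\<close>

lemma numer_polyfun: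
  assumes "polyfun n m f"
  shows "\<exists>q. polyfun n (m + card (index_pairs n)) q \<and> (\<forall>w. q (\<lambda>i. Y (w i)) = numer n f w)"
proof -
  define F where "F = (\<lambda>v. (\<Prod>p\<in>index_pairs n. \<eta> * (v (fst p) - v (snd p)) +
      \<theta> * (v (n + fst p) - v (n + snd p))) * f (\<lambda>i. A * v i + B * v (n + i)))"
  have "polyfun (n + n) (card (index_pairs n) + m) F"
    unfolding F_def
    by (intro polyfun_mult polyfun_prod polyfun_add polyfun_cmult polyfun_diff polyfun_var'
        polyfun_subst[OF assms]) (auto simp: index_pairs_def)
  then obtain q where q: "polyfun n (card (index_pairs n) + m) q"
    "\<And>w. q (\<lambda>i. Y (w i)) = (\<Sum>I\<in>Pow {..<n}.
       (\<Prod>i<n. weight I w i) * F (\<lambda>i. if i < n then Y (w i) else zval I w (i - n)))"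
    using polyfun_eliminate by blast
  have "(\<Prod>i<n. weight I w i) * F (\<lambda>i. if i < n then Y (w i) else zval I w (i - n)) =
      numer_term n f w I" for w I
    unfolding F_def numer_term_def
    by (intro arg_cong2[of _ _ _ _ "(*)"] refl prod.cong polyfun_cong[OF assms])
      (auto simp: index_pairs_def pair_factor_def)
  then show ?thesis using q by (auto simp: numer_def add.commute)
qed

text \<open>The swap is absorbed by relabelling the sets of lowered rows. Weights and
  \<open>f\<close> are unaffected; the pair factors are differences of one quantity per row, so
  their product changes sign like a Vandermonde product.\<close>

lemma numer_antisymmetric:
  assumes sym: "symmetric_fun n f"
    and k: "Suc k < n" and tr: "tr = transpose k (Suc k)"
  shows "numer n f (\<lambda>i. w (tr i)) = - numer n f w"
proof -
  have perm: "tr permutes {..<n}" using k tr by (auto intro: permutes_swap_id)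
  have inv: "tr (tr i) = i" for i using tr by simp
  have mem: "i \<in> tr ` J \<longleftrightarrow> tr i \<in> J" for i J using inv by (metis image_iff)
  have "numer_term n f (\<lambda>i. w (tr i)) (tr ` J) = - numer_term n f w J" for J
  proof -
    have "(\<Prod>i<n. weight (tr ` J) (\<lambda>i. w (tr i)) i) = (\<Prod>i<n. weight J w i)"
      using prod.permute[OF perm, of "weight J w"] by (simp add: weight_def mem o_def)
    moreover have "(\<Prod>(i, j)\<in>index_pairs n. pair_factor (tr ` J) (\<lambda>i. w (tr i)) i j) =
        - (\<Prod>(i, j)\<in>index_pairs n. pair_factor J w i j)"
    proof -
      define u where "u = (\<lambda>i. \<eta> * Y (w i) + \<theta> * zval J w i)"
      have "pair_factor (tr ` J) (\<lambda>i. w (tr i)) i j = u (tr i) - u (tr j)"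
        "pair_factor J w i j = u i - u j" for i j
        by (simp_all add: pair_factor_def zval_def mem u_def algebra_simps)
      then show ?thesis using prod_pairs_adjacent_transpose[OF k tr, of u] by simp
    qed
    moreover have "f (\<lambda>i. A * Y (w (tr i)) + B * zval (tr ` J) (\<lambda>i. w (tr i)) i) =
        f (\<lambda>i. A * Y (w i) + B * zval J w i)"
      using sym[unfolded symmetric_fun_def, rule_format, OF perm,
          of "\<lambda>i. A * Y (w i) + B * zval J w i"] by (simp add: zval_def mem)
    ultimately show ?thesis by (simp add: numer_term_def)
  qed
  moreover have "(\<Sum>I\<in>Pow {..<n}. numer_term n f (\<lambda>i. w (tr i)) I) =
      (\<Sum>J\<in>Pow {..<n}. numer_term n f (\<lambda>i. w (tr i)) (tr ` J))"
  proof -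
    have img: "tr ` J \<in> Pow {..<n}" if "J \<in> Pow {..<n}" for J
      using that permutes_image[OF perm] by (metis PowD PowI image_mono)
    show ?thesis
      by (rule sum.reindex_bij_witness[of _ "\<lambda>J. tr ` J" "\<lambda>J. tr ` J"])
        (use img in \<open>auto simp: image_image inv simp del: Pow_iff\<close>)
  qed
  ultimately show ?thesis by (simp add: numer_def sum_negf)
qed

text \<open>Swapping adjacent equal rows has no effect, so the numerator equals its own negative;
  this is where characteristic two is excluded. Equal rows further apart are brought together by
  adjacent swaps.\<close>

lemma numer_eq_0:
  assumes sym: "symmetric_fun n f"
    and char: "(2 :: 'f) \<noteq> 0" and "a < b" "b < n" "w a = w b"
  shows "numer n f w = 0"
  using assms(3-5)
proof (induction b arbitrary: w)
  case (Suc b)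
  define tr where "tr = transpose b (Suc b)"
  have anti: "numer n f (\<lambda>i. w (tr i)) = - numer n f w"
    using numer_antisymmetric[OF sym _ tr_def] Suc.prems by blast
  show ?case
  proof (cases "a = b")
    case True
    then have "(\<lambda>i. w (tr i)) = w" using Suc.prems by (auto simp: tr_def transpose_def)
    then have "numer n f w = - numer n f w" using anti by simp
    then have "2 * numer n f w = 0" by (metis add.right_inverse mult_2)
    then show ?thesis using char by simp
  next
    case False
    then have "numer n f (\<lambda>i. w (tr i)) = 0"
      using Suc.prems by (intro Suc.IH) (auto simp: tr_def transpose_def)
    then show ?thesis using anti by simp
  qed
qed simp

text \<open>The operator sends a symmetric polynomial function of degree \<open>m\<close> in the \<open>W\<close> to one in the
  \<open>Y\<close>: after clearing denominators it is antisymmetric, hence divisible by the Vandermonde product.\<close>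

lemma operator_polyfun:
  assumes f: "polyfun n m f" and sym: "symmetric_fun n f"
    and char: "(2 :: 'f) \<noteq> 0"
  obtains g where "polyfun n m g"
    "\<And>w. numer n f w = vandermonde n w * g (\<lambda>i. Y (w i))"
proof -
  obtain q where q: "polyfun n (m + card (index_pairs n)) q"
    "\<And>w. q (\<lambda>i. Y (w i)) = numer n f w"
    using numer_polyfun[OF f] by blast
  have inf: "infinite (range Y)"
    using Y_inj finite_imageD infinite_UNIV_char_0 finite_prod by blast
  have "q y = 0" if y: "\<And>i. y i \<in> range Y" and ab: "(a, b) \<in> index_pairs n" "y a = y b" for y a b
  proof -
    define w where "w = (\<lambda>i. inv Y (y i))"
    have "y = (\<lambda>i. Y (w i))" using y by (auto simp: w_def f_inv_into_f)
    moreover have "numer n f w = 0"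
      by (rule numer_eq_0[OF sym char, of a b]) (use ab in \<open>auto simp: w_def index_pairs_def\<close>)
    ultimately show ?thesis using q(2) by simp
  qed
  then have "\<exists>g. polyfun n m g \<and>
    (\<forall>y. (\<forall>i. y i \<in> range Y) \<longrightarrow> q y = (\<Prod>(a, b)\<in>index_pairs n. y a - y b) * g y)"
    by (intro polyfun_divide_by_differences[OF finite_index_pairs q(1) inf])
      (auto simp: index_pairs_def)
  then obtain g where g: "polyfun n m g"
    "\<forall>y. (\<forall>i. y i \<in> range Y) \<longrightarrow> q y = (\<Prod>(a, b)\<in>index_pairs n. y a - y b) * g y"
    by blast
  have "numer n f w = vandermonde n w * g (\<lambda>i. Y (w i))" for w
    unfolding vandermonde_def using g(2) q(2) by fastforce
  then show thesis using that g(1) by blast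
qed

end

section \<open>The operator evaluated at the grid points of partitions\<close>

definition site :: "nat \<Rightarrow> nat list \<Rightarrow> nat \<Rightarrow> nat \<times> nat" where
  "site n \<rho> i = (\<rho> ! i, n - 1 - i)"

definition lower :: "nat set \<Rightarrow> nat list \<Rightarrow> nat list" where
  "lower I \<rho> = map (\<lambda>i. if i \<in> I then \<rho> ! i - 1 else \<rho> ! i) [0..<length \<rho>]"

lemma parts_iff_nth: "\<rho> \<in> parts n \<longleftrightarrow> length \<rho> = n \<and> (\<forall>i. Suc i < n \<longrightarrow> \<rho> ! Suc i \<le> \<rho> ! i)"
  by (auto simp: parts_def sorted_wrt_iff_nth_Suc_transp transp_on_def)

lemma parts_nth_mono: "\<rho> \<in> parts n \<Longrightarrow> i \<le> j \<Longrightarrow> j < n \<Longrightarrow> \<rho> ! j \<le> \<rho> ! i"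
  by (cases "i = j") (auto simp: parts_def sorted_wrt_iff_nth_less)

lemma length_parts: "\<rho> \<in> parts n \<Longrightarrow> length \<rho> = n"
  by (simp add: parts_def)

lemma sum_list_lower:
  assumes "I \<subseteq> {..<length \<rho>}" "\<And>i. i \<in> I \<Longrightarrow> 0 < \<rho> ! i"
  shows "sum_list (lower I \<rho>) + card I = sum_list \<rho>"
proof -
  have "sum_list (lower I \<rho>) + card I =
      (\<Sum>i<length \<rho>. (if i \<in> I then \<rho> ! i - 1 else \<rho> ! i) + (if i \<in> I then 1 else 0))"
    using assms(1) by (simp add: lower_def interv_sum_list_conv_sum_set_nat atLeast0LessThan
        sum.distrib sum.If_cases Int_absorb1 Int_absorb2)
  also have "\<dots> = (\<Sum>i<length \<rho>. \<rho> ! i)"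
    using assms(2) by (intro sum.cong) (auto simp: Suc_leI)
  finally show ?thesis by (simp add: sum_list_sum_nth atLeast0LessThan)
qed

text \<open>Symmetry is asked for only at permuted grid points of partitions: the quotient by the
  Vandermonde product is known to be symmetric where that product is nonzero. Averaging later yields
  a symmetric Laurent polynomial with the same values.\<close>

definition vanishing_interpolant ::
  "nat \<Rightarrow> (nat \<times> nat \<Rightarrow> 'f::field) \<Rightarrow> nat list \<Rightarrow> nat list \<Rightarrow> bool" where
  "vanishing_interpolant n Y \<mu> \<kappa> \<longleftrightarrow> (\<exists>g. polyfun n (sum_list \<mu>) g \<and>
     (\<forall>\<rho>\<in>parts n. \<forall>\<pi>. \<pi> permutes {..<n} \<longrightarrow> g (\<lambda>i. Y (site n \<rho> (\<pi> i))) = g (\<lambda>i. Y (site n \<rho> i))) \<and>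
     (\<forall>\<rho>\<in>parts n. sum_list \<rho> \<le> sum_list \<mu> \<longrightarrow>
       g (\<lambda>i. Y (site n \<rho> i)) = (if \<rho> = \<mu> then 1 else 0)) \<and>
     g (\<lambda>i. Y (site n \<kappa> i)) = 0)"

context lowering_operator
begin

text \<open>Lowering a set of rows that does not leave a partition gives a vanishing term: \<open>\<phi>1\<close> kills
  lowering a zero last row, a pair factor kills lowering a row but not the equal next one.\<close>

lemma numer_term_site:
  assumes f: "polyfun n m f" and \<rho>: "\<rho> \<in> parts n" and I: "I \<subseteq> {..<n}"
    and nz: "numer_term n f (site n \<rho>) I \<noteq> 0"
  shows "lower I \<rho> \<in> parts n" "\<And>i. i \<in> I \<Longrightarrow> 0 < \<rho> ! i"
    "f (\<lambda>i. A * Y (site n \<rho> i) + B * zval I (site n \<rho>) i) = f (\<lambda>i. W (site n (lower I \<rho>) i))"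
proof -
  have weight_nz: "weight I (site n \<rho>) i \<noteq> 0" if "i < n" for i
    using nz that by (auto simp: numer_term_def)
  have pair_nz: "pair_factor I (site n \<rho>) i j \<noteq> 0" if "i < j" "j < n" for i j
  proof
    assume "pair_factor I (site n \<rho>) i j = 0"
    then have "(\<Prod>(i, j)\<in>index_pairs n. pair_factor I (site n \<rho>) i j) = 0"
      using that by (intro prod_zero[OF finite_index_pairs] bexI[of _ "(i, j)"]) (auto simp: index_pairs_def)
    then show False using nz by (simp add: numer_term_def)
  qed
  have next_row: "Suc i \<in> I" if "i \<in> I" "Suc i < n" "\<rho> ! Suc i = \<rho> ! i" for i
  proof (rule ccontr)
    assume "Suc i \<notin> I"
    then have "pair_factor I (site n \<rho>) i (Suc i) = 0"
      using that pair_zero[of "\<rho> ! i" "n - 1 - Suc i"]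
      by (simp add: pair_factor_def site_def zval_def Suc_diff_Suc)
    then show False using pair_nz that by auto
  qed
  have pos: "0 < \<rho> ! i" if "i \<in> I" for i
  proof (rule ccontr)
    assume "\<not> 0 < \<rho> ! i"
    then have zero: "\<rho> ! j = 0" if "i \<le> j" "j < n" for j
      using parts_nth_mono[OF \<rho> that] by simp
    have "j < n \<longrightarrow> j \<in> I" if "i \<le> j" for j
      using that
    proof (induction j rule: dec_induct)
      case (step j)
      then show ?case using next_row[of j] zero[of j] zero[of "Suc j"] by auto
    qed (use \<open>i \<in> I\<close> in auto)
    then have "n - 1 \<in> I" "\<rho> ! (n - 1) = 0" "n - 1 < n"
      using zero[of "n - 1"] that I by auto
    then have "weight I (site n \<rho>) (n - 1) = 0"
      using \<phi>1_origin by (simp add: weight_def site_def)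
    then show False using weight_nz \<open>n - 1 < n\<close> by auto
  qed
  show "\<And>i. i \<in> I \<Longrightarrow> 0 < \<rho> ! i" by (rule pos)
  have len: "length \<rho> = n" using \<rho> by (simp add: length_parts)
  \<comment> \<open>Only equal consecutive rows could end up in the wrong order, and
    \<open>next_row\<close> excludes lowering just the upper one.\<close>
  have "lower I \<rho> ! Suc i \<le> lower I \<rho> ! i" if "Suc i < n" for i
    using parts_nth_mono[OF \<rho> _ that, of i] next_row[OF _ that] that len
    by (cases "\<rho> ! Suc i = \<rho> ! i") (auto simp: lower_def)
  then show "lower I \<rho> \<in> parts n" using len by (simp add: parts_iff_nth lower_def)
  show "f (\<lambda>i. A * Y (site n \<rho> i) + B * zval I (site n \<rho>) i) = f (\<lambda>i. W (site n (lower I \<rho>) i))"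
  proof (rule polyfun_cong[OF f])
    fix i assume "i < n"
    then show "A * Y (site n \<rho> i) + B * zval I (site n \<rho>) i = W (site n (lower I \<rho>) i)"
      using len pos[of i] W_lower[of "\<rho> ! i - 1" "n - 1 - i"] W_stay[of "site n \<rho> i"]
      by (auto simp: lower_def site_def zval_def)
  qed
qed

text \<open>Under an adjacent swap numerator and Vandermonde product both change sign, and the
  latter is nonzero at distinct sites, so it cancels. The transposition of a and b + 1 is that of a
  and b conjugated by an adjacent one, and transpositions generate all permutations.\<close>

lemma operator_symmetric:
  assumes num: "\<And>w. numer n f w = vandermonde n w * g (\<lambda>i. Y (w i))"
    and sym: "symmetric_fun n f" and \<pi>: "\<pi> permutes {..<n}" and inj: "inj_on w {..<n}"
  shows "g (\<lambda>i. Y (w (\<pi> i))) = g (\<lambda>i. Y (w i))"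
proof -
  have adjacent: "g (\<lambda>i. Y (w (transpose k (Suc k) i))) = g (\<lambda>i. Y (w i))"
    if k: "Suc k < n" and inj: "inj_on w {..<n}" for k w
  proof -
    have "vandermonde n (\<lambda>i. w (transpose k (Suc k) i)) = - vandermonde n w"
      unfolding vandermonde_def
      using prod_pairs_adjacent_transpose[OF k refl, of "\<lambda>i. Y (w i)"] by simp
    then show ?thesis
      using numer_antisymmetric[OF sym k refl, of w] vandermonde_nonzero[OF inj] by (simp add: num)
  qed
  have swap: "g (\<lambda>i. Y (w (transpose a b i))) = g (\<lambda>i. Y (w i))"
    if "a < b" "b < n" "inj_on w {..<n}" for a b w
    using that
  proof (induction b arbitrary: w)
    case (Suc b)
    define tr where "tr = transpose b (Suc b)"
    have perm: "tr permutes {..<n}" using Suc.prems by (auto simp: tr_def intro: permutes_swap_id)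
    have inj_comp: "inj_on (\<lambda>i. w (\<pi> i)) {..<n}" if "\<pi> permutes {..<n}" for \<pi>
      using comp_inj_on[OF permutes_inj_on[OF that], of w "{..<n}"] Suc.prems
        permutes_image[OF that] by (simp add: o_def)
    show ?case
    proof (cases "a = b")
      case True
      then show ?thesis using adjacent Suc.prems by simp
    next
      case False
      then have ab: "a < b" "b < n" using Suc.prems by auto
      have "transpose a b permutes {..<n}" using ab by (auto intro: permutes_swap_id)
      have decomp: "transpose a (Suc b) i = tr (transpose a b (tr i))" for i
        using ab by (auto simp: tr_def transpose_def)
      have "g (\<lambda>i. Y (w (transpose a (Suc b) i))) = g (\<lambda>i. Y (w (tr (transpose a b i))))"
        unfolding decomp
        by (rule adjacent[of b "\<lambda>i. w (tr (transpose a b i))", folded tr_def])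
          (use Suc.prems inj_comp[OF permutes_compose[OF \<open>transpose a b permutes {..<n}\<close> perm]] in
            \<open>simp_all add: o_def\<close>)
      also have "\<dots> = g (\<lambda>i. Y (w (tr i)))"
        using Suc.IH[OF ab inj_comp[OF perm]] by simp
      also have "\<dots> = g (\<lambda>i. Y (w i))"
        unfolding tr_def by (rule adjacent) (use Suc.prems in auto)
      finally show ?thesis .
    qed
  qed simp
  have swap': "g (\<lambda>i. Y (w (transpose a b i))) = g (\<lambda>i. Y (w i))"
    if "a \<noteq> b" "a < n" "b < n" "inj_on w {..<n}" for a b w
  proof (cases "a < b")
    case False
    then show ?thesis
      using swap[of b a w] that by (simp only: transpose_commute[of a b])
  qed (use swap that in blast)
  show ?thesis
    using \<pi> finite_lessThan inj
  proof (induction arbitrary: w rule: permutes_induct)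
    case (swap a b p)
    have perm: "transpose a b permutes {..<n}" using swap.hyps by (auto intro: permutes_swap_id)
    have "inj_on (\<lambda>i. w (transpose a b i)) {..<n}"
      using comp_inj_on[OF permutes_inj_on[OF perm], of w "{..<n}"] swap.prems
        permutes_image[OF perm] by (simp add: o_def)
    from swap.IH[OF this] have "g (\<lambda>i. Y (w ((transpose a b \<circ> p) i))) = g (\<lambda>i. Y (w (transpose a b i)))"
      by simp
    also have "\<dots> = g (\<lambda>i. Y (w i))"
      using swap' swap.hyps swap.prems by simp
    finally show ?case .
  qed simp
qed


text \<open>The witness is the rescaled image of an interpolant on the \<open>W\<close> grid. At
  \<open>\<kappa>\<close> and at all partitions of size at most that of \<open>\<mu>\<close>, a
  lowered partition is small enough for the interpolation conditions and is never
  \<open>\<mu>\<close>, so only the term keeping all rows survives. The choice of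
  \<open>\<sigma>\<close> kills it at \<open>\<kappa>\<close>; among the small partitions it is
  nonzero exactly at \<open>\<mu>\<close>.\<close>

lemma operator_interpolation:
  assumes W_inj: "inj W" and char: "(2 :: 'f) \<noteq> 0"
    and \<mu>: "\<mu> \<in> parts n" and \<kappa>: "\<kappa> \<in> parts n" and size: "sum_list \<kappa> = sum_list \<mu> + 1"
    and not_contained: "\<not> contains \<kappa> \<mu>"
    and i0: "i0 < n" "\<kappa> ! i0 \<noteq> \<mu> ! i0" "\<sigma> = site n \<kappa> i0"
  shows "vanishing_interpolant n Y \<mu> \<kappa>"
proof -
  define m where "m = sum_list \<mu>"
  obtain f where f: "sfun n m f" "\<And>\<rho>. \<rho> \<in> parts n \<Longrightarrow> sum_list \<rho> \<le> m \<Longrightarrow>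
      f (\<lambda>i. W (site n \<rho> i)) = (if \<rho> = \<mu> then 1 else 0)"
    using interpolation_sfun[of "\<lambda>r s. W (r, s)" n m 0 0 "\<lambda>\<rho>. if \<rho> = \<mu> then 1 else 0"]
      injD[OF W_inj] by (auto simp: site_def)
  have sym: "symmetric_fun n f" using sfun_symmetric[OF f(1)] by (simp add: symmetric_fun_def)
  note poly_f = sfun_imp_polyfun[OF f(1)]
  obtain g where g: "polyfun n m g"
    "\<And>w. numer n f w = vandermonde n w * g (\<lambda>i. Y (w i))"
    using operator_polyfun[OF poly_f sym char] by blast
  have inj_site: "inj_on (site n \<rho>) {..<n}" for \<rho>
    by (auto simp: inj_on_def site_def)
  note vandermonde = vandermonde_nonzero[OF inj_site]
  have lowered: "numer_term n f (site n \<rho>) I = 0"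
    if \<rho>: "\<rho> \<in> parts n" and I: "I \<subseteq> {..<n}" "I \<noteq> {}"
      and small: "sum_list \<rho> \<le> m \<or> \<rho> = \<kappa>" for \<rho> I
  proof (rule ccontr)
    assume nz: "numer_term n f (site n \<rho>) I \<noteq> 0"
    note * = numer_term_site[OF poly_f \<rho> I(1) nz]
    have len: "length \<rho> = n" using \<rho> by (rule length_parts)
    have "card I > 0" using I finite_subset by (auto simp: card_gt_0_iff)
    moreover have "sum_list (lower I \<rho>) + card I = sum_list \<rho>"
      using I * len by (intro sum_list_lower) auto
    ultimately have less: "sum_list (lower I \<rho>) < sum_list \<rho>" by linarith
    have "lower I \<rho> \<noteq> \<mu>"
    proof
      assume eq: "lower I \<rho> = \<mu>"
      then have "\<rho> = \<kappa>" using less small m_def by auto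
      moreover have "contains \<rho> (lower I \<rho>)"
        by (auto simp: contains_def lower_def list_all2_conv_all_nth)
      ultimately show False using eq not_contained by simp
    qed
    moreover have "sum_list (lower I \<rho>) \<le> m" using less small size m_def by auto
    ultimately have "f (\<lambda>i. W (site n (lower I \<rho>) i)) = 0" using f(2) * by simp
    then show False using nz *(3) by (simp add: numer_term_def)
  qed
  have num: "numer n f (site n \<rho>) = numer_term n f (site n \<rho>) {}"
    if "\<rho> \<in> parts n" "sum_list \<rho> \<le> m \<or> \<rho> = \<kappa>" for \<rho>
  proof -
    have "numer n f (site n \<rho>) = (\<Sum>I\<in>{{}}. numer_term n f (site n \<rho>) I)"
      unfolding numer_def by (rule sum.mono_neutral_right) (use lowered that in auto)
    then show ?thesis by simp
  qed
  have term_empty: "numer_term n f (site n \<rho>) {} = (\<Prod>i<n. \<phi>0 (site n \<rho> i)) *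
      ((\<Prod>(i, j)\<in>index_pairs n. pair_factor {} (site n \<rho>) i j) * f (\<lambda>i. W (site n \<rho> i)))" for \<rho>
    by (simp add: numer_term_def weight_def zval_def W_stay)
  have small: "g (\<lambda>i. Y (site n \<rho> i)) = 0" if "\<rho> \<in> parts n" "sum_list \<rho> \<le> m" "\<rho> \<noteq> \<mu>" for \<rho>
    using num[OF that(1)] term_empty[of \<rho>] f(2)[OF that(1)] g(2)[of "site n \<rho>"] vandermonde[of \<rho>] that
    by simp
  have "\<phi>0 (site n \<kappa> i0) = 0" using \<phi>0_zero_iff i0 by simp
  then have "(\<Prod>i<n. \<phi>0 (site n \<kappa> i)) = 0" using i0 by (intro prod_zero) auto
  then have "numer n f (site n \<kappa>) = 0"
    unfolding num[OF \<kappa> disjI2[OF refl]] term_empty by (simp only: mult_zero_left)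
  then have at_\<kappa>: "g (\<lambda>i. Y (site n \<kappa> i)) = 0"
    using g(2)[of "site n \<kappa>"] vandermonde[of \<kappa>] by (metis mult_eq_0_iff)
  define a where "a = g (\<lambda>i. Y (site n \<mu> i))"
  have "a \<noteq> 0"
  proof -
    \<comment> \<open>The second component of a site identifies the row, and in row
      \<open>i0\<close> the two lengths differ; so every row of \<open>\<mu>\<close> has a nonzero
      weight for being kept.\<close>
    have "site n \<mu> i \<noteq> \<sigma>" if "i < n" for i
    proof (cases "i = i0")
      case False
      then have "n - 1 - i \<noteq> n - 1 - i0" using that i0 by arith
      then show ?thesis using i0 by (simp add: site_def)
    qed (use i0 in \<open>simp add: site_def\<close>)
    then have 1: "(\<Prod>i<n. \<phi>0 (site n \<mu> i)) \<noteq> 0" using \<phi>0_zero_iff by (subst prod_zero_iff) auto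
    have "pair_factor {} (site n \<mu>) i j \<noteq> 0" if "(i, j) \<in> index_pairs n" for i j
    proof -
      have "n - 1 - i \<noteq> n - 1 - j" using that unfolding index_pairs_def by auto
      then show ?thesis
        using pair_nonzero[of "n - 1 - i" "n - 1 - j" "\<mu> ! i" "\<mu> ! j"]
        by (simp add: pair_factor_def zval_def site_def)
    qed
    then have 2: "(\<Prod>(i, j)\<in>index_pairs n. pair_factor {} (site n \<mu>) i j) \<noteq> 0"
      by (subst prod_zero_iff) auto
    have "numer n f (site n \<mu>) \<noteq> 0"
      using num[OF \<mu>] term_empty[of \<mu>] 1 2 f(2)[OF \<mu>] m_def by simp
    then show ?thesis using g(2)[of "site n \<mu>"] by (auto simp: a_def)
  qed
  show ?thesis
    unfolding vanishing_interpolant_def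
  proof (intro exI[of _ "\<lambda>y. (1 / a) * g y"] conjI ballI allI impI)
    show "polyfun n (sum_list \<mu>) (\<lambda>y. (1 / a) * g y)"
      unfolding m_def[symmetric] by (intro polyfun_cmult g(1))
    show "(1 / a) * g (\<lambda>i. Y (site n \<rho> (\<pi> i))) = (1 / a) * g (\<lambda>i. Y (site n \<rho> i))"
      if "\<pi> permutes {..<n}" for \<rho> \<pi>
      using operator_symmetric[OF g(2) sym that inj_site] by simp
  qed (use small at_\<kappa> \<open>a \<noteq> 0\<close> in \<open>auto simp: a_def m_def\<close>)
qed

end

section \<open>Laurent polynomials\<close>

abbreviation coef :: "('a \<Rightarrow>\<^sub>0 'b::zero) \<Rightarrow> 'a \<Rightarrow> 'b" where
  "coef \<equiv> Poly_Mapping.lookup"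

abbreviation supp :: "('a \<Rightarrow>\<^sub>0 'b::zero) \<Rightarrow> 'a set" where
  "supp \<equiv> Poly_Mapping.keys"

definition exponent_size :: "(nat \<Rightarrow>\<^sub>0 int) \<Rightarrow> nat" where
  "exponent_size m = (\<Sum>i\<in>supp m. nat \<bar>coef m i\<bar>)"

definition monomial_value :: "(nat \<Rightarrow>\<^sub>0 int) \<Rightarrow> (nat \<Rightarrow> 'f::field) \<Rightarrow> 'f" where
  "monomial_value m x = (\<Prod>i\<in>supp m. x i powi coef m i)"

lemma exponent_size_superset:
  "finite A \<Longrightarrow> supp m \<subseteq> A \<Longrightarrow> exponent_size m = (\<Sum>i\<in>A. nat \<bar>coef m i\<bar>)"
  unfolding exponent_size_def by (rule sum.mono_neutral_left) (auto simp: in_keys_iff)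

lemma monomial_value_superset:
  "finite A \<Longrightarrow> supp m \<subseteq> A \<Longrightarrow> monomial_value m x = (\<Prod>i\<in>A. x i powi coef m i)"
  unfolding monomial_value_def by (rule prod.mono_neutral_left) (auto simp: in_keys_iff)

lemma exponent_size_add_le: "exponent_size (m + m') \<le> exponent_size m + exponent_size m'"
proof -
  define A where "A = supp m \<union> supp m'"
  have "finite A" "supp m \<subseteq> A" "supp m' \<subseteq> A" "supp (m + m') \<subseteq> A"
    using keys_add[of m m'] by (auto simp: A_def)
  then show ?thesis
    by (simp add: exponent_size_superset lookup_add flip: sum.distrib) (rule sum_mono, linarith)
qed

lemma ldegree_le_iff: "ldegree p \<le> N \<longleftrightarrow> (\<forall>m\<in>supp p. exponent_size m \<le> N)"
  unfolding ldegree_def exponent_size_def by (subst Max_le_iff) auto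

lemma ldegree_add_le: "ldegree p \<le> N \<Longrightarrow> ldegree r \<le> N \<Longrightarrow> ldegree (p + r) \<le> N"
  unfolding ldegree_le_iff using keys_add[of p r] by blast

lemma ldegree_mult_le: "ldegree p \<le> N \<Longrightarrow> ldegree r \<le> M \<Longrightarrow> ldegree (p * r) \<le> N + M"
  unfolding ldegree_le_iff
proof
  fix m assume *: "\<forall>m\<in>supp p. exponent_size m \<le> N" "\<forall>m\<in>supp r. exponent_size m \<le> M"
    and "m \<in> supp (p * r)"
  then obtain a b where "m = a + b" "a \<in> supp p" "b \<in> supp r"
    using keys_mult[of p r] by blast
  then show "exponent_size m \<le> N + M"
    using * exponent_size_add_le[of a b] by (metis add_mono order_trans)
qed

lemma keys_const: "m \<in> supp (const c) \<Longrightarrow> m = 0"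
  by (auto simp: const_def split: if_splits)

lemma ldegree_const: "ldegree (const c) = 0"
  using ldegree_le_iff[of "const c" 0] keys_const by (fastforce simp: exponent_size_def)

lemma lookup_const_mult: "coef (const c * p) m = c * coef p m"
  unfolding const_def mult_map_scale_conv_mult[symmetric] by (simp add: Poly_Mapping.map.rep_eq when_def)

lemma const_0: "const 0 = 0"
  by (simp add: const_def)

lemma const_mult: "const a * const b = const (a * b)"
  by (simp add: const_def mult_single)

lemma laurent_sum_single: "p = (\<Sum>m\<in>supp p. Poly_Mapping.single m (coef p m))"
proof (rule poly_mapping_eqI)
  fix k
  have "coef (\<Sum>m\<in>supp p. Poly_Mapping.single m (coef p m)) k =
      (\<Sum>m\<in>supp p. if m = k then coef p m else 0)"
    by (simp add: lookup_sum lookup_single when_def)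
  also have "\<dots> = coef p k"
    by (simp add: in_keys_iff)
  finally show "coef p k =
    coef (\<Sum>m\<in>supp p. Poly_Mapping.single m (coef p m)) k" ..
qed

lemma laurent_mult_sum_single:
  "p * r = (\<Sum>m\<in>supp p. \<Sum>m'\<in>supp r.
     Poly_Mapping.single (m + m') (coef p m * coef r m'))"
proof -
  have "p * r = (\<Sum>m\<in>supp p. Poly_Mapping.single m (coef p m)) *
      (\<Sum>m\<in>supp r. Poly_Mapping.single m (coef r m))"
    using laurent_sum_single by metis
  then show ?thesis by (simp add: sum_product mult_single)
qed

lemma leval_superset:
  "finite A \<Longrightarrow> supp p \<subseteq> A \<Longrightarrow> leval p x = (\<Sum>m\<in>A. coef p m * monomial_value m x)"
  unfolding leval_def monomial_value_def by (rule sum.mono_neutral_left) (auto simp: in_keys_iff)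

lemma leval_add: "leval (p + r) x = leval p x + leval r x"
proof -
  define A where "A = supp p \<union> supp r"
  have "finite A" "supp p \<subseteq> A" "supp r \<subseteq> A" "supp (p + r) \<subseteq> A"
    using keys_add[of p r] by (auto simp: A_def)
  then show ?thesis
    by (simp add: leval_superset lookup_add distrib_right sum.distrib)
qed

lemma leval_single: "leval (Poly_Mapping.single m c) x = c * monomial_value m x"
  by (subst leval_superset[of "{m}"]) auto

lemma leval_0: "leval 0 x = 0"
  by (simp add: leval_def)

lemma leval_sum: "leval (\<Sum>i\<in>A. f i) x = (\<Sum>i\<in>A. leval (f i) x)"
  by (induction A rule: infinite_finite_induct) (auto simp: leval_0 leval_add)

lemma leval_const: "leval (const c) x = c"
  by (simp add: const_def leval_single monomial_value_def)

text \<open>\<open>powi\<close> is not additive in the exponent at base 0: exponents 1 and -1 both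
  give 0, while their sum gives 1. Hence multiplicativity is required only for the monomials that
  occur.\<close>

lemma leval_mult:
  assumes "\<And>m m'. m \<in> supp p \<Longrightarrow> m' \<in> supp r \<Longrightarrow>
    monomial_value (m + m') x = monomial_value m x * monomial_value m' x"
  shows "leval (p * r) x = leval p x * leval r x"
proof -
  have "leval (p * r) x = (\<Sum>m\<in>supp p. \<Sum>m'\<in>supp r.
      (coef p m * monomial_value m x) * (coef r m' * monomial_value m' x))"
    by (subst laurent_mult_sum_single) (simp add: leval_sum leval_single assms mult_ac cong: sum.cong)
  also have "\<dots> = leval p x * leval r x"
    by (simp add: leval_superset[OF finite_keys order_refl] sum_product)
  finally show ?thesis .
qed

text \<open>Both alternatives exclude a zero base with a negative exponent. The first serves
  \<open>BM\<close>; the second serves the other families, where a coordinate may be zero, as at an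
  empty last row in \<open>AJ\<close>.\<close>

lemma monomial_value_add:
  assumes "(\<forall>i. x i \<noteq> 0) \<or> (\<forall>i. 0 \<le> coef m i \<and> 0 \<le> coef m' i)"
  shows "monomial_value (m + m') x = monomial_value m x * monomial_value m' x"
proof -
  define A where "A = supp m \<union> supp m'"
  have A: "finite A" "supp m \<subseteq> A" "supp m' \<subseteq> A" "supp (m + m') \<subseteq> A"
    using keys_add[of m m'] by (auto simp: A_def)
  have "x i powi (coef m i + coef m' i) =
      x i powi coef m i * x i powi coef m' i" for i
  proof (cases "x i = 0")
    case True
    then have "0 \<le> coef m i" "0 \<le> coef m' i" using assms by auto
    then show ?thesis by (auto simp: power_int_def nat_add_distrib power_add)
  qed (simp add: power_int_add)
  then show ?thesis
    by (simp add: monomial_value_superset[OF A(1,2)] monomial_value_superset[OF A(1,3)]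
        monomial_value_superset[OF A(1,4)] lookup_add prod.distrib)
qed

text \<open>An additive bijection of the exponents induces a ring automorphism. It is used for
  permuting variables and for inverting some of them.\<close>

lemma map_key_mult:
  fixes p r :: "'f::field laurent"
  assumes inj: "inj \<sigma>" and surj: "surj \<sigma>" and add: "\<And>a b. \<sigma> (a + b) = \<sigma> a + \<sigma> b"
  shows "Poly_Mapping.map_key \<sigma> (p * r) = Poly_Mapping.map_key \<sigma> p * Poly_Mapping.map_key \<sigma> r"
proof -
  have sum: "Poly_Mapping.map_key \<sigma> (\<Sum>i\<in>A. f i) = (\<Sum>i\<in>A. Poly_Mapping.map_key \<sigma> (f i))"
    for A :: "(nat \<Rightarrow>\<^sub>0 int) set" and f :: "_ \<Rightarrow> 'f laurent"
    using inj by (induction A rule: infinite_finite_induct) (auto simp: map_key_plus)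
  have single: "Poly_Mapping.map_key \<sigma> (Poly_Mapping.single m c) = Poly_Mapping.single (inv \<sigma> m) c"
    for m and c :: 'f
    using map_key_single[OF inj, of "inv \<sigma> m" c] surj by (simp add: surj_f_inv_f)
  have inv_add: "inv \<sigma> (a + b) = inv \<sigma> a + inv \<sigma> b" for a b
    using inj surj add by (metis inv_f_f surj_f_inv_f)
  have expand: "Poly_Mapping.map_key \<sigma> p =
      (\<Sum>m\<in>supp p. Poly_Mapping.single (inv \<sigma> m) (coef p m))" for p :: "'f laurent"
    by (subst laurent_sum_single) (simp add: sum single)
  show ?thesis
    unfolding expand[of p] expand[of r] sum_product mult_single
    by (subst laurent_mult_sum_single) (simp add: sum single inv_add)
qed

section \<open>The action of permutations on Laurent polynomials\<close>

definition permute_exponent :: "(nat \<Rightarrow> nat) \<Rightarrow> (nat \<Rightarrow>\<^sub>0 int) \<Rightarrow> (nat \<Rightarrow>\<^sub>0 int)" where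
  "permute_exponent \<pi> = Poly_Mapping.map_key \<pi>"

text \<open>Reindexing the coefficients moves each monomial by the inverse permutation of exponents.
  Thus x_i goes to x_(\<pi> i), and the result is a left action although exponents are acted on from
  the right.\<close>

definition permute_laurent :: "(nat \<Rightarrow> nat) \<Rightarrow> 'f::field laurent \<Rightarrow> 'f laurent" where
  "permute_laurent \<pi> = Poly_Mapping.map_key (permute_exponent \<pi>)"

lemma lookup_permute_exponent:
  "\<pi> permutes A \<Longrightarrow> coef (permute_exponent \<pi> m) i = coef m (\<pi> i)"
  by (simp add: permute_exponent_def Poly_Mapping.map_key.rep_eq permutes_inj)

lemma permute_exponent_inv:
  assumes "\<pi> permutes A"
  shows "permute_exponent \<pi> (permute_exponent (inv \<pi>) m) = m"
    "permute_exponent (inv \<pi>) (permute_exponent \<pi> m) = m"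
  using assms permutes_inv[OF assms]
  by (auto intro!: poly_mapping_eqI simp: lookup_permute_exponent permutes_inverses)

lemma bij_permute_exponent:
  assumes "\<pi> permutes A"
  shows "inj (permute_exponent \<pi>)" "surj (permute_exponent \<pi>)"
proof -
  show "inj (permute_exponent \<pi>)"
    using permute_exponent_inv(2)[OF assms] by (rule inj_on_inverseI)
  show "surj (permute_exponent \<pi>)"
    using permute_exponent_inv(1)[OF assms] by (rule surjI)
qed

lemma permute_exponent_add:
  "\<pi> permutes A \<Longrightarrow> permute_exponent \<pi> (a + b) = permute_exponent \<pi> a + permute_exponent \<pi> b"
  by (simp add: permute_exponent_def map_key_plus permutes_inj)

lemma lookup_permute_laurent:
  "\<pi> permutes A \<Longrightarrow> coef (permute_laurent \<pi> p) m = coef p (permute_exponent \<pi> m)"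
  by (simp add: permute_laurent_def Poly_Mapping.map_key.rep_eq bij_permute_exponent)

lemma symmetric_laurent_iff:
  "symmetric_laurent n p \<longleftrightarrow> (\<forall>\<pi>. \<pi> permutes {..<n} \<longrightarrow> permute_laurent \<pi> p = p)"
proof -
  have "permute_laurent \<pi> p = p \<longleftrightarrow>
      (\<forall>m. coef p (permute_exponent \<pi> m) = coef p m)"
    if "\<pi> permutes {..<n}" for \<pi>
    using lookup_permute_laurent[OF that, of p] by (auto simp: poly_mapping_eq_iff fun_eq_iff)
  then show ?thesis by (simp add: symmetric_laurent_def permute_exponent_def)
qed

lemma permute_laurent_mult:
  "\<pi> permutes A \<Longrightarrow> permute_laurent \<pi> (p * r) = permute_laurent \<pi> p * permute_laurent \<pi> r"
  unfolding permute_laurent_def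
  by (rule map_key_mult) (auto simp: bij_permute_exponent permute_exponent_add)

lemma permute_laurent_add:
  "\<pi> permutes A \<Longrightarrow> permute_laurent \<pi> (p + r) = permute_laurent \<pi> p + permute_laurent \<pi> r"
  unfolding permute_laurent_def by (simp add: map_key_plus bij_permute_exponent)

lemma permute_laurent_single:
  assumes "\<pi> permutes A"
  shows "permute_laurent \<pi> (Poly_Mapping.single m c) = Poly_Mapping.single (permute_exponent (inv \<pi>) m) c"
  using map_key_single[OF bij_permute_exponent(1)[OF assms], of "permute_exponent (inv \<pi>) m" c]
  by (simp add: permute_laurent_def permute_exponent_inv[OF assms])

lemma permute_laurent_const:
  assumes "\<pi> permutes A"
  shows "permute_laurent \<pi> (const c) = const c"
  by (simp add: const_def permute_laurent_single[OF assms] permute_exponent_def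
      map_key_zero[OF permutes_inj[OF permutes_inv[OF assms]]])

lemma permute_laurent_comp:
  assumes "\<pi> permutes A" "\<pi>' permutes A"
  shows "permute_laurent \<pi>' (permute_laurent \<pi> p) = permute_laurent (\<pi>' \<circ> \<pi>) p"
proof (rule poly_mapping_eqI)
  fix m
  have comp: "\<pi>' \<circ> \<pi> permutes A" using assms by (simp add: permutes_compose)
  have "permute_exponent \<pi> (permute_exponent \<pi>' m) = permute_exponent (\<pi>' \<circ> \<pi>) m"
    by (rule poly_mapping_eqI) (simp add: lookup_permute_exponent[OF comp]
        lookup_permute_exponent[OF assms(1)] lookup_permute_exponent[OF assms(2)])
  then show "coef (permute_laurent \<pi>' (permute_laurent \<pi> p)) m =
      coef (permute_laurent (\<pi>' \<circ> \<pi>) p) m"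
    by (simp add: lookup_permute_laurent[OF comp] lookup_permute_laurent[OF assms(1)]
        lookup_permute_laurent[OF assms(2)])
qed

lemma keys_permute_exponent: "\<pi> permutes A \<Longrightarrow> supp (permute_exponent \<pi> m) = \<pi> -` supp m"
  by (simp add: permute_exponent_def keys_map_key permutes_inj)

lemma exponent_size_permute: "\<pi> permutes A \<Longrightarrow> exponent_size (permute_exponent \<pi> m) = exponent_size m"
  unfolding exponent_size_def keys_permute_exponent lookup_permute_exponent
  by (rule sum.reindex_bij_witness[of _ "inv \<pi>" \<pi>]) (auto simp: permutes_inverses)

lemma monomial_value_permute:
  "\<pi> permutes A \<Longrightarrow> monomial_value (permute_exponent \<pi> m) (\<lambda>i. x (\<pi> i)) = monomial_value m x"
  unfolding monomial_value_def keys_permute_exponent lookup_permute_exponent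
  by (rule prod.reindex_bij_witness[of _ "inv \<pi>" \<pi>]) (auto simp: permutes_inverses)

lemma leval_permute:
  assumes "\<pi> permutes A"
  shows "leval (permute_laurent \<pi> p) x = leval p (\<lambda>i. x (\<pi> i))"
proof -
  have inv: "inv \<pi> permutes A" using assms by (rule permutes_inv)
  have "leval (permute_laurent \<pi> p) x =
      (\<Sum>m\<in>supp (permute_laurent \<pi> p). coef p (permute_exponent \<pi> m) * monomial_value m x)"
    by (simp add: leval_superset[OF finite_keys order_refl] lookup_permute_laurent[OF assms])
  also have "\<dots> = (\<Sum>m\<in>supp p. coef p m * monomial_value (permute_exponent (inv \<pi>) m) x)"
    by (rule sum.reindex_bij_witness[of _ "permute_exponent (inv \<pi>)" "permute_exponent \<pi>"])
      (auto simp: permute_exponent_inv[OF assms] in_keys_iff lookup_permute_laurent[OF assms])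
  also have "\<dots> = (\<Sum>m\<in>supp p. coef p m * monomial_value m (\<lambda>i. x (\<pi> i)))"
    using monomial_value_permute[OF inv, of _ "\<lambda>i. x (\<pi> i)"] by (simp add: permutes_inverses[OF assms])
  finally show ?thesis by (simp add: leval_superset[OF finite_keys order_refl])
qed

lemma ldegree_permute_le:
  assumes "\<pi> permutes A" "ldegree p \<le> N"
  shows "ldegree (permute_laurent \<pi> p) \<le> N"
  unfolding ldegree_le_iff
proof
  fix m assume "m \<in> supp (permute_laurent \<pi> p)"
  then have "permute_exponent \<pi> m \<in> supp p"
    by (simp add: in_keys_iff lookup_permute_laurent[OF assms(1)])
  then have "exponent_size (permute_exponent \<pi> m) \<le> N" using assms(2) by (simp add: ldegree_le_iff)
  then show "exponent_size m \<le> N" by (simp add: exponent_size_permute[OF assms(1)])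
qed

lemma gen_algebra_permute:
  assumes "\<pi> permutes A" "\<And>g. g \<in> G \<Longrightarrow> permute_laurent \<pi> g \<in> G" "p \<in> gen_algebra G"
  shows "permute_laurent \<pi> p \<in> gen_algebra G"
  using assms(3)
  by (induction rule: gen_algebra.induct)
    (auto simp: permute_laurent_const[OF assms(1)] permute_laurent_add[OF assms(1)]
      permute_laurent_mult[OF assms(1)] intro: gen_algebra.intros assms(2))

lemma gen_algebra_sum: "(\<And>i. i \<in> A \<Longrightarrow> f i \<in> gen_algebra G) \<Longrightarrow> (\<Sum>i\<in>A. f i) \<in> gen_algebra G"
  by (induction A rule: infinite_finite_induct)
    (auto intro: gen_algebra.intros simp: const_0[symmetric])

lemma symmetric_const: "symmetric_laurent n (const c)"
  by (simp add: symmetric_laurent_iff permute_laurent_const)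

lemma symmetric_add: "symmetric_laurent n p \<Longrightarrow> symmetric_laurent n r \<Longrightarrow> symmetric_laurent n (p + r)"
  by (simp add: symmetric_laurent_iff permute_laurent_add)

lemma symmetric_mult: "symmetric_laurent n p \<Longrightarrow> symmetric_laurent n r \<Longrightarrow> symmetric_laurent n (p * r)"
  by (simp add: symmetric_laurent_iff permute_laurent_mult)

lemma Lam_const: "const c \<in> Lam F n"
  by (simp add: Lam_def gen_algebra.intros symmetric_const)

lemma Lam_add: "p \<in> Lam F n \<Longrightarrow> r \<in> Lam F n \<Longrightarrow> p + r \<in> Lam F n"
  by (auto simp: Lam_def intro: gen_algebra.intros symmetric_add)

lemma Lam_mult: "p \<in> Lam F n \<Longrightarrow> r \<in> Lam F n \<Longrightarrow> p * r \<in> Lam F n"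
  by (auto simp: Lam_def intro: gen_algebra.intros symmetric_mult)

lemma Lam_sum: "(\<And>i. i \<in> A \<Longrightarrow> f i \<in> Lam F n) \<Longrightarrow> (\<Sum>i\<in>A. f i) \<in> Lam F n"
  by (induction A rule: infinite_finite_induct)
    (auto intro: Lam_add simp: Lam_const const_0[symmetric])

lemma ldegree_sum_le: "(\<And>i. i \<in> A \<Longrightarrow> ldegree (f i) \<le> N) \<Longrightarrow> ldegree (\<Sum>i\<in>A. f i) \<le> N"
  by (induction A rule: infinite_finite_induct)
    (auto intro!: ldegree_add_le simp: ldegree_const const_0[symmetric])

lemma ldegree_const_mult_le: "ldegree p \<le> N \<Longrightarrow> ldegree (const c * p) \<le> N"
  using ldegree_mult_le[of "const c" 0 p N] by (simp add: ldegree_const)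

lemma leval_const_mult: "leval (const c * p) x = c * leval p x"
  by (rule trans[OF leval_mult])
    (auto dest!: keys_const simp: monomial_value_def leval_const)

section \<open>Saturated chains and divided differences\<close>

definition parts_upto :: "nat \<Rightarrow> nat \<Rightarrow> nat list set" where
  "parts_upto n m = {\<kappa> \<in> parts n. sum_list \<kappa> \<le> m}"

lemma finite_parts_upto [simp]: "finite (parts_upto n m)"
proof (rule finite_subset)
  show "parts_upto n m \<subseteq> {\<kappa>. set \<kappa> \<subseteq> {..m} \<and> length \<kappa> = n}"
    by (auto simp: parts_upto_def parts_def intro: order_trans[OF member_le_sum_list])
qed (rule finite_lists_length_eq, simp)

definition covers_of :: "nat \<Rightarrow> nat list \<Rightarrow> nat list set" where
  "covers_of n \<mu> = {\<rho> \<in> parts n. covers \<rho> \<mu>}"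

definition covered_by :: "nat \<Rightarrow> nat list \<Rightarrow> nat list set" where
  "covered_by n \<kappa> = {\<rho> \<in> parts n. covers \<kappa> \<rho>}"

lemma finite_covers_of [simp]: "finite (covers_of n \<mu>)"
  by (rule finite_subset[OF _ finite_parts_upto[of n "sum_list \<mu> + 1"]])
    (auto simp: covers_of_def parts_upto_def covers_def)

lemma finite_covered_by [simp]: "finite (covered_by n \<kappa>)"
  by (rule finite_subset[OF _ finite_parts_upto[of n "sum_list \<kappa>"]])
    (auto simp: covered_by_def parts_upto_def covers_def)

lemma sat_chains_iff:
  "zs \<in> sat_chains n \<kappa> \<mu> \<longleftrightarrow>
    zs \<noteq> [] \<and> set zs \<subseteq> parts n \<and> hd zs = \<kappa> \<and> last zs = \<mu> \<and> successively covers zs"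
  by (simp add: sat_chains_def successively_conv_nth)

text \<open>Each covering step lowers the size by one, so sizes identify positions. Length,
  finiteness and distinctness of the members all come from this.\<close>

lemma sat_chain_size:
  assumes "zs \<in> sat_chains n \<kappa> \<mu>" "i < length zs"
  shows "sum_list (zs ! i) + i = sum_list \<kappa>"
  using assms(2)
proof (induction i)
  case 0
  then show ?case using assms(1) by (auto simp: sat_chains_def hd_conv_nth)
next
  case (Suc i)
  then have "covers (zs ! i) (zs ! Suc i)" using assms(1) by (simp add: sat_chains_def)
  then show ?case using Suc by (simp add: covers_def)
qed

lemma sat_chain_length:
  assumes "zs \<in> sat_chains n \<kappa> \<mu>"
  shows "sum_list \<kappa> + 1 = sum_list \<mu> + length zs"
proof -
  have "zs \<noteq> []" "last zs = \<mu>" using assms by (auto simp: sat_chains_def)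
  then show ?thesis
    using sat_chain_size[OF assms, of "length zs - 1"] by (cases zs rule: rev_cases) auto
qed

lemma finite_sat_chains [simp]: "finite (sat_chains n \<kappa> \<mu>)"
proof (rule finite_subset)
  show "sat_chains n \<kappa> \<mu> \<subseteq>
      {zs. set zs \<subseteq> parts_upto n (sum_list \<kappa>) \<and> length zs = sum_list \<kappa> + 1 - sum_list \<mu>}"
  proof clarify
    fix zs assume zs: "zs \<in> sat_chains n \<kappa> \<mu>"
    have "\<rho> \<in> parts_upto n (sum_list \<kappa>)" if \<rho>: "\<rho> \<in> set zs" for \<rho>
    proof -
      obtain i where "i < length zs" "\<rho> = zs ! i" using \<rho> by (metis in_set_conv_nth)
      then have "sum_list \<rho> \<le> sum_list \<kappa>" using sat_chain_size[OF zs] by fastforce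
      then show ?thesis using zs \<rho> by (auto simp: parts_upto_def sat_chains_def)
    qed
    then show "set zs \<subseteq> parts_upto n (sum_list \<kappa>) \<and> length zs = sum_list \<kappa> + 1 - sum_list \<mu>"
      using sat_chain_length[OF zs] by auto
  qed
qed (rule finite_lists_length_eq, simp)

lemma sat_chains_trivial:
  assumes "\<kappa> \<in> parts n" "sum_list \<kappa> \<le> sum_list \<mu>"
  shows "sat_chains n \<kappa> \<mu> = (if \<kappa> = \<mu> then {[\<mu>]} else {})"
proof -
  have "zs = [\<kappa>] \<and> \<kappa> = \<mu>" if "zs \<in> sat_chains n \<kappa> \<mu>" for zs
  proof -
    have "length zs \<le> 1" "zs \<noteq> []" "hd zs = \<kappa>" "last zs = \<mu>"
      using sat_chain_length[OF that] assms that by (auto simp: sat_chains_def)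
    then show ?thesis by (cases zs) auto
  qed
  moreover have "[\<kappa>] \<in> sat_chains n \<kappa> \<kappa>" using assms by (auto simp: sat_chains_def)
  ultimately show ?thesis by auto
qed

lemma Cons_in_sat_chains:
  assumes "\<kappa> \<in> parts n" "zs \<noteq> []"
  shows "\<kappa> # zs \<in> sat_chains n \<kappa> \<mu> \<longleftrightarrow> covers \<kappa> (hd zs) \<and> zs \<in> sat_chains n (hd zs) \<mu>"
  using assms by (auto simp: sat_chains_iff successively_Cons)

lemma snoc_in_sat_chains:
  assumes "\<mu> \<in> parts n" "zs \<noteq> []"
  shows "zs @ [\<mu>] \<in> sat_chains n \<kappa> \<mu> \<longleftrightarrow> covers (last zs) \<mu> \<and> zs \<in> sat_chains n \<kappa> (last zs)"
  using assms by (auto simp: sat_chains_iff successively_append_iff)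

text \<open>Since the endpoints differ, a chain has a second member, and deleting the first one
  leaves a chain from a partition covered by \<open>\<kappa>\<close>. This and its mirror image
  match the two terms of the divided difference recursion.\<close>

lemma sum_sat_chains_Cons:
  assumes "\<kappa> \<in> parts n" "\<kappa> \<noteq> \<mu>"
  shows "(\<Sum>zs\<in>sat_chains n \<kappa> \<mu>. F zs) =
           (\<Sum>\<rho>\<in>covered_by n \<kappa>. \<Sum>zs\<in>sat_chains n \<rho> \<mu>. F (\<kappa> # zs))"
proof -
  have "(\<Sum>zs\<in>sat_chains n \<kappa> \<mu>. F zs) =
      (\<Sum>(\<rho>, zs)\<in>Sigma (covered_by n \<kappa>) (\<lambda>\<rho>. sat_chains n \<rho> \<mu>). F (\<kappa> # zs))"
  proof (rule sum.reindex_bij_witness[of _ "\<lambda>(\<rho>, zs). \<kappa> # zs" "\<lambda>zs. (hd (tl zs), tl zs)"])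
    fix zs assume zs: "zs \<in> sat_chains n \<kappa> \<mu>"
    then obtain xs where xs: "zs = \<kappa> # xs" by (cases zs) (auto simp: sat_chains_def)
    have "xs \<noteq> []" using zs xs assms(2) by (auto simp: sat_chains_def)
    then have "covers \<kappa> (hd xs)" "xs \<in> sat_chains n (hd xs) \<mu>"
      using zs xs Cons_in_sat_chains assms(1) by auto
    moreover from this have "hd xs \<in> parts n"
      using \<open>xs \<noteq> []\<close> by (auto simp: sat_chains_def)
    ultimately show "(hd (tl zs), tl zs) \<in> Sigma (covered_by n \<kappa>) (\<lambda>\<rho>. sat_chains n \<rho> \<mu>)"
      using xs by (auto simp: covered_by_def)
    show "(case (hd (tl zs), tl zs) of (\<rho>, zs) \<Rightarrow> \<kappa> # zs) = zs" using xs by simp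
    show "(case (hd (tl zs), tl zs) of (\<rho>, zs) \<Rightarrow> F (\<kappa> # zs)) = F zs" using xs by simp
  next
    fix p assume p: "p \<in> Sigma (covered_by n \<kappa>) (\<lambda>\<rho>. sat_chains n \<rho> \<mu>)"
    then obtain \<rho> zs where *: "p = (\<rho>, zs)" "\<rho> \<in> covered_by n \<kappa>" "zs \<in> sat_chains n \<rho> \<mu>" by blast
    then have "zs \<noteq> []" "hd zs = \<rho>" by (auto simp: sat_chains_def)
    then show "(case p of (\<rho>, zs) \<Rightarrow> \<kappa> # zs) \<in> sat_chains n \<kappa> \<mu>"
      "(hd (tl (case p of (\<rho>, zs) \<Rightarrow> \<kappa> # zs)), tl (case p of (\<rho>, zs) \<Rightarrow> \<kappa> # zs)) = p"
      using * Cons_in_sat_chains[OF assms(1)] by (auto simp: covered_by_def)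
  qed
  then show ?thesis by (simp add: sum.Sigma)
qed

lemma sum_sat_chains_snoc:
  assumes "\<mu> \<in> parts n" "\<kappa> \<noteq> \<mu>"
  shows "(\<Sum>zs\<in>sat_chains n \<kappa> \<mu>. F zs) =
           (\<Sum>\<rho>\<in>covers_of n \<mu>. \<Sum>zs\<in>sat_chains n \<kappa> \<rho>. F (zs @ [\<mu>]))"
proof -
  have "(\<Sum>zs\<in>sat_chains n \<kappa> \<mu>. F zs) =
      (\<Sum>(\<rho>, zs)\<in>Sigma (covers_of n \<mu>) (\<lambda>\<rho>. sat_chains n \<kappa> \<rho>). F (zs @ [\<mu>]))"
  proof (rule sum.reindex_bij_witness[of _ "\<lambda>(\<rho>, zs). zs @ [\<mu>]" "\<lambda>zs. (last (butlast zs), butlast zs)"])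
    fix zs assume zs: "zs \<in> sat_chains n \<kappa> \<mu>"
    then obtain xs where xs: "zs = xs @ [\<mu>]" by (cases zs rule: rev_cases) (auto simp: sat_chains_def)
    have "xs \<noteq> []" using zs xs assms(2) by (auto simp: sat_chains_def)
    then have "covers (last xs) \<mu>" "xs \<in> sat_chains n \<kappa> (last xs)"
      using zs xs snoc_in_sat_chains assms(1) by auto
    moreover from this have "last xs \<in> parts n"
      using \<open>xs \<noteq> []\<close> by (auto simp: sat_chains_def)
    ultimately show "(last (butlast zs), butlast zs) \<in> Sigma (covers_of n \<mu>) (\<lambda>\<rho>. sat_chains n \<kappa> \<rho>)"
      using xs by (auto simp: covers_of_def)
    show "(case (last (butlast zs), butlast zs) of (\<rho>, zs) \<Rightarrow> zs @ [\<mu>]) = zs" using xs by simp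
    show "(case (last (butlast zs), butlast zs) of (\<rho>, zs) \<Rightarrow> F (zs @ [\<mu>])) = F zs" using xs by simp
  next
    fix p assume p: "p \<in> Sigma (covers_of n \<mu>) (\<lambda>\<rho>. sat_chains n \<kappa> \<rho>)"
    then obtain \<rho> zs where *: "p = (\<rho>, zs)" "\<rho> \<in> covers_of n \<mu>" "zs \<in> sat_chains n \<kappa> \<rho>" by blast
    then have "zs \<noteq> []" "last zs = \<rho>" by (auto simp: sat_chains_def)
    then show "(case p of (\<rho>, zs) \<Rightarrow> zs @ [\<mu>]) \<in> sat_chains n \<kappa> \<mu>"
      "(last (butlast (case p of (\<rho>, zs) \<Rightarrow> zs @ [\<mu>])), butlast (case p of (\<rho>, zs) \<Rightarrow> zs @ [\<mu>])) = p"
      using * snoc_in_sat_chains[OF assms(1)] by (auto simp: covers_of_def)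
  qed
  then show ?thesis by (simp add: sum.Sigma)
qed

section \<open>Divided differences along chains\<close>

text \<open>The divided difference of \<open>b\<close> at the nodes \<open>s x\<close> in Lagrange
  form. Indexing by a set builds in its symmetry in the nodes.\<close>

definition divided_diff :: "('a \<Rightarrow> 'f::field) \<Rightarrow> ('a \<Rightarrow> 'f) \<Rightarrow> 'a set \<Rightarrow> 'f" where
  "divided_diff s b A = (\<Sum>x\<in>A. b x / (\<Prod>z\<in>A - {x}. s x - s z))"

text \<open>The factor \<open>s x - s y\<close> cancels against the denominator of every other
  summand and annihilates the one at \<open>y\<close>.\<close>

lemma divided_diff_remove:
  assumes "finite A" "inj_on s A" "y \<in> A"
  shows "(\<Sum>x\<in>A. (s x - s y) * (b x / (\<Prod>z\<in>A - {x}. s x - s z))) = divided_diff s b (A - {y})"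
proof -
  have "(\<Sum>x\<in>A. (s x - s y) * (b x / (\<Prod>z\<in>A - {x}. s x - s z))) =
      (\<Sum>x\<in>A - {y}. (s x - s y) * (b x / (\<Prod>z\<in>A - {x}. s x - s z)))"
    using assms(1,3) by (simp add: sum.remove)
  also have "\<dots> = divided_diff s b (A - {y})"
    unfolding divided_diff_def
  proof (rule sum.cong[OF refl])
    fix x assume x: "x \<in> A - {y}"
    then have "s x - s y \<noteq> 0" using assms(2,3) by (auto dest: inj_onD)
    moreover have "(\<Prod>z\<in>A - {x}. s x - s z) = (s x - s y) * (\<Prod>z\<in>A - {y} - {x}. s x - s z)"
      using assms(1,3) x by (subst prod.remove[of _ y]) (auto simp: Diff_insert2[symmetric] insert_commute)
    ultimately show "(s x - s y) * (b x / (\<Prod>z\<in>A - {x}. s x - s z)) =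
        b x / (\<Prod>z\<in>A - {y} - {x}. s x - s z)" by simp
  qed
  finally show ?thesis .
qed

text \<open>In the summand at z, write s x - s y as (s z - s y) - (s z - s x) and remove one node
  from each part.\<close>

lemma divided_diff_recursion:
  assumes "finite A" "inj_on s A" "x \<in> A" "y \<in> A"
  shows "(s x - s y) * divided_diff s b A = divided_diff s b (A - {y}) - divided_diff s b (A - {x})"
  unfolding divided_diff_remove[OF assms(1,2,4), symmetric] divided_diff_remove[OF assms(1-3), symmetric]
  unfolding divided_diff_def sum_distrib_left sum_subtractf[symmetric] left_diff_distrib[symmetric]
  by simp

definition chain_prod :: "(nat list \<Rightarrow> nat list \<Rightarrow> 'f::field) \<Rightarrow> nat list list \<Rightarrow> 'f" where
  "chain_prod D zs = (\<Prod>i<length zs - 1. D (zs ! i) (zs ! (i + 1)))"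

lemma chain_prod_Cons: "zs \<noteq> [] \<Longrightarrow> chain_prod D (\<kappa> # zs) = D \<kappa> (hd zs) * chain_prod D zs"
  by (cases zs) (auto simp: chain_prod_def prod.lessThan_Suc_shift simp del: prod.lessThan_Suc)

lemma chain_prod_snoc: "zs \<noteq> [] \<Longrightarrow> chain_prod D (zs @ [\<mu>]) = chain_prod D zs * D (last zs) \<mu>"
  by (cases zs rule: rev_cases)
    (auto simp: chain_prod_def nth_append Suc_less_eq intro!: prod.cong)

text \<open>The right-hand side of the formula with free edge weights \<open>D\<close>. Taking norm
  difference times binomial for \<open>D\<close> absorbs the numerators of
  \<open>wt_LR\<close>.\<close>

definition chain_sum ::
  "nat \<Rightarrow> (nat list \<Rightarrow> 'f::field) \<Rightarrow> (nat list \<Rightarrow> nat list \<Rightarrow> 'f) \<Rightarrow> (nat list \<Rightarrow> 'f) \<Rightarrow>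
   nat list \<Rightarrow> nat list \<Rightarrow> 'f" where
  "chain_sum n s D b \<kappa> \<mu> = (\<Sum>zs\<in>sat_chains n \<kappa> \<mu>. chain_prod D zs * divided_diff s b (set zs))"

lemma sat_chain_distinct:
  assumes "zs \<in> sat_chains n \<kappa> \<mu>"
  shows "distinct zs" "\<rho> \<in> set zs \<Longrightarrow> \<rho>' \<in> set zs \<Longrightarrow> sum_list \<rho> = sum_list \<rho>' \<Longrightarrow> \<rho> = \<rho>'"
proof -
  have "i = j" if "i < length zs" "j < length zs" "sum_list (zs ! i) = sum_list (zs ! j)" for i j
    using sat_chain_size[OF assms that(1)] sat_chain_size[OF assms that(2)] that(3) by linarith
  note size_inj = this
  then show "distinct zs" unfolding distinct_conv_nth by metis
  show "\<rho> = \<rho>'" if \<rho>: "\<rho> \<in> set zs" "\<rho>' \<in> set zs" "sum_list \<rho> = sum_list \<rho>'"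
  proof -
    obtain i j where "i < length zs" "\<rho> = zs ! i" "j < length zs" "\<rho>' = zs ! j"
      using \<rho>(1,2) by (metis in_set_conv_nth)
    then show ?thesis using size_inj[of i j] \<rho>(3) by simp
  qed
qed

text \<open>On a single chain, the recursion with its two ends as nodes produces the chain without
  its last member minus the chain without its first. Grouping by the neighbour of the deleted end
  splits off one edge weight.\<close>

lemma chain_sum_recursion:
  fixes s :: "nat list \<Rightarrow> 'f::field"
  assumes s_inj: "\<And>\<rho> \<rho>'. \<rho> \<in> parts n \<Longrightarrow> \<rho>' \<in> parts n \<Longrightarrow> sum_list \<rho> \<noteq> sum_list \<rho>' \<Longrightarrow> s \<rho> \<noteq> s \<rho>'"
    and \<kappa>: "\<kappa> \<in> parts n" and \<mu>: "\<mu> \<in> parts n" and less: "sum_list \<mu> < sum_list \<kappa>"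
  shows "(s \<kappa> - s \<mu>) * chain_sum n s D b \<kappa> \<mu> =
    (\<Sum>\<rho>\<in>covers_of n \<mu>. D \<rho> \<mu> * chain_sum n s D b \<kappa> \<rho>) -
    (\<Sum>\<rho>\<in>covered_by n \<kappa>. D \<kappa> \<rho> * chain_sum n s D b \<rho> \<mu>)"
proof -
  have ne: "\<kappa> \<noteq> \<mu>" using less by auto
  have step: "(s \<kappa> - s \<mu>) * (chain_prod D zs * divided_diff s b (set zs)) =
      chain_prod D zs * divided_diff s b (set (butlast zs)) -
      chain_prod D zs * divided_diff s b (set (tl zs))" if zs: "zs \<in> sat_chains n \<kappa> \<mu>" for zs
  proof -
    have props: "zs \<noteq> []" "hd zs = \<kappa>" "last zs = \<mu>" "set zs \<subseteq> parts n"
      using zs by (auto simp: sat_chains_def)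
    then obtain \<eta> where "zs = \<kappa> # \<eta>" by (cases zs) auto
    then obtain M where M: "zs = \<kappa> # M @ [\<mu>]"
      using props ne by (cases \<eta> rule: rev_cases) auto
    have "inj_on s (set zs)"
      using sat_chain_distinct(2)[OF zs] s_inj props(4) by (fastforce simp: inj_on_def)
    moreover have "set (butlast zs) = set zs - {\<mu>}" "set (tl zs) = set zs - {\<kappa>}" "\<kappa> \<in> set zs" "\<mu> \<in> set zs"
      using sat_chain_distinct(1)[OF zs] M by (auto simp: butlast_append)
    ultimately have "(s \<kappa> - s \<mu>) * divided_diff s b (set zs) =
        divided_diff s b (set (butlast zs)) - divided_diff s b (set (tl zs))"
      using divided_diff_recursion[of "set zs" s \<kappa> \<mu> b] by simp
    then show ?thesis
      unfolding mult.left_commute[of "s \<kappa> - s \<mu>"] right_diff_distrib[symmetric] by simp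
  qed
  have "(s \<kappa> - s \<mu>) * chain_sum n s D b \<kappa> \<mu> =
      (\<Sum>zs\<in>sat_chains n \<kappa> \<mu>. chain_prod D zs * divided_diff s b (set (butlast zs))) -
      (\<Sum>zs\<in>sat_chains n \<kappa> \<mu>. chain_prod D zs * divided_diff s b (set (tl zs)))"
    unfolding chain_sum_def sum_distrib_left sum_subtractf[symmetric]
    by (intro sum.cong refl step)
  also have "(\<Sum>zs\<in>sat_chains n \<kappa> \<mu>. chain_prod D zs * divided_diff s b (set (butlast zs))) =
      (\<Sum>\<rho>\<in>covers_of n \<mu>. D \<rho> \<mu> * chain_sum n s D b \<kappa> \<rho>)"
    unfolding sum_sat_chains_snoc[OF \<mu> ne] chain_sum_def sum_distrib_left
  proof (intro sum.cong refl)
    fix \<rho> zs assume "zs \<in> sat_chains n \<kappa> \<rho>"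
    then have "zs \<noteq> []" "last zs = \<rho>" by (auto simp: sat_chains_def)
    then show "chain_prod D (zs @ [\<mu>]) * divided_diff s b (set (butlast (zs @ [\<mu>]))) =
        D \<rho> \<mu> * (chain_prod D zs * divided_diff s b (set zs))"
      by (simp add: chain_prod_snoc)
  qed
  also have "(\<Sum>zs\<in>sat_chains n \<kappa> \<mu>. chain_prod D zs * divided_diff s b (set (tl zs))) =
      (\<Sum>\<rho>\<in>covered_by n \<kappa>. D \<kappa> \<rho> * chain_sum n s D b \<rho> \<mu>)"
    unfolding sum_sat_chains_Cons[OF \<kappa> ne] chain_sum_def sum_distrib_left
  proof (intro sum.cong refl)
    fix \<rho> zs assume "zs \<in> sat_chains n \<rho> \<mu>"
    then have "zs \<noteq> []" "hd zs = \<rho>" by (auto simp: sat_chains_def)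
    then show "chain_prod D (\<kappa> # zs) * divided_diff s b (set (tl (\<kappa> # zs))) =
        D \<kappa> \<rho> * (chain_prod D zs * divided_diff s b (set zs))"
      by (simp add: chain_prod_Cons)
  qed
  finally show ?thesis .
qed

lemma chain_sum_trivial:
  assumes "\<kappa> \<in> parts n" "sum_list \<kappa> \<le> sum_list \<mu>"
  shows "chain_sum n s D b \<kappa> \<mu> = (if \<kappa> = \<mu> then b \<mu> else 0)"
  unfolding chain_sum_def sat_chains_trivial[OF assms]
  by (simp add: chain_prod_def divided_diff_def)

text \<open>Members of a chain are distinct, so positions can be replaced by members; the numerator
  does not depend on the summation index and factors out.\<close>

lemma wt_LR_conv_divided_diff:
  assumes "zs \<in> sat_chains n \<kappa> \<mu>"
  shows "wt_LR F n \<nu> zs = (\<Prod>i<length zs - 1.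
       fnorm F n (fshift F n (zs ! i)) - fnorm F n (fshift F n (zs ! (i + 1)))) *
     divided_diff (\<lambda>\<rho>. fnorm F n (fshift F n \<rho>)) (\<lambda>\<rho>. binom F n \<rho> \<nu>) (set zs)"
proof -
  define s where "s = (\<lambda>\<rho>. fnorm F n (fshift F n \<rho>))"
  have dist: "distinct zs" and ne: "zs \<noteq> []"
    using sat_chain_distinct[OF assms] assms by (auto simp: sat_chains_def)
  define I where "I = {0..length zs - 1}"
  have I: "I = {..<length zs}" using ne by (cases zs) (auto simp: I_def)
  have img: "set zs = (!) zs ` I" unfolding I by (auto simp: set_conv_nth)
  have inj: "inj_on ((!) zs) I" unfolding I using dist by (auto simp: inj_on_nth)
  have "(\<Prod>z\<in>set zs - {zs ! j}. s (zs ! j) - s z) = (\<Prod>i\<in>I - {j}. s (zs ! j) - s (zs ! i))"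
    if "j \<in> I" for j
  proof -
    have "set zs - {zs ! j} = (!) zs ` (I - {j})"
      unfolding img using inj that by (auto simp: inj_on_def)
    then show ?thesis
      using inj by (simp add: prod.reindex inj_on_diff)
  qed
  then have "divided_diff s (\<lambda>\<rho>. binom F n \<rho> \<nu>) (set zs) =
      (\<Sum>j\<in>I. binom F n (zs ! j) \<nu> / (\<Prod>i\<in>I - {j}. s (zs ! j) - s (zs ! i)))"
    unfolding divided_diff_def by (subst img) (simp add: sum.reindex[OF inj] cong: sum.cong)
  then show ?thesis
    unfolding wt_LR_def Let_def s_def[symmetric] I_def[symmetric]
    by (simp add: sum_distrib_left s_def)
qed

text \<open>An abstract form in terms of values only: \<open>H\<close> is the matrix of binomials,
  \<open>C\<close> holds the structure constants for a fixed \<nu>, and \<open>b\<close> the values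
  of the factor belonging to \<nu>. Unitriangularity of \<open>H\<close> replaces linear
  independence of the polynomials.\<close>

theorem structure_constants_chain_sum:
  fixes H C :: "nat list \<Rightarrow> nat list \<Rightarrow> 'f::field" and s b :: "nat list \<Rightarrow> 'f"
  assumes tri: "\<And>\<kappa> \<mu>. \<kappa> \<in> parts n \<Longrightarrow> \<mu> \<in> parts n \<Longrightarrow> sum_list \<kappa> \<le> sum_list \<mu> \<Longrightarrow>
      H \<kappa> \<mu> = (if \<kappa> = \<mu> then 1 else 0)"
    and s_inj: "\<And>\<kappa> \<mu>. \<kappa> \<in> parts n \<Longrightarrow> \<mu> \<in> parts n \<Longrightarrow> sum_list \<kappa> \<noteq> sum_list \<mu> \<Longrightarrow> s \<kappa> \<noteq> s \<mu>"
    and pieri: "\<And>\<kappa> \<mu>. \<kappa> \<in> parts n \<Longrightarrow> \<mu> \<in> parts n \<Longrightarrow>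
      (s \<kappa> - s \<mu>) * H \<kappa> \<mu> = (\<Sum>\<rho>\<in>covers_of n \<mu>. (s \<rho> - s \<mu>) * H \<rho> \<mu> * H \<kappa> \<rho>)"
    and C: "\<And>\<kappa> \<mu>. \<kappa> \<in> parts n \<Longrightarrow> \<mu> \<in> parts n \<Longrightarrow>
      H \<kappa> \<mu> * b \<kappa> = (\<Sum>\<rho>\<in>parts_upto n (sum_list \<kappa>). C \<rho> \<mu> * H \<kappa> \<rho>)"
    and \<kappa>: "\<kappa> \<in> parts n" and \<mu>: "\<mu> \<in> parts n"
  shows "C \<kappa> \<mu> = chain_sum n s (\<lambda>\<rho> \<rho>'. (s \<rho> - s \<rho>') * H \<rho> \<rho>') b \<kappa> \<mu>"
proof -
  define D where "D = (\<lambda>\<rho> \<rho>'. (s \<rho> - s \<rho>') * H \<rho> \<rho>')"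
  have diag: "(\<Sum>\<rho>\<in>parts_upto n (sum_list \<kappa>). d \<rho> * H \<kappa> \<rho>) = d \<kappa>"
    if "\<kappa> \<in> parts n" "\<And>\<rho>. \<rho> \<in> parts n \<Longrightarrow> sum_list \<rho> < sum_list \<kappa> \<Longrightarrow> d \<rho> = 0" for d \<kappa>
  proof -
    have "(\<Sum>\<rho>\<in>parts_upto n (sum_list \<kappa>). d \<rho> * H \<kappa> \<rho>) = (\<Sum>\<rho>\<in>{\<kappa>}. d \<rho> * H \<kappa> \<rho>)"
    proof (rule sum.mono_neutral_right)
      show "\<forall>\<rho>\<in>parts_upto n (sum_list \<kappa>) - {\<kappa>}. d \<rho> * H \<kappa> \<rho> = 0"
      proof
        fix \<rho> assume "\<rho> \<in> parts_upto n (sum_list \<kappa>) - {\<kappa>}"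
        then have \<rho>: "\<rho> \<in> parts n" "\<kappa> \<noteq> \<rho>" by (auto simp: parts_upto_def)
        show "d \<rho> * H \<kappa> \<rho> = 0"
        proof (cases "sum_list \<rho> < sum_list \<kappa>")
          case True
          then show ?thesis using that(2)[OF \<rho>(1)] by simp
        next
          case False
          then have "H \<kappa> \<rho> = 0" using tri[OF that(1) \<rho>(1)] \<rho>(2) by simp
          then show ?thesis by simp
        qed
      qed
      show "{\<kappa>} \<subseteq> parts_upto n (sum_list \<kappa>)" using that(1) by (simp add: parts_upto_def)
    qed simp
    then show ?thesis using tri[OF that(1) that(1)] by simp
  qed
  have independent: "d \<kappa> = 0"
    if "\<And>\<kappa>. \<kappa> \<in> parts n \<Longrightarrow> (\<Sum>\<rho>\<in>parts_upto n (sum_list \<kappa>). d \<rho> * H \<kappa> \<rho>) = 0" "\<kappa> \<in> parts n" for d \<kappa>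
    using that(2)
  proof (induction "sum_list \<kappa>" arbitrary: \<kappa> rule: less_induct)
    case less
    then show ?case using diag[of \<kappa> d] that(1) by simp
  qed
  have base: "C \<kappa> \<mu> = (if \<kappa> = \<mu> then b \<mu> else 0)"
    if "\<kappa> \<in> parts n" "\<mu> \<in> parts n" "sum_list \<kappa> \<le> sum_list \<mu>" for \<kappa> \<mu>
    using that(1,3)
  proof (induction "sum_list \<kappa>" arbitrary: \<kappa> rule: less_induct)
    case less
    have "C \<rho> \<mu> = 0" if "\<rho> \<in> parts n" "sum_list \<rho> < sum_list \<kappa>" for \<rho>
      using less.hyps[OF that(2,1)] that less.prems by auto
    then have "C \<kappa> \<mu> = H \<kappa> \<mu> * b \<kappa>"
      using diag[of \<kappa> "\<lambda>\<rho>. C \<rho> \<mu>"] C less.prems \<open>\<mu> \<in> parts n\<close> by simp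
    then show ?case using tri less.prems \<open>\<mu> \<in> parts n\<close> by simp
  qed
  have recursion: "(s \<kappa> - s \<mu>) * C \<kappa> \<mu> =
      (\<Sum>\<rho>\<in>covers_of n \<mu>. D \<rho> \<mu> * C \<kappa> \<rho>) - (\<Sum>\<rho>\<in>covered_by n \<kappa>. D \<kappa> \<rho> * C \<rho> \<mu>)"
    if \<kappa>: "\<kappa> \<in> parts n" and \<mu>: "\<mu> \<in> parts n" for \<kappa> \<mu>
  proof -
    \<comment> \<open>The defect of the recursion; its pairing with row \<open>x\<close> of
      \<open>H\<close> is zero for every \<open>x\<close>, which forces it to vanish.\<close>
    define d where "d = (\<lambda>\<kappa>. (s \<kappa> - s \<mu>) * C \<kappa> \<mu> - (\<Sum>\<rho>\<in>covers_of n \<mu>. D \<rho> \<mu> * C \<kappa> \<rho>) +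
      (\<Sum>\<rho>\<in>covered_by n \<kappa>. D \<kappa> \<rho> * C \<rho> \<mu>))"
    have "(\<Sum>\<rho>\<in>parts_upto n (sum_list x). d \<rho> * H x \<rho>) = 0" if x: "x \<in> parts n" for x
    proof -
      let ?P = "parts_upto n (sum_list x)"
      have "(\<Sum>\<rho>\<in>?P. (\<Sum>\<sigma>\<in>covers_of n \<mu>. D \<sigma> \<mu> * C \<rho> \<sigma>) * H x \<rho>) =
          (\<Sum>\<sigma>\<in>covers_of n \<mu>. D \<sigma> \<mu> * (\<Sum>\<rho>\<in>?P. C \<rho> \<sigma> * H x \<rho>))" (is "?A = _")
        unfolding sum_distrib_left sum_distrib_right by (subst sum.swap) (simp add: mult.assoc)
      also have "\<dots> = (\<Sum>\<sigma>\<in>covers_of n \<mu>. D \<sigma> \<mu> * H x \<sigma>) * b x"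
        unfolding sum_distrib_right
        by (intro sum.cong refl) (auto simp: C[OF x, symmetric] covers_of_def mult.assoc)
      also have "\<dots> = (s x - s \<mu>) * H x \<mu> * b x"
        using pieri[OF x \<mu>] by (simp add: D_def)
      finally have 1: "?A =
        (s x - s \<mu>) * H x \<mu> * b x" .
      have "(\<Sum>\<rho>\<in>?P. (\<Sum>\<sigma>\<in>covered_by n \<rho>. D \<rho> \<sigma> * C \<sigma> \<mu>) * H x \<rho>) =
          (\<Sum>\<rho>\<in>?P. \<Sum>\<sigma>\<in>covered_by n \<rho>. C \<sigma> \<mu> * (D \<rho> \<sigma> * H x \<rho>))" (is "?B = _")
        unfolding sum_distrib_right by (intro sum.cong refl) (simp add: mult_ac)
      also have "\<dots> = (\<Sum>\<rho>\<in>?P. \<Sum>\<sigma>\<in>{\<sigma>\<in>?P. covers \<rho> \<sigma>}. C \<sigma> \<mu> * (D \<rho> \<sigma> * H x \<rho>))"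
        by (intro sum.cong refl) (auto simp: covered_by_def parts_upto_def covers_def)
      also have "\<dots> = (\<Sum>\<sigma>\<in>?P. \<Sum>\<rho>\<in>{\<rho>\<in>?P. covers \<rho> \<sigma>}. C \<sigma> \<mu> * (D \<rho> \<sigma> * H x \<rho>))"
        by (rule sum.swap_restrict) auto
      \<comment> \<open>The inner sum may run over all covers: those of size greater than that of
        \<open>x\<close> have \<open>H x \<rho> = 0\<close>.\<close>
      also have "\<dots> = (\<Sum>\<sigma>\<in>?P. C \<sigma> \<mu> * (\<Sum>\<rho>\<in>covers_of n \<sigma>. D \<rho> \<sigma> * H x \<rho>))"
        unfolding sum_distrib_left
      proof (rule sum.cong[OF refl], rule sum.mono_neutral_left)
        fix \<sigma>
        show "\<forall>\<rho>\<in>covers_of n \<sigma> - {\<rho> \<in> ?P. covers \<rho> \<sigma>}. C \<sigma> \<mu> * (D \<rho> \<sigma> * H x \<rho>) = 0"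
        proof
          fix \<rho> assume "\<rho> \<in> covers_of n \<sigma> - {\<rho> \<in> ?P. covers \<rho> \<sigma>}"
          then have \<rho>: "\<rho> \<in> parts n" "sum_list x < sum_list \<rho>"
            by (auto simp: covers_of_def parts_upto_def)
          then have "H x \<rho> = 0" using tri[OF x \<rho>(1)] by auto
          then show "C \<sigma> \<mu> * (D \<rho> \<sigma> * H x \<rho>) = 0" by simp
        qed
      qed (simp, auto simp: covers_of_def parts_upto_def)
      also have "\<dots> = (\<Sum>\<sigma>\<in>?P. C \<sigma> \<mu> * ((s x - s \<sigma>) * H x \<sigma>))"
        by (intro sum.cong refl) (simp add: pieri[OF x] parts_upto_def D_def)
      finally have 2: "?B =
        (\<Sum>\<sigma>\<in>?P. C \<sigma> \<mu> * ((s x - s \<sigma>) * H x \<sigma>))" .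
      have 3: "(\<Sum>\<rho>\<in>?P. d \<rho> * H x \<rho>) = (\<Sum>\<rho>\<in>?P. (s \<rho> - s \<mu>) * C \<rho> \<mu> * H x \<rho>) -
          (s x - s \<mu>) * H x \<mu> * b x + (\<Sum>\<sigma>\<in>?P. C \<sigma> \<mu> * ((s x - s \<sigma>) * H x \<sigma>))"
        unfolding d_def 1[symmetric] 2[symmetric]
        by (simp add: sum.distrib sum_subtractf distrib_right left_diff_distrib)
      \<comment> \<open>The coefficients combine to (s \<rho> - s \<mu>) + (s x - s \<rho>) = s x -
        s \<mu>, which no longer depends on \<rho>.\<close>
      have "(\<Sum>\<rho>\<in>?P. (s \<rho> - s \<mu>) * C \<rho> \<mu> * H x \<rho>) +
          (\<Sum>\<sigma>\<in>?P. C \<sigma> \<mu> * ((s x - s \<sigma>) * H x \<sigma>)) = (s x - s \<mu>) * (\<Sum>\<rho>\<in>?P. C \<rho> \<mu> * H x \<rho>)"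
        unfolding sum_distrib_left sum.distrib[symmetric]
        by (intro sum.cong refl) (simp add: algebra_simps)
      also have "\<dots> = (s x - s \<mu>) * H x \<mu> * b x" using C[OF x \<mu>] by simp
      finally have 4: "(\<Sum>\<rho>\<in>?P. (s \<rho> - s \<mu>) * C \<rho> \<mu> * H x \<rho>) +
        (\<Sum>\<sigma>\<in>?P. C \<sigma> \<mu> * ((s x - s \<sigma>) * H x \<sigma>)) = (s x - s \<mu>) * H x \<mu> * b x" .
      have "u - w + v = 0" if "u + v = w" for u v w :: 'f
        using that by auto
      then show ?thesis unfolding 3 using 4 by blast
    qed
    then have "d \<kappa> = 0" using independent \<kappa> by blast
    then show ?thesis by (simp add: d_def algebra_simps)
  qed
  have "C \<kappa> \<mu> = chain_sum n s D b \<kappa> \<mu>"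
    using \<kappa> \<mu>
  proof (induction "sum_list \<kappa> - sum_list \<mu>" arbitrary: \<kappa> \<mu>)
    case 0
    then have "sum_list \<kappa> \<le> sum_list \<mu>" by simp
    then show ?case using base[OF 0(2,3)] chain_sum_trivial[OF 0(2)] by metis
  next
    case (Suc k)
    have less: "sum_list \<mu> < sum_list \<kappa>" using Suc.hyps(2) by simp
    have "(s \<kappa> - s \<mu>) * C \<kappa> \<mu> = (s \<kappa> - s \<mu>) * chain_sum n s D b \<kappa> \<mu>"
      unfolding recursion[OF Suc.prems]
    proof (rule trans[OF _ chain_sum_recursion[OF s_inj Suc.prems less, symmetric]],
        intro arg_cong2[of _ _ _ _ "(-)"] arg_cong2[of _ _ _ _ "(*)"] sum.cong refl)
      show "C \<kappa> \<rho> = chain_sum n s D b \<kappa> \<rho>" if "\<rho> \<in> covers_of n \<mu>" for \<rho>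
        using that Suc by (intro Suc.hyps(1)) (auto simp: covers_of_def covers_def)
      show "C \<rho> \<mu> = chain_sum n s D b \<rho> \<mu>" if "\<rho> \<in> covered_by n \<kappa>" for \<rho>
        using that Suc by (intro Suc.hyps(1)) (auto simp: covered_by_def covers_def)
    qed
    then show ?case using s_inj[OF Suc.prems] less by simp
  qed
  then show ?thesis by (simp add: D_def)
qed

section \<open>Interpolation polynomials of an abstract family\<close>

text \<open>Gaussian elimination: solving the new equation for a pivot unknown costs one equation
  and one unknown.\<close>

lemma homogeneous_system_solution:
  fixes u :: "'i \<Rightarrow> 'b \<Rightarrow> 'f::field"
  assumes "finite B" "finite I" "card B < card I"
  shows "\<exists>c. (\<exists>i\<in>I. c i \<noteq> 0) \<and> (\<forall>b\<in>B. (\<Sum>i\<in>I. c i * u i b) = 0)"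
  using assms
proof (induction B arbitrary: I u rule: finite_induct)
  case empty
  then have "I \<noteq> {}" by auto
  then show ?case by (intro exI[of _ "\<lambda>_. 1"]) auto
next
  case (insert b B)
  show ?case
  proof (cases "\<exists>k\<in>I. u k b \<noteq> 0")
    case False
    have "card B < card I" using insert by simp
    then obtain c where "\<exists>i\<in>I. c i \<noteq> 0" "\<forall>b\<in>B. (\<Sum>i\<in>I. c i * u i b) = 0"
      using insert.IH[of I u] insert.prems by blast
    then show ?thesis using False by (intro exI[of _ c]) auto
  next
    case True
    then obtain k where k: "k \<in> I" "u k b \<noteq> 0" by blast
    define v where "v = (\<lambda>i b'. u i b' - u i b / u k b * u k b')"
    have "card B < card (I - {k})" using insert k by simp
    then obtain c where c: "\<exists>i\<in>I - {k}. c i \<noteq> 0" "\<forall>b'\<in>B. (\<Sum>i\<in>I - {k}. c i * v i b') = 0"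
      using insert.IH[of "I - {k}" v] insert.prems by blast
    define c' where "c' = c(k := - (\<Sum>i\<in>I - {k}. c i * (u i b / u k b)))"
    have sum_c': "(\<Sum>i\<in>I. c' i * u i b') = (\<Sum>i\<in>I - {k}. c i * v i b')" for b'
    proof -
      have "(\<Sum>i\<in>I. c' i * u i b') = c' k * u k b' + (\<Sum>i\<in>I - {k}. c' i * u i b')"
        using k insert.prems by (simp add: sum.remove)
      also have "(\<Sum>i\<in>I - {k}. c' i * u i b') = (\<Sum>i\<in>I - {k}. c i * u i b')"
        by (rule sum.cong) (auto simp: c'_def)
      also have "c' k * u k b' = - (\<Sum>i\<in>I - {k}. c i * (u i b / u k b) * u k b')"
        by (simp add: c'_def sum_distrib_right)
      finally show ?thesis
        by (simp add: v_def right_diff_distrib sum_subtractf mult.assoc)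
    qed
    have "(\<Sum>i\<in>I. c' i * u i b) = 0"
      unfolding sum_c' using k by (simp add: v_def)
    then have "\<forall>b'\<in>insert b B. (\<Sum>i\<in>I. c' i * u i b') = 0"
      using c(2) sum_c' by auto
    moreover have "\<exists>i\<in>I. c' i \<noteq> 0" using c(1) by (auto simp: c'_def)
    ultimately show ?thesis by blast
  qed
qed

text \<open>At \<open>\<kappa>\<close> the terms of smaller partitions vanish by induction on size
  and all others except the diagonal one by \<open>tri\<close>.\<close>

lemma triangular_zero:
  fixes H :: "nat list \<Rightarrow> nat list \<Rightarrow> 'f::field"
  assumes "finite A" and \<kappa>: "\<kappa> \<in> A"
    and tri: "\<And>\<kappa> \<mu>. \<kappa> \<in> A \<Longrightarrow> \<mu> \<in> A \<Longrightarrow> sum_list \<kappa> \<le> sum_list \<mu> \<Longrightarrow>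
      H \<kappa> \<mu> = (if \<kappa> = \<mu> then 1 else 0)"
    and zero: "\<And>\<kappa>. \<kappa> \<in> A \<Longrightarrow> (\<Sum>\<rho>\<in>A. d \<rho> * H \<kappa> \<rho>) = 0"
  shows "d \<kappa> = 0"
  using \<kappa>
proof (induction "sum_list \<kappa>" arbitrary: \<kappa> rule: less_induct)
  case less
  have "d \<rho> * H \<kappa> \<rho> = 0" if "\<rho> \<in> A - {\<kappa>}" for \<rho>
  proof (cases "sum_list \<rho> < sum_list \<kappa>")
    case True
    then show ?thesis using less.hyps[of \<rho>] that by simp
  next
    case False
    then have "H \<kappa> \<rho> = 0" using tri[of \<kappa> \<rho>] less.prems that by auto
    then show ?thesis by simp
  qed
  then have "(\<Sum>\<rho>\<in>A - {\<kappa>}. d \<rho> * H \<kappa> \<rho>) = 0" by (rule sum.neutral[rule_format])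
  then have "(\<Sum>\<rho>\<in>A. d \<rho> * H \<kappa> \<rho>) = d \<kappa> * H \<kappa> \<kappa>"
    using assms(1) less.prems by (subst sum.remove[of A \<kappa>]) simp_all
  then show ?case using zero[OF less.prems] tri[OF less.prems less.prems] by simp
qed

definition expo :: "nat \<Rightarrow> nat \<Rightarrow> (nat \<Rightarrow> nat) \<Rightarrow> (nat \<Rightarrow>\<^sub>0 int)" where
  "expo n d a = (\<Sum>i<n. Poly_Mapping.single i (int (d * a i)))"

lemma lookup_expo: "coef (expo n d a) i = (if i < n then int (d * a i) else 0)"
  by (simp add: expo_def lookup_sum lookup_single when_def)

lemma permute_expo:
  assumes "\<pi> permutes {..<n}"
  shows "permute_exponent \<pi> (expo n d a) = expo n d (\<lambda>i. a (\<pi> i))"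
  by (rule poly_mapping_eqI)
    (use permutes_in_image[OF assms] in \<open>auto simp: lookup_permute_exponent[OF assms] lookup_expo\<close>)

lemma exists_sorting_permutation:
  fixes a :: "nat \<Rightarrow> nat"
  obtains \<pi> \<kappa> where "\<pi> permutes {..<n}" "\<kappa> \<in> parts n" "\<And>i. i < n \<Longrightarrow> \<kappa> ! i = a (\<pi> i)"
    "sum_list \<kappa> = (\<Sum>i<n. a i)"
proof -
  define xs where "xs = map a [0..<n]"
  define \<kappa> where "\<kappa> = rev (sort xs)"
  have "mset \<kappa> = mset xs" by (simp add: \<kappa>_def)
  then obtain \<pi> where \<pi>: "\<pi> permutes {..<length xs}" "permute_list \<pi> xs = \<kappa>"
    by (rule mset_eq_permutation)
  have len: "length xs = n" by (simp add: xs_def)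
  have "\<kappa> \<in> parts n"
    by (simp add: parts_def \<kappa>_def sorted_wrt_rev len)
  moreover have "\<kappa> ! i = a (\<pi> i)" if "i < n" for i
  proof -
    have "\<pi> i < n" using permutes_in_image[OF \<pi>(1), of i] that len by simp
    then show ?thesis using \<pi> that len permute_list_nth[OF \<pi>(1), of i] by (simp add: xs_def)
  qed
  moreover have "sum_list \<kappa> = (\<Sum>i<n. a i)"
  proof -
    have "sum_list \<kappa> = sum_list xs" by (metis \<open>mset \<kappa> = mset xs\<close> sum_mset_sum_list)
    then show ?thesis by (simp add: xs_def interv_sum_list_conv_sum_set_nat atLeast0LessThan)
  qed
  ultimately show thesis using that \<pi>(1) len by simp
qed

text \<open>What the four families share. \<open>gv\<close> is the one-variable function behind the
  generators, \<open>good\<close> marks coordinates at which evaluation is multiplicative, and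
  \<open>Y\<close> is the grid seen through \<open>gv\<close>. \<open>dominant\<close> moves any
  coefficient to an exponent vector of nonnegative multiples of the degree, from which a permutation
  reaches a partition.\<close>

locale interp_setup =
  fixes F :: "'f::field interp_family" and n :: nat and gv :: "'f \<Rightarrow> 'f" and good :: "'f \<Rightarrow> bool"
    and Y :: "nat \<times> nat \<Rightarrow> 'f"
  assumes char_0: "\<And>k. of_nat k = (0 :: 'f) \<Longrightarrow> k = 0"
    and fdeg_pos: "0 < fdeg F"
    and gen_permute: "\<And>\<pi> i. \<pi> permutes {..<n} \<Longrightarrow> i < n \<Longrightarrow> permute_laurent \<pi> (fgen F i) \<in> fgen F ` {..<n}"
    and gen_degree: "\<And>i. ldegree (fgen F i) \<le> fdeg F"
    and gen_eval: "\<And>i x. \<forall>j. good (x j) \<Longrightarrow> leval (fgen F i) x = gv (x i)"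
    and eval_mult: "\<And>p r x. p \<in> gen_algebra (fgen F ` {..<n}) \<Longrightarrow> r \<in> gen_algebra (fgen F ` {..<n}) \<Longrightarrow>
      \<forall>j. good (x j) \<Longrightarrow> leval (p * r) x = leval p x * leval r x"
    and dominant: "\<And>p m. p \<in> gen_algebra (fgen F ` {..<n}) \<Longrightarrow> m \<in> supp p \<Longrightarrow>
      \<exists>a. coef p (expo n (fdeg F) a) = coef p m \<and>
        (\<Sum>i<n. fdeg F * a i) = exponent_size m"
    and shift_good: "\<And>\<kappa> i. good (fshift F n \<kappa> i)"
    and shift_eval: "\<And>\<kappa> i. gv (fshift F n \<kappa> i) = Y (site n \<kappa> i)"
    and norm_eq: "\<And>x. fnorm F n x = (\<Sum>i<n. gv (x i))"
    and norm_inj: "\<And>\<kappa> \<mu>. \<kappa> \<in> parts n \<Longrightarrow> \<mu> \<in> parts n \<Longrightarrow> sum_list \<kappa> \<noteq> sum_list \<mu> \<Longrightarrow>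
      (\<Sum>i<n. Y (site n \<kappa> i)) \<noteq> (\<Sum>i<n. Y (site n \<mu> i))"
    and Y_inj: "inj Y"
    and vanishing_witness: "\<And>\<kappa> \<mu>. \<kappa> \<in> parts n \<Longrightarrow> \<mu> \<in> parts n \<Longrightarrow> sum_list \<kappa> = sum_list \<mu> + 1 \<Longrightarrow>
      \<not> contains \<kappa> \<mu> \<Longrightarrow> vanishing_interpolant n Y \<mu> \<kappa>"
begin

abbreviation gens :: "'f laurent set" where "gens \<equiv> fgen F ` {..<n}"

abbreviation pt :: "nat list \<Rightarrow> nat \<Rightarrow> 'f" where "pt \<equiv> fshift F n"

lemma Lam_eval_mult:
  "p \<in> Lam F n \<Longrightarrow> r \<in> Lam F n \<Longrightarrow> leval (p * r) (pt \<kappa>) = leval p (pt \<kappa>) * leval r (pt \<kappa>)"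
  using eval_mult shift_good by (auto simp: Lam_def)

text \<open>Generators are substituted for the variables, which multiplies degrees by
  \<open>fdeg F\<close>.\<close>

lemma gen_algebra_of_polyfun:
  "polyfun n m f \<Longrightarrow> \<exists>p\<in>gen_algebra gens. ldegree p \<le> fdeg F * m \<and>
     (\<forall>x. (\<forall>j. good (x j)) \<longrightarrow> leval p x = f (\<lambda>i. gv (x i)))"
proof (induction rule: polyfun.induct)
  case (polyfun_const c)
  show ?case
    by (rule bexI[of _ "const c"]) (auto simp: ldegree_const leval_const intro: gen_algebra.intros)
next
  case (polyfun_var i)
  then show ?case
    by (intro bexI[of _ "fgen F i"]) (auto simp: gen_eval gen_degree intro: gen_algebra.intros)
next
  case (polyfun_mono m f m')
  then show ?case by (meson mult_le_mono2 order_trans)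
next
  case (polyfun_add m f g)
  then obtain p r where "p \<in> gen_algebra gens" "ldegree p \<le> fdeg F * m"
    "\<forall>x. (\<forall>j. good (x j)) \<longrightarrow> leval p x = f (\<lambda>i. gv (x i))"
    "r \<in> gen_algebra gens" "ldegree r \<le> fdeg F * m"
    "\<forall>x. (\<forall>j. good (x j)) \<longrightarrow> leval r x = g (\<lambda>i. gv (x i))" by blast
  then show ?case
    by (intro bexI[of _ "p + r"]) (auto simp: leval_add intro: ldegree_add_le gen_algebra.intros)
next
  case (polyfun_mult m f m' g)
  then obtain p r where "p \<in> gen_algebra gens" "ldegree p \<le> fdeg F * m"
    "\<forall>x. (\<forall>j. good (x j)) \<longrightarrow> leval p x = f (\<lambda>i. gv (x i))"
    "r \<in> gen_algebra gens" "ldegree r \<le> fdeg F * m'"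
    "\<forall>x. (\<forall>j. good (x j)) \<longrightarrow> leval r x = g (\<lambda>i. gv (x i))" by blast
  then show ?case
    by (intro bexI[of _ "p * r"])
      (auto simp: eval_mult distrib_left intro: ldegree_mult_le gen_algebra.intros)
qed

text \<open>Averaging over all permutations produces symmetry; n! is invertible in characteristic
  zero. A value survives the averaging if \<open>f\<close> is constant on the orbit of the point, so
  this premise is attached to each point separately.\<close>

lemma Lam_of_polyfun:
  assumes "polyfun n m f"
  obtains p where "p \<in> Lam F n" "ldegree p \<le> fdeg F * m"
    "\<And>\<kappa>. (\<And>\<pi>. \<pi> permutes {..<n} \<Longrightarrow> f (\<lambda>i. Y (site n \<kappa> (\<pi> i))) = f (\<lambda>i. Y (site n \<kappa> i))) \<Longrightarrow>
       leval p (pt \<kappa>) = f (\<lambda>i. Y (site n \<kappa> i))"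
proof -
  obtain p where p: "p \<in> gen_algebra gens" "ldegree p \<le> fdeg F * m"
    "\<And>x. (\<And>j. good (x j)) \<Longrightarrow> leval p x = f (\<lambda>i. gv (x i))"
    using gen_algebra_of_polyfun[OF assms] by blast
  define S where "S = {\<pi>. \<pi> permutes {..<n}}"
  have S: "finite S" "card S = fact n" "\<And>\<pi>. \<pi> \<in> S \<Longrightarrow> \<pi> permutes {..<n}"
    using finite_permutations[of "{..<n}"] card_permutations[of "{..<n}" n] by (auto simp: S_def)
  have fact_nz: "of_nat (fact n) \<noteq> (0 :: 'f)" using char_0[of "fact n"] by auto
  define q where "q = const (1 / of_nat (fact n)) * (\<Sum>\<pi>\<in>S. permute_laurent \<pi> p)"
  have "permute_laurent \<pi>' (\<Sum>\<pi>\<in>S. permute_laurent \<pi> p) = (\<Sum>\<pi>\<in>S. permute_laurent \<pi> p)"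
    if \<pi>': "\<pi>' permutes {..<n}" for \<pi>'
  proof -
    have zero: "permute_laurent \<pi>' 0 = 0"
      by (simp add: permute_laurent_def bij_permute_exponent[OF \<pi>'])
    have "permute_laurent \<pi>' (\<Sum>\<pi>\<in>A. permute_laurent \<pi> p) = (\<Sum>\<pi>\<in>A. permute_laurent \<pi>' (permute_laurent \<pi> p))"
      for A
      by (induction A rule: infinite_finite_induct) (auto simp: permute_laurent_add[OF \<pi>'] zero)
    also have "(\<Sum>\<pi>\<in>S. permute_laurent \<pi>' (permute_laurent \<pi> p)) = (\<Sum>\<pi>\<in>S. permute_laurent (\<pi>' \<circ> \<pi>) p)"
      by (intro sum.cong refl permute_laurent_comp[OF S(3) \<pi>'])
    also have "\<dots> = (\<Sum>\<pi>\<in>S. permute_laurent \<pi> p)"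
      unfolding S_def
      by (rule setum_permutations_compose_left[OF \<pi>', of "\<lambda>\<pi>. permute_laurent \<pi> p", symmetric])
    finally show ?thesis .
  qed
  then have "symmetric_laurent n q"
    unfolding q_def by (intro symmetric_mult symmetric_const) (simp add: symmetric_laurent_iff)
  moreover have "q \<in> gen_algebra gens"
    unfolding q_def
  proof (rule gen_algebra.intros(4)[OF gen_algebra.intros(1) gen_algebra_sum])
    fix \<pi> assume "\<pi> \<in> S"
    then show "permute_laurent \<pi> p \<in> gen_algebra gens"
      using gen_permute[OF S(3)] by (intro gen_algebra_permute[OF S(3) _ p(1)]) auto
  qed
  moreover have "ldegree q \<le> fdeg F * m"
    unfolding q_def using p(2) S by (intro ldegree_const_mult_le ldegree_sum_le ldegree_permute_le) auto
  moreover have "leval q (pt \<kappa>) = f (\<lambda>i. Y (site n \<kappa> i))"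
    if inv: "\<And>\<pi>. \<pi> permutes {..<n} \<Longrightarrow> f (\<lambda>i. Y (site n \<kappa> (\<pi> i))) = f (\<lambda>i. Y (site n \<kappa> i))" for \<kappa>
  proof -
    have "leval (permute_laurent \<pi> p) (pt \<kappa>) = f (\<lambda>i. Y (site n \<kappa> i))" if "\<pi> \<in> S" for \<pi>
      using inv[OF S(3)[OF that]] leval_permute[OF S(3)[OF that], of p "pt \<kappa>"]
      by (simp add: p(3) shift_good shift_eval)
    then show ?thesis
      using S fact_nz by (simp add: q_def leval_const_mult leval_sum)
  qed
  ultimately show thesis using that by (simp add: Lam_def)
qed

text \<open>A monomial of a nonzero \<open>p\<close> is moved by \<open>dominant\<close> and then by
  a sorting permutation to \<open>fdeg F\<close> times a partition, with the same coefficient; the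
  degree bounds the size of that partition.\<close>

lemma Lam_eq_0:
  assumes p: "p \<in> Lam F n" "ldegree p \<le> fdeg F * M"
    and zero: "\<And>\<kappa>. \<kappa> \<in> parts_upto n M \<Longrightarrow> coef p (expo n (fdeg F) (\<lambda>i. \<kappa> ! i)) = 0"
  shows "p = 0"
proof (rule ccontr)
  assume "p \<noteq> 0"
  then obtain m where m: "m \<in> supp p"
    by (metis all_not_in_conv keys_eq_empty)
  then obtain a where a: "coef p (expo n (fdeg F) a) = coef p m"
    "(\<Sum>i<n. fdeg F * a i) = exponent_size m"
    using dominant p(1) by (auto simp: Lam_def)
  obtain \<pi> \<kappa> where \<pi>: "\<pi> permutes {..<n}" and \<kappa>: "\<kappa> \<in> parts n" "\<And>i. i < n \<Longrightarrow> \<kappa> ! i = a (\<pi> i)"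
    "sum_list \<kappa> = (\<Sum>i<n. a i)"
    by (rule exists_sorting_permutation[of n a]) blast
  have "fdeg F * sum_list \<kappa> \<le> fdeg F * M"
    using a(2) m p(2) \<kappa>(3) by (simp add: ldegree_le_iff sum_distrib_left)
  then have "\<kappa> \<in> parts_upto n M" using \<kappa>(1) fdeg_pos by (simp add: parts_upto_def)
  moreover have "expo n (fdeg F) (\<lambda>i. \<kappa> ! i) = permute_exponent \<pi> (expo n (fdeg F) a)"
    unfolding permute_expo[OF \<pi>] by (rule poly_mapping_eqI) (simp add: lookup_expo \<kappa>(2))
  moreover have "coef p (permute_exponent \<pi> (expo n (fdeg F) a)) =
      coef p (expo n (fdeg F) a)"
    using p(1) \<pi> by (simp add: Lam_def symmetric_laurent_def permute_exponent_def)
  ultimately have "coef p m = 0" using zero a(1) by metis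
  then show False using m by (simp add: in_keys_iff)
qed

section \<open>Existence and uniqueness of interpolation polynomials\<close>

definition interpolates :: "'f laurent \<Rightarrow> nat list \<Rightarrow> bool" where
  "interpolates h \<mu> \<longleftrightarrow> h \<in> Lam F n \<and> ldegree h \<le> fdeg F * sum_list \<mu> \<and>
     (\<forall>\<kappa>\<in>parts n. sum_list \<kappa> \<le> sum_list \<mu> \<longrightarrow> leval h (pt \<kappa>) = (if \<kappa> = \<mu> then 1 else 0))"

lemma interpolates_exists: "\<exists>h. interpolates h \<mu>"
proof -
  obtain f where f: "sfun n (sum_list \<mu>) f"
    "\<forall>\<kappa>\<in>parts n. sum_list \<kappa> \<le> sum_list \<mu> \<longrightarrow>
       f (\<lambda>i. Y (0 + \<kappa> ! i, 0 + (n - 1 - i))) = (if \<kappa> = \<mu> then 1 else 0)"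
    using interpolation_sfun[of "\<lambda>r s. Y (r, s)" n "sum_list \<mu>" 0 0 "\<lambda>\<kappa>. if \<kappa> = \<mu> then 1 else 0"]
      injD[OF Y_inj] by auto
  obtain p where "p \<in> Lam F n" "ldegree p \<le> fdeg F * sum_list \<mu>"
    "\<And>\<kappa>. (\<And>\<pi>. \<pi> permutes {..<n} \<Longrightarrow> f (\<lambda>i. Y (site n \<kappa> (\<pi> i))) = f (\<lambda>i. Y (site n \<kappa> i))) \<Longrightarrow>
       leval p (pt \<kappa>) = f (\<lambda>i. Y (site n \<kappa> i))"
    using Lam_of_polyfun[OF sfun_imp_polyfun[OF f(1)]] by blast
  moreover have "f (\<lambda>i. Y (site n \<kappa> (\<pi> i))) = f (\<lambda>i. Y (site n \<kappa> i))" if "\<pi> permutes {..<n}" for \<kappa> \<pi>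
    using sfun_symmetric[OF f(1) that, of "\<lambda>i. Y (site n \<kappa> i)"] by simp
  ultimately have "interpolates p \<mu>"
    using f(2) by (simp add: interpolates_def site_def)
  then show ?thesis by blast
qed

text \<open>A dimension count: an element of degree at most \<open>d M\<close> is determined by its coefficients at the
  dominant exponents \<open>d \<kappa>\<close>, \<open>\<bar>\<kappa>\<bar> \<le> M\<close>, and there are as many independent \<open>h \<mu>\<close>.\<close>

lemma interpolation_expansion:
  assumes h: "\<And>\<mu>. \<mu> \<in> parts n \<Longrightarrow> interpolates (h \<mu>) \<mu>"
    and p: "p \<in> Lam F n" "ldegree p \<le> fdeg F * M"
  obtains c where "p = (\<Sum>\<mu>\<in>parts_upto n M. const (c \<mu>) * h \<mu>)"
proof -
  let ?P = "parts_upto n M"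
  have P: "\<mu> \<in> parts n" "sum_list \<mu> \<le> M" if "\<mu> \<in> ?P" for \<mu>
    using that by (auto simp: parts_upto_def)
  \<comment> \<open>\<open>None\<close> stands for \<open>p\<close> and \<open>Some \<mu>\<close>
    for \<open>h \<mu>\<close>, giving one unknown more than there are dominant exponents.\<close>
  define I where "I = insert None (Some ` ?P)"
  define w where "w = case_option p h"
  have "card ?P < card I"
    unfolding I_def by (subst card_insert_disjoint) (auto simp: card_image)
  then obtain c where c: "\<exists>i\<in>I. c i \<noteq> 0"
    "\<forall>\<kappa>\<in>?P. (\<Sum>i\<in>I. c i * coef (w i) (expo n (fdeg F) (\<lambda>i. \<kappa> ! i))) = 0"
    using homogeneous_system_solution[of ?P I
        "\<lambda>i \<kappa>. coef (w i) (expo n (fdeg F) (\<lambda>i. \<kappa> ! i))"] by (auto simp: I_def)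
  have h_le: "h \<mu> \<in> Lam F n" "ldegree (h \<mu>) \<le> fdeg F * M" if "\<mu> \<in> ?P" for \<mu>
    using h[OF P(1)[OF that]] P(2)[OF that] unfolding interpolates_def
    by (auto intro: order_trans[OF _ mult_le_mono2])
  have w: "w i \<in> Lam F n" "ldegree (w i) \<le> fdeg F * M" if "i \<in> I" for i
    using that p h_le unfolding I_def w_def by auto
  have zero: "(\<Sum>i\<in>I. const (c i) * w i) = 0"
  proof (rule Lam_eq_0)
    show "(\<Sum>i\<in>I. const (c i) * w i) \<in> Lam F n" by (intro Lam_sum Lam_mult Lam_const w)
    show "ldegree (\<Sum>i\<in>I. const (c i) * w i) \<le> fdeg F * M"
      by (intro ldegree_sum_le ldegree_const_mult_le w)
  qed (use c(2) in \<open>simp add: lookup_sum lookup_const_mult\<close>)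
  have split: "(\<Sum>i\<in>I. const (c i) * w i) = const (c None) * p + (\<Sum>\<mu>\<in>?P. const (c (Some \<mu>)) * h \<mu>)"
    unfolding I_def by (subst sum.insert) (auto simp: sum.reindex w_def)
  \<comment> \<open>Otherwise the relation would involve only the \<open>h \<mu>\<close>, whose
    values form a unitriangular matrix.\<close>
  have "c None \<noteq> 0"
  proof
    assume None: "c None = 0"
    then have sum0: "(\<Sum>\<mu>\<in>?P. const (c (Some \<mu>)) * h \<mu>) = 0"
      using zero split by (simp add: const_0)
    have "c (Some \<kappa>) = 0" if "\<kappa> \<in> ?P" for \<kappa>
    proof (rule triangular_zero[of ?P \<kappa> "\<lambda>\<kappa> \<mu>. leval (h \<mu>) (pt \<kappa>)" "\<lambda>\<mu>. c (Some \<mu>)"])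
      show "(\<Sum>\<rho>\<in>?P. c (Some \<rho>) * leval (h \<rho>) (pt \<kappa>)) = 0" for \<kappa>
        using arg_cong[OF sum0, of "\<lambda>p. leval p (pt \<kappa>)"]
        by (simp add: leval_sum leval_const_mult leval_0)
      show "leval (h \<mu>) (pt \<kappa>) = (if \<kappa> = \<mu> then 1 else 0)"
        if "\<kappa> \<in> ?P" "\<mu> \<in> ?P" "sum_list \<kappa> \<le> sum_list \<mu>" for \<kappa> \<mu>
        using h[OF P(1)[OF that(2)]] P(1)[OF that(1)] that(3) unfolding interpolates_def by blast
    qed (use that in auto)
    then show False using c(1) None by (auto simp: I_def)
  qed
  have "p = const (1 / c None) * (const (c None) * p)"
    using \<open>c None \<noteq> 0\<close> unfolding mult.assoc[symmetric] const_mult by (simp add: const_def)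
  also have "const (c None) * p = - (\<Sum>\<mu>\<in>?P. const (c (Some \<mu>)) * h \<mu>)"
    using zero split by (simp add: eq_neg_iff_add_eq_0)
  also have "const (1 / c None) * - (\<Sum>\<mu>\<in>?P. const (c (Some \<mu>)) * h \<mu>) =
      const (- 1 / c None) * (\<Sum>\<mu>\<in>?P. const (c (Some \<mu>)) * h \<mu>)"
    by (simp add: const_def single_uminus)
  also have "\<dots> = (\<Sum>\<mu>\<in>?P. const (- 1 / c None * c (Some \<mu>)) * h \<mu>)"
    by (simp only: sum_distrib_left mult.assoc[symmetric] const_mult)
  finally show thesis by (rule that)
qed

text \<open>The coefficients of \<open>p\<close> in an interpolating family are annihilated by a
  unitriangular matrix of values, so interpolation is unique.\<close>

lemma Lam_vanishing:
  assumes p: "p \<in> Lam F n" "ldegree p \<le> fdeg F * M"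
    and zero: "\<And>\<kappa>. \<kappa> \<in> parts_upto n M \<Longrightarrow> leval p (pt \<kappa>) = 0"
  shows "p = 0"
proof -
  let ?P = "parts_upto n M"
  have P: "\<mu> \<in> parts n" "sum_list \<mu> \<le> M" if "\<mu> \<in> ?P" for \<mu>
    using that by (auto simp: parts_upto_def)
  \<comment> \<open>\<open>interp_poly\<close> is a definite description whose meaning rests on this
    very lemma, so an interpolating family is chosen by \<open>SOME\<close>.\<close>
  define h where "h = (\<lambda>\<mu>. SOME h. interpolates h \<mu>)"
  have h: "interpolates (h \<mu>) \<mu>" for \<mu>
    unfolding h_def using interpolates_exists by (rule someI_ex)
  obtain c where c: "p = (\<Sum>\<mu>\<in>?P. const (c \<mu>) * h \<mu>)"
    using interpolation_expansion[OF h p] by blast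
  have "c \<kappa> = 0" if "\<kappa> \<in> ?P" for \<kappa>
  proof (rule triangular_zero[of ?P \<kappa> "\<lambda>\<kappa> \<mu>. leval (h \<mu>) (pt \<kappa>)"])
    show "(\<Sum>\<rho>\<in>?P. c \<rho> * leval (h \<rho>) (pt \<kappa>)) = 0" if "\<kappa> \<in> ?P" for \<kappa>
      using zero[OF that] c by (simp add: leval_sum leval_const_mult)
    show "leval (h \<mu>) (pt \<kappa>) = (if \<kappa> = \<mu> then 1 else 0)"
      if "\<kappa> \<in> ?P" "\<mu> \<in> ?P" "sum_list \<kappa> \<le> sum_list \<mu>" for \<kappa> \<mu>
      using h[of \<mu>] P(1)[OF that(1)] that(3) unfolding interpolates_def by blast
  qed (use that in auto)
  then show ?thesis using c by (simp add: const_0)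
qed

lemma Lam_eqI:
  assumes "p \<in> Lam F n" "ldegree p \<le> fdeg F * M" "r \<in> Lam F n" "ldegree r \<le> fdeg F * M"
    and "\<And>\<kappa>. \<kappa> \<in> parts_upto n M \<Longrightarrow> leval p (pt \<kappa>) = leval r (pt \<kappa>)"
  shows "p = r"
proof -
  have "p + const (- 1) * r = 0"
    by (rule Lam_vanishing[of _ M])
      (use assms in \<open>auto intro!: Lam_add Lam_mult Lam_const ldegree_add_le ldegree_const_mult_le
        simp: leval_add leval_const_mult\<close>)
  then show ?thesis by (simp add: const_def single_uminus)
qed

lemma interp_poly_interpolates: "interpolates (interp_poly F n \<mu>) \<mu>"
proof -
  have "\<exists>!h. interpolates h \<mu>"
  proof (rule ex_ex1I[OF interpolates_exists])
    fix h h' assume hh: "interpolates h \<mu>" "interpolates h' \<mu>"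
    show "h = h'"
      by (rule Lam_eqI[of _ "sum_list \<mu>"]) (use hh in \<open>auto simp: interpolates_def parts_upto_def\<close>)
  qed
  then have "interpolates (THE h. interpolates h \<mu>) \<mu>" by (rule theI')
  then show ?thesis by (simp add: interp_poly_def interpolates_def)
qed

lemma interp_poly_eqI: "interpolates h \<mu> \<Longrightarrow> interp_poly F n \<mu> = h"
  by (rule Lam_eqI[of _ "sum_list \<mu>"])
    (use interp_poly_interpolates[of \<mu>] in \<open>auto simp: interpolates_def parts_upto_def\<close>)

lemma interp_poly_Lam: "interp_poly F n \<mu> \<in> Lam F n"
  and interp_poly_degree: "ldegree (interp_poly F n \<mu>) \<le> fdeg F * sum_list \<mu>"
  using interp_poly_interpolates by (auto simp: interpolates_def)

lemma binom_triangular: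
  "\<kappa> \<in> parts n \<Longrightarrow> sum_list \<kappa> \<le> sum_list \<mu> \<Longrightarrow> binom F n \<kappa> \<mu> = (if \<kappa> = \<mu> then 1 else 0)"
  using interp_poly_interpolates[of \<mu>] unfolding interpolates_def binom_def by blast

text \<open>The function from \<open>vanishing_witness\<close> gives an element with the defining
  properties of the interpolation polynomial, hence equal to it, and it is zero at
  \<open>\<kappa>\<close> by construction.\<close>

lemma binom_not_contained:
  assumes "\<kappa> \<in> parts n" "\<mu> \<in> parts n" "sum_list \<kappa> = sum_list \<mu> + 1" "\<not> contains \<kappa> \<mu>"
  shows "binom F n \<kappa> \<mu> = 0"
proof -
  obtain g where g: "polyfun n (sum_list \<mu>) g"
    "\<And>\<rho> \<pi>. \<rho> \<in> parts n \<Longrightarrow> \<pi> permutes {..<n} \<Longrightarrow>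
      g (\<lambda>i. Y (site n \<rho> (\<pi> i))) = g (\<lambda>i. Y (site n \<rho> i))"
    "\<And>\<rho>. \<rho> \<in> parts n \<Longrightarrow> sum_list \<rho> \<le> sum_list \<mu> \<Longrightarrow>
      g (\<lambda>i. Y (site n \<rho> i)) = (if \<rho> = \<mu> then 1 else 0)"
    "g (\<lambda>i. Y (site n \<kappa> i)) = 0"
    using vanishing_witness[OF assms] unfolding vanishing_interpolant_def by blast
  obtain p where p: "p \<in> Lam F n" "ldegree p \<le> fdeg F * sum_list \<mu>"
    "\<And>\<rho>. \<rho> \<in> parts n \<Longrightarrow> leval p (pt \<rho>) = g (\<lambda>i. Y (site n \<rho> i))"
    using Lam_of_polyfun[OF g(1)] g(2) by metis
  have "interpolates p \<mu>" using p g(3) by (simp add: interpolates_def)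
  then show ?thesis using interp_poly_eqI[of p \<mu>] p(3) g(4) assms(1) by (simp add: binom_def)
qed

definition norm_at :: "nat list \<Rightarrow> 'f" where
  "norm_at \<kappa> = fnorm F n (pt \<kappa>)"

lemma norm_at_inj:
  "\<kappa> \<in> parts n \<Longrightarrow> \<mu> \<in> parts n \<Longrightarrow> sum_list \<kappa> \<noteq> sum_list \<mu> \<Longrightarrow> norm_at \<kappa> \<noteq> norm_at \<mu>"
  using norm_inj by (simp add: norm_at_def norm_eq shift_eval)

text \<open>By the degree bound it suffices to compare values up to size one above that of
  \<open>\<mu>\<close>. At a cover the right side has a single term. At any other partition both
  sides vanish: through the norm factor at \<open>\<mu>\<close>, through the defining conditions at
  small sizes, and through the extra vanishing at the top size.\<close>

lemma pieri:
  assumes \<kappa>: "\<kappa> \<in> parts n" and \<mu>: "\<mu> \<in> parts n"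
  shows "(norm_at \<kappa> - norm_at \<mu>) * binom F n \<kappa> \<mu> =
    (\<Sum>\<rho>\<in>covers_of n \<mu>. (norm_at \<rho> - norm_at \<mu>) * binom F n \<rho> \<mu> * binom F n \<kappa> \<rho>)"
proof -
  define f where "f = (\<lambda>y :: nat \<Rightarrow> 'f. \<Sum>i<n. y i)"
  have "polyfun n 1 f" unfolding f_def by (intro polyfun_sum polyfun_var) auto
  moreover have "f (\<lambda>i. Y (site n \<kappa> (\<pi> i))) = f (\<lambda>i. Y (site n \<kappa> i))" if "\<pi> permutes {..<n}" for \<kappa> \<pi>
    using sum.permute[OF that, of "\<lambda>i. Y (site n \<kappa> i)"] by (simp add: f_def o_def)
  ultimately obtain N where N: "N \<in> Lam F n" "ldegree N \<le> fdeg F * 1"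
    "\<And>\<kappa>. leval N (pt \<kappa>) = f (\<lambda>i. Y (site n \<kappa> i))"
    using Lam_of_polyfun by metis
  have N_val: "leval N (pt \<kappa>) = norm_at \<kappa>" for \<kappa>
    by (simp add: N(3) norm_at_def norm_eq shift_eval f_def)
  define p where "p = (N + const (- norm_at \<mu>)) * interp_poly F n \<mu>"
  define r where "r = (\<Sum>\<rho>\<in>covers_of n \<mu>. const ((norm_at \<rho> - norm_at \<mu>) * binom F n \<rho> \<mu>) * interp_poly F n \<rho>)"
  have p_val: "leval p (pt x) = (norm_at x - norm_at \<mu>) * binom F n x \<mu>" for x
    unfolding p_def
    by (subst Lam_eval_mult)
      (auto intro!: Lam_add Lam_const N interp_poly_Lam simp: leval_add leval_const N_val binom_def)
  have r_val: "leval r (pt x) =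
      (\<Sum>\<rho>\<in>covers_of n \<mu>. (norm_at \<rho> - norm_at \<mu>) * binom F n \<rho> \<mu> * binom F n x \<rho>)" for x
    by (simp add: r_def leval_sum leval_const_mult binom_def)
  have "p = r"
  proof (rule Lam_eqI[of _ "1 + sum_list \<mu>"])
    show "p \<in> Lam F n" unfolding p_def by (intro Lam_mult Lam_add Lam_const N interp_poly_Lam)
    show "r \<in> Lam F n" unfolding r_def by (intro Lam_sum Lam_mult Lam_const interp_poly_Lam)
    show "ldegree p \<le> fdeg F * (1 + sum_list \<mu>)"
      unfolding p_def distrib_left
      by (intro ldegree_mult_le ldegree_add_le N interp_poly_degree) (simp add: ldegree_const)
    show "ldegree r \<le> fdeg F * (1 + sum_list \<mu>)"
      unfolding r_def
    proof (intro ldegree_sum_le ldegree_const_mult_le)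
      fix \<rho> assume "\<rho> \<in> covers_of n \<mu>"
      then have "sum_list \<rho> = 1 + sum_list \<mu>" by (auto simp: covers_of_def covers_def)
      then show "ldegree (interp_poly F n \<rho>) \<le> fdeg F * (1 + sum_list \<mu>)"
        using interp_poly_degree[of \<rho>] by simp
    qed
    fix x assume "x \<in> parts_upto n (1 + sum_list \<mu>)"
    then have x: "x \<in> parts n" "sum_list x \<le> 1 + sum_list \<mu>" by (auto simp: parts_upto_def)
    have delta: "binom F n x \<rho> = (if x = \<rho> then 1 else 0)" if "\<rho> \<in> covers_of n \<mu>" for \<rho>
      using that x by (intro binom_triangular) (auto simp: covers_of_def covers_def)
    have "leval r (pt x) = (\<Sum>\<rho>\<in>covers_of n \<mu>.
        if x = \<rho> then (norm_at \<rho> - norm_at \<mu>) * binom F n \<rho> \<mu> else 0)"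
      unfolding r_val by (intro sum.cong refl) (simp add: delta)
    also have "\<dots> = (if x \<in> covers_of n \<mu> then (norm_at x - norm_at \<mu>) * binom F n x \<mu> else 0)"
      by (simp add: sum.delta)
    finally have r_at: "leval r (pt x) =
      (if x \<in> covers_of n \<mu> then (norm_at x - norm_at \<mu>) * binom F n x \<mu> else 0)" .
    show "leval p (pt x) = leval r (pt x)"
    proof (cases "x \<in> covers_of n \<mu>")
      case True
      then show ?thesis by (simp add: p_val r_at)
    next
      case not_cover: False
      have "x = \<mu> \<or> binom F n x \<mu> = 0"
      proof (cases "sum_list x \<le> sum_list \<mu>")
        case True
        then show ?thesis using binom_triangular[OF x(1) True] by simp
      next
        case False
        then have "sum_list x = sum_list \<mu> + 1" using x(2) by simp
        moreover from this have "\<not> contains x \<mu>"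
          using not_cover x(1) by (auto simp: covers_of_def covers_def)
        ultimately show ?thesis using binom_not_contained[OF x(1) \<mu>] by blast
      qed
      then show ?thesis using not_cover by (auto simp: p_val r_at)
    qed
  qed
  then show ?thesis using p_val[of \<kappa>] r_val[of \<kappa>] by simp
qed

section \<open>Products expanded in the interpolation basis\<close>

definition expands :: "(nat list \<Rightarrow>\<^sub>0 'f) \<Rightarrow> 'f laurent \<Rightarrow> bool" where
  "expands c p \<longleftrightarrow> supp c \<subseteq> parts n \<and>
     p = (\<Sum>\<kappa>\<in>supp c. const (coef c \<kappa>) * interp_poly F n \<kappa>)"

lemma expands_superset:
  assumes "finite A" "supp c \<subseteq> A"
  shows "(\<Sum>\<kappa>\<in>supp c. const (coef c \<kappa>) * interp_poly F n \<kappa>) =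
    (\<Sum>\<kappa>\<in>A. const (coef c \<kappa>) * interp_poly F n \<kappa>)"
  by (rule sum.mono_neutral_left) (use assms in \<open>auto simp: in_keys_iff const_0\<close>)

lemma expands_exists:
  assumes "p \<in> Lam F n" "ldegree p \<le> fdeg F * M"
  shows "\<exists>c. expands c p"
proof -
  obtain c where c: "p = (\<Sum>\<mu>\<in>parts_upto n M. const (c \<mu>) * interp_poly F n \<mu>)"
    using interpolation_expansion[OF interp_poly_interpolates assms] by blast
  define c' where "c' = (\<Sum>\<mu>\<in>parts_upto n M. Poly_Mapping.single \<mu> (c \<mu>))"
  have lookup: "coef c' \<mu> = (if \<mu> \<in> parts_upto n M then c \<mu> else 0)" for \<mu>
    by (simp add: c'_def lookup_sum lookup_single when_def)
  then have keys_c': "supp c' \<subseteq> parts_upto n M"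
    by (auto simp: in_keys_iff split: if_splits)
  have "expands c' p"
    unfolding expands_def expands_superset[OF finite_parts_upto keys_c']
  proof
    show "supp c' \<subseteq> parts n"
      using keys_c' by (auto simp: parts_upto_def)
    show "p = (\<Sum>\<kappa>\<in>parts_upto n M. const (coef c' \<kappa>) * interp_poly F n \<kappa>)"
      using c by (simp add: lookup cong: sum.cong)
  qed
  then show ?thesis by blast
qed

lemma expands_unique:
  assumes "expands c p" "expands c' p"
  shows "c = c'"
proof (rule poly_mapping_eqI)
  fix \<kappa>
  define A where "A = supp c \<union> supp c'"
  have A: "finite A" "A \<subseteq> parts n" "supp c \<subseteq> A" "supp c' \<subseteq> A"
    using assms by (auto simp: A_def expands_def)
  have p: "p = (\<Sum>\<kappa>\<in>A. const (coef c \<kappa>) * interp_poly F n \<kappa>)"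
    "p = (\<Sum>\<kappa>\<in>A. const (coef c' \<kappa>) * interp_poly F n \<kappa>)"
    using assms A expands_superset[OF A(1)] by (auto simp: expands_def)
  have eval: "(\<Sum>\<rho>\<in>A. coef c \<rho> * binom F n x \<rho>) =
      (\<Sum>\<rho>\<in>A. coef c' \<rho> * binom F n x \<rho>)" for x
    using arg_cong[OF p(1), of "\<lambda>p. leval p (pt x)"] arg_cong[OF p(2), of "\<lambda>p. leval p (pt x)"]
    by (simp add: leval_sum leval_const_mult binom_def)
  show "coef c \<kappa> = coef c' \<kappa>"
  proof (cases "\<kappa> \<in> A")
    case True
    have "coef c \<kappa> - coef c' \<kappa> = 0"
    proof (rule triangular_zero[of A \<kappa> "binom F n" "\<lambda>\<kappa>. coef c \<kappa> - coef c' \<kappa>"])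
      show "(\<Sum>\<rho>\<in>A. (coef c \<rho> - coef c' \<rho>) * binom F n x \<rho>) = 0" for x
        using eval[of x] by (simp add: left_diff_distrib sum_subtractf)
    qed (use A True binom_triangular in auto)
    then show ?thesis by simp
  next
    case False
    then show ?thesis using A by (metis in_keys_iff subsetD)
  qed
qed

lemma LR_expansion_expands: "expands (LR_expansion F n \<mu> \<nu>) (interp_poly F n \<mu> * interp_poly F n \<nu>)"
proof -
  have "\<exists>c. expands c (interp_poly F n \<mu> * interp_poly F n \<nu>)"
    by (rule expands_exists[of _ "sum_list \<mu> + sum_list \<nu>"])
      (auto intro!: Lam_mult interp_poly_Lam ldegree_mult_le interp_poly_degree simp: distrib_left)
  then have "\<exists>!c. expands c (interp_poly F n \<mu> * interp_poly F n \<nu>)"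
    using expands_unique by blast
  then have "expands (THE c. expands c (interp_poly F n \<mu> * interp_poly F n \<nu>))
    (interp_poly F n \<mu> * interp_poly F n \<nu>)" by (rule theI')
  then show ?thesis by (simp add: LR_expansion_def expands_def)
qed

text \<open>Interpolation polynomials of other partitions that are not smaller vanish at
  \<open>\<kappa>\<close>, so evaluation there cuts the expansion off and leaves a finite triangular
  system.\<close>

lemma binom_mult:
  assumes "\<kappa> \<in> parts n"
  shows "binom F n \<kappa> \<mu> * binom F n \<kappa> \<nu> =
    (\<Sum>\<rho>\<in>parts_upto n (sum_list \<kappa>). LR_coeff F n \<rho> \<mu> \<nu> * binom F n \<kappa> \<rho>)"
proof -
  define c where "c = LR_expansion F n \<mu> \<nu>"
  have c: "supp c \<subseteq> parts n" "interp_poly F n \<mu> * interp_poly F n \<nu> =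
      (\<Sum>\<kappa>\<in>supp c. const (coef c \<kappa>) * interp_poly F n \<kappa>)"
    using LR_expansion_expands[of \<mu> \<nu>] by (simp_all add: expands_def c_def)
  have "binom F n \<kappa> \<mu> * binom F n \<kappa> \<nu> = leval (interp_poly F n \<mu> * interp_poly F n \<nu>) (pt \<kappa>)"
    by (simp add: binom_def Lam_eval_mult interp_poly_Lam)
  also have "\<dots> = (\<Sum>\<rho>\<in>supp c. coef c \<rho> * binom F n \<kappa> \<rho>)"
    by (simp add: c(2) leval_sum leval_const_mult binom_def)
  also have "\<dots> = (\<Sum>\<rho>\<in>supp c \<union> parts_upto n (sum_list \<kappa>). coef c \<rho> * binom F n \<kappa> \<rho>)"
    by (rule sum.mono_neutral_left) (auto simp: in_keys_iff)
  also have "\<dots> = (\<Sum>\<rho>\<in>parts_upto n (sum_list \<kappa>). coef c \<rho> * binom F n \<kappa> \<rho>)"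
  proof (rule sum.mono_neutral_right)
    show "\<forall>\<rho>\<in>supp c \<union> parts_upto n (sum_list \<kappa>) - parts_upto n (sum_list \<kappa>).
        coef c \<rho> * binom F n \<kappa> \<rho> = 0"
    proof
      fix \<rho> assume "\<rho> \<in> supp c \<union> parts_upto n (sum_list \<kappa>) - parts_upto n (sum_list \<kappa>)"
      then have "sum_list \<kappa> < sum_list \<rho>" using c(1) by (auto simp: parts_upto_def)
      then have "binom F n \<kappa> \<rho> = 0" using binom_triangular[OF assms, of \<rho>] by auto
      then show "coef c \<rho> * binom F n \<kappa> \<rho> = 0" by simp
    qed
  qed auto
  finally show ?thesis by (simp add: LR_coeff_def c_def)
qed

text \<open>The subtraction in \<open>k\<close> is truncated. If \<open>\<kappa>\<close> is smaller
  in size than \<open>\<mu>\<close>, there are no chains and the formula states that the coefficient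
  is zero; otherwise every chain has length \<open>k + 1\<close>.\<close>

theorem LR_coeff_chain_formula:
  assumes \<kappa>: "\<kappa> \<in> parts n" and \<mu>: "\<mu> \<in> parts n" and k: "k = sum_list \<kappa> - sum_list \<mu>"
  shows "LR_coeff F n \<kappa> \<mu> \<nu> =
    (\<Sum>\<zeta>\<in>sat_chains n \<kappa> \<mu>. wt_LR F n \<nu> \<zeta> * (\<Prod>i<k. binom F n (\<zeta> ! i) (\<zeta> ! (i + 1))))"
proof -
  have "LR_coeff F n \<kappa> \<mu> \<nu> = chain_sum n norm_at
      (\<lambda>\<rho> \<rho>'. (norm_at \<rho> - norm_at \<rho>') * binom F n \<rho> \<rho>') (\<lambda>\<rho>. binom F n \<rho> \<nu>) \<kappa> \<mu>"
  proof (rule structure_constants_chain_sum[where C = "\<lambda>\<kappa> \<mu>. LR_coeff F n \<kappa> \<mu> \<nu>", OF _ _ _ _ \<kappa> \<mu>])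
  qed (rule binom_triangular norm_at_inj pieri binom_mult; assumption)+
  also have "\<dots> = (\<Sum>\<zeta>\<in>sat_chains n \<kappa> \<mu>. wt_LR F n \<nu> \<zeta> * (\<Prod>i<k. binom F n (\<zeta> ! i) (\<zeta> ! (i + 1))))"
    unfolding chain_sum_def
  proof (rule sum.cong[OF refl])
    fix \<zeta> assume \<zeta>: "\<zeta> \<in> sat_chains n \<kappa> \<mu>"
    then have "\<zeta> \<noteq> []" by (auto simp: sat_chains_def)
    then have len: "length \<zeta> - 1 = k"
      using sat_chain_length[OF \<zeta>] k by (cases \<zeta>) auto
    have norm_at: "(\<lambda>\<rho>. fnorm F n (pt \<rho>)) = norm_at" by (simp add: norm_at_def fun_eq_iff)
    show "chain_prod (\<lambda>\<rho> \<rho>'. (norm_at \<rho> - norm_at \<rho>') * binom F n \<rho> \<rho>') \<zeta> *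
        divided_diff norm_at (\<lambda>\<rho>. binom F n \<rho> \<nu>) (set \<zeta>) =
        wt_LR F n \<nu> \<zeta> * (\<Prod>i<k. binom F n (\<zeta> ! i) (\<zeta> ! (i + 1)))"
      unfolding wt_LR_conv_divided_diff[OF \<zeta>] chain_prod_def len prod.distrib norm_at
      by (simp add: norm_at_def mult_ac)
  qed
  finally show ?thesis .
qed

end

section \<open>The generators of the four families\<close>

lemma permute_xpow:
  assumes "\<pi> permutes A"
  shows "permute_laurent \<pi> (xpow i e) = xpow (\<pi> i) e"
proof -
  have "permute_exponent (inv \<pi>) (Poly_Mapping.single i e) = Poly_Mapping.single (\<pi> i) e"
    by (rule poly_mapping_eqI)
      (use permutes_inverses[OF assms] in
        \<open>auto simp: lookup_permute_exponent[OF permutes_inv[OF assms]] lookup_single when_def\<close>)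
  then show ?thesis by (simp add: xpow_def permute_laurent_single[OF assms])
qed

lemma keys_xpow: "supp (xpow i e :: 'f::field laurent) = {Poly_Mapping.single i e}"
  by (simp add: xpow_def)

lemma exponent_size_single: "exponent_size (Poly_Mapping.single i e) = nat \<bar>e\<bar>"
  by (subst exponent_size_superset[of "{i}"]) auto

lemma ldegree_xpow: "ldegree (xpow i e) \<le> nat \<bar>e\<bar>"
  by (simp add: ldegree_le_iff keys_xpow exponent_size_single)

lemma leval_xpow: "leval (xpow i e) x = x i powi e"
  by (simp add: xpow_def leval_single) (subst monomial_value_superset[of "{i}"], auto)

lemma exponent_size_expo: "exponent_size (expo n d a) = (\<Sum>i<n. d * a i)"
proof -
  have "supp (expo n d a) \<subseteq> {..<n}" by (auto simp: in_keys_iff lookup_expo split: if_splits)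
  then have "exponent_size (expo n d a) = (\<Sum>i<n. nat \<bar>int (d * a i)\<bar>)"
    by (subst exponent_size_superset[of "{..<n}"]) (auto simp: lookup_expo)
  then show ?thesis by (simp only: abs_of_nat nat_int)
qed

text \<open>Multiples of \<open>d\<close> are closed under addition. Dominance follows, and so does
  multiplicativity of evaluation at arbitrary points, zero coordinates included.\<close>

lemma keys_gen_algebra_powers:
  assumes "p \<in> gen_algebra ((\<lambda>i. xpow i (int d)) ` {..<n})"
  shows "\<forall>m\<in>supp p. \<exists>a. m = expo n d a"
  using assms
proof (induction rule: gen_algebra.induct)
  case (1 c)
  have "expo n d (\<lambda>_. 0) = 0" by (rule poly_mapping_eqI) (simp add: lookup_expo)
  then show ?case using keys_const by metis
next
  case (2 g)
  then obtain i where i: "i < n" "g = xpow i (int d)" by auto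
  have "Poly_Mapping.single i (int d) = expo n d (\<lambda>j. if j = i then 1 else 0)"
    by (rule poly_mapping_eqI) (use i in \<open>auto simp: lookup_expo lookup_single when_def\<close>)
  then show ?case using i by (auto simp: keys_xpow)
next
  case (3 p r)
  then show ?case using keys_add[of p r] by blast
next
  case (4 p r)
  show ?case
  proof
    fix m assume "m \<in> supp (p * r)"
    then obtain k l where m: "m = k + l" "k \<in> supp p" "l \<in> supp r"
      using keys_mult[of p r] by blast
    then obtain a b where "k = expo n d a" "l = expo n d b" using 4 by blast
    then have "m = expo n d (\<lambda>i. a i + b i)"
      using m by (intro poly_mapping_eqI) (simp add: lookup_add lookup_expo distrib_left)
    then show "\<exists>a. m = expo n d a" by blast
  qed
qed

lemma dominant_powers:
  assumes "p \<in> gen_algebra ((\<lambda>i. xpow i (int d)) ` {..<n})" "m \<in> supp p"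
  shows "\<exists>a. coef p (expo n d a) = coef p m \<and>
    (\<Sum>i<n. d * a i) = exponent_size m"
  using keys_gen_algebra_powers[OF assms(1)] assms(2) exponent_size_expo by metis

lemma eval_mult_powers:
  assumes "p \<in> gen_algebra ((\<lambda>i. xpow i (int d)) ` {..<n})" "r \<in> gen_algebra ((\<lambda>i. xpow i (int d)) ` {..<n})"
  shows "leval (p * r) x = leval p x * leval r x"
proof (rule leval_mult)
  fix m m' assume "m \<in> supp p" "m' \<in> supp r"
  then obtain a b where "m = expo n d a" "m' = expo n d b"
    using keys_gen_algebra_powers[OF assms(1)] keys_gen_algebra_powers[OF assms(2)] by blast
  then show "monomial_value (m + m') x = monomial_value m x * monomial_value m' x"
    by (intro monomial_value_add) (simp add: lookup_expo)
qed

section \<open>Invariance under inverting variables, for \<open>BM\<close>\<close>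

definition flip_exponent :: "nat set \<Rightarrow> (nat \<Rightarrow>\<^sub>0 int) \<Rightarrow> (nat \<Rightarrow>\<^sub>0 int)" where
  "flip_exponent A = Poly_Mapping.mapp (\<lambda>i e. if i \<in> A then - e else e)"

lemma lookup_flip_exponent:
  "coef (flip_exponent A m) i =
    (if i \<in> A then - coef m i else coef m i)"
  by (auto simp: flip_exponent_def lookup_mapp when_def in_keys_iff)

lemma flip_exponent_involution: "flip_exponent A (flip_exponent A m) = m"
  by (rule poly_mapping_eqI) (simp add: lookup_flip_exponent)

lemma flip_exponent_add: "flip_exponent A (k + l) = flip_exponent A k + flip_exponent A l"
  by (rule poly_mapping_eqI) (simp add: lookup_flip_exponent lookup_add)

lemma inj_flip_exponent: "inj (flip_exponent A)" and surj_flip_exponent: "surj (flip_exponent A)"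
  using flip_exponent_involution by (metis inj_on_inverseI, metis surjI)

lemma flip_single:
  "Poly_Mapping.map_key (flip_exponent A) (Poly_Mapping.single m c) = Poly_Mapping.single (flip_exponent A m) c"
  using map_key_single[OF inj_flip_exponent, of A "flip_exponent A m" c]
  by (simp add: flip_exponent_involution)

lemma gen_algebra_flip:
  assumes "p \<in> gen_algebra ((\<lambda>i. xpow i 1 + xpow i (- 1)) ` {..<n})"
  shows "Poly_Mapping.map_key (flip_exponent A) p = p"
  using assms
proof (induction rule: gen_algebra.induct)
  case (1 c)
  have "flip_exponent A 0 = 0" by (rule poly_mapping_eqI) (simp add: lookup_flip_exponent)
  then show ?case by (simp add: const_def flip_single)
next
  case (2 g)
  then obtain i where i: "g = xpow i 1 + xpow i (- 1)" by auto
  have "flip_exponent A (Poly_Mapping.single i e) = Poly_Mapping.single i (if i \<in> A then - e else e)" for e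
    by (rule poly_mapping_eqI) (simp add: lookup_flip_exponent lookup_single when_def)
  then show ?case
    by (simp add: i xpow_def map_key_plus[OF inj_flip_exponent] flip_single add.commute)
next
  case (3 p r)
  then show ?case by (simp add: map_key_plus[OF inj_flip_exponent])
next
  case (4 p r)
  then show ?case
    by (simp add: map_key_mult[OF inj_flip_exponent surj_flip_exponent flip_exponent_add])
qed

lemma keys_gen_algebra_reciprocal:
  assumes "p \<in> gen_algebra ((\<lambda>i. xpow i 1 + xpow i (- 1)) ` {..<n})"
  shows "\<forall>m\<in>supp p. supp m \<subseteq> {..<n}"
  using assms
proof (induction rule: gen_algebra.induct)
  case (1 c)
  then show ?case by (auto dest: keys_const)
next
  case (2 g)
  then obtain i where i: "i < n" "g = xpow i 1 + xpow i (- 1)" by auto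
  then show ?case using keys_add[of "xpow i 1" "xpow i (- 1)"] by (fastforce simp: keys_xpow)
next
  case (3 p r)
  then show ?case using keys_add[of p r] by blast
next
  case (4 p r)
  show ?case
  proof
    fix m assume "m \<in> supp (p * r)"
    then obtain k l where "m = k + l" "k \<in> supp p" "l \<in> supp r"
      using keys_mult[of p r] by blast
    then show "supp m \<subseteq> {..<n}" using 4 keys_add[of k l] by blast
  qed
qed

text \<open>Elements are invariant under inverting any set of variables. Inverting exactly those
  with a negative exponent in \<open>m\<close> preserves coefficient and size and makes all
  exponents nonnegative.\<close>

lemma dominant_reciprocal:
  assumes p: "p \<in> gen_algebra ((\<lambda>i. xpow i 1 + xpow i (- 1)) ` {..<n})" and m: "m \<in> supp p"
  shows "\<exists>a. coef p (expo n 1 a) = coef p m \<and>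
    (\<Sum>i<n. 1 * a i) = exponent_size m"
proof -
  define A where "A = {i. coef m i < 0}"
  define a where "a = (\<lambda>i. nat \<bar>coef m i\<bar>)"
  have keys: "supp m \<subseteq> {..<n}" using keys_gen_algebra_reciprocal[OF p] m by blast
  have flip: "flip_exponent A m = expo n 1 a"
  proof (rule poly_mapping_eqI)
    fix i
    have "coef m i = 0" if "\<not> i < n" using that keys by (auto simp: in_keys_iff)
    then show "coef (flip_exponent A m) i = coef (expo n 1 a) i"
      by (auto simp: lookup_flip_exponent lookup_expo A_def a_def)
  qed
  have "coef p (flip_exponent A m) =
      coef (Poly_Mapping.map_key (flip_exponent A) p) m"
    by (simp add: Poly_Mapping.map_key.rep_eq inj_flip_exponent)
  then have "coef p (expo n 1 a) = coef p m"
    by (simp add: flip gen_algebra_flip[OF p])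
  moreover have "(\<Sum>i<n. 1 * a i) = exponent_size m"
    using exponent_size_superset[OF _ keys] by (simp add: a_def)
  ultimately show ?thesis by blast
qed

lemma eval_mult_nonzero: "\<forall>j. x j \<noteq> 0 \<Longrightarrow> leval (p * r) x = leval p x * leval r x"
  by (intro leval_mult monomial_value_add) simp

text \<open>Some parameters are functions of \<open>\<sigma>\<close>, since the site to single out
  is known only from \<open>\<kappa>\<close> and \<open>\<mu>\<close>: any row in which they differ
  will do.\<close>

lemma vanishing_interpolant_exists:
  fixes Y W :: "nat \<times> nat \<Rightarrow> 'f::field"
  assumes op: "\<And>\<sigma>. lowering_operator Y W z0 z1 (\<phi>0 \<sigma>) (\<phi>1 \<sigma>) A B \<eta> \<theta> (c \<sigma>) (\<beta>0 \<sigma>) (\<beta>1 \<sigma>) S0 S1 P0 P1 \<sigma>"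
    and W: "inj W" and char: "(2 :: 'f) \<noteq> 0"
    and \<kappa>: "\<kappa> \<in> parts n" and \<mu>: "\<mu> \<in> parts n" and size: "sum_list \<kappa> = sum_list \<mu> + 1"
    and not_contained: "\<not> contains \<kappa> \<mu>"
  shows "vanishing_interpolant n Y \<mu> \<kappa>"
proof -
  have "\<kappa> \<noteq> \<mu>" using size by auto
  then obtain i where i: "i < n" "\<kappa> ! i \<noteq> \<mu> ! i"
    using \<kappa> \<mu> by (metis length_parts nth_equalityI)
  interpret lowering_operator Y W z0 z1 "\<phi>0 (site n \<kappa> i)" "\<phi>1 (site n \<kappa> i)" A B \<eta> \<theta>
    "c (site n \<kappa> i)" "\<beta>0 (site n \<kappa> i)" "\<beta>1 (site n \<kappa> i)" S0 S1 P0 P1 "site n \<kappa> i" by (rule op)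
  show ?thesis
    by (rule operator_interpolation[OF W char \<mu> \<kappa> size not_contained i refl])
qed

section \<open>The four families\<close>

lemma of_nat_fract: "of_nat k = to_fract (of_nat k :: 'a::idom)"
  by (induction k) auto

lemma fract_char_0: "of_nat k = (0 :: 'a::{idom,ring_char_0} fract) \<Longrightarrow> k = 0"
  by (simp add: of_nat_fract)

lemma to_fract_power: "to_fract (x ^ k) = to_fract x ^ k"
  by (induction k) auto

lemma two_nonzero: "(\<And>k. of_nat k = (0 :: 'f::field) \<Longrightarrow> k = 0) \<Longrightarrow> (2 :: 'f) \<noteq> 0"
  by (metis of_nat_numeral zero_neq_numeral)

text \<open>A kept row has root 0 and a lowered one root 1, so the quadratic is z^2 = z and
  \<open>f\<close> sees x - z. Pair factors are differences of x - \<tau> z, which agree when the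
  upper of two equal adjacent rows is lowered and the other kept.\<close>

lemma lowering_operator_AJ:
  fixes x :: "nat \<times> nat \<Rightarrow> 'f::field"
  assumes x: "\<And>r s. x (r, s) = of_nat r + of_nat s * \<tau>" and inj: "inj x"
  shows "lowering_operator x x (\<lambda>_. 0) (\<lambda>_. 1) (\<lambda>p. x \<sigma> - x p) x 1 (- 1) 1 (- \<tau>) (x \<sigma>) 0 1 1 0 0 0 \<sigma>"
proof
  show "1 * (x (r, s) - x (r', s')) + - \<tau> * (0 - 0) \<noteq> 0" if "s \<noteq> s'" for r r' s s'
    using that injD[OF inj, of "(r, s)" "(r', s')"] by auto
  show "x \<sigma> - x p = 0 \<longleftrightarrow> p = \<sigma>" for p
    using injD[OF inj, of \<sigma> p] by auto
qed (use inj in \<open>auto simp: x algebra_simps\<close>)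

text \<open>The roots are 0 and x, so lowering, which divides by q, reads x - (1 - 1/q) z. The
  weights have a pole at x = 0, but only their sum and first moment matter, where it cancels. Pair
  factors compare t x for a kept row with x for a lowered one.\<close>

lemma lowering_operator_AM:
  fixes x :: "nat \<times> nat \<Rightarrow> 'f::field"
  assumes x: "\<And>r s. x (r, s) = q ^ r * t ^ s" and inj: "inj x" and nz: "q \<noteq> 0" "t \<noteq> 0"
  shows "lowering_operator x x (\<lambda>_. 0) x (\<lambda>p. 1 / x p - 1 / x \<sigma>) (\<lambda>p. (x p - 1) / x p)
    1 (- (1 - 1 / q)) t (1 - t) (1 - 1 / x \<sigma>) (- 1) 1 0 1 0 0 \<sigma>"
proof
  have x_nz: "x p \<noteq> 0" for p using nz by (cases p) (simp add: x)
  show "t * (x (r, s) - x (r', s')) + (1 - t) * (0 - 0) \<noteq> 0" if "s \<noteq> s'" for r r' s s'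
    using that injD[OF inj, of "(r, s)" "(r', s')"] nz by auto
  show "1 / x p - 1 / x \<sigma> = 0 \<longleftrightarrow> p = \<sigma>" for p
    using injD[OF inj, of p \<sigma>] x_nz by (auto simp: field_simps)
  show "(1 / x p - 1 / x \<sigma>) + (x p - 1) / x p = 1 - 1 / x \<sigma>" for p
    using x_nz[of p] by (simp add: diff_divide_distrib)
  show "(1 / x p - 1 / x \<sigma>) * 0 + (x p - 1) / x p * x p = - 1 + 1 * x p" for p
    using x_nz[of p] by simp
  show "1 * x (Suc r, s) + - (1 - 1 / q) * x (Suc r, s) = x (r, s)" for r s
    using nz by (simp add: x field_simps)
qed (use inj in \<open>auto simp: x algebra_simps\<close>)

text \<open>Keeping and lowering are the half steps x + 1/2 and x - 1/2, since x^2 + x and x^2 - x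
  are their squares minus 1/4. Up to that constant, the \<open>W\<close> grid is the grid with
  \<alpha> raised by 1/2. Replacing x by -x exchanges the two roots and their weights, so the
  weighted sums are even in x.\<close>

lemma lowering_operator_BJ:
  fixes x :: "nat \<times> nat \<Rightarrow> 'f::field"
  assumes x: "\<And>r s. x (r, s) = of_nat r + of_nat s * \<tau> + \<alpha>" and inj: "inj x" and two: "(2 :: 'f) \<noteq> 0"
    and sum_nz: "\<And>p p'. x p + x p' \<noteq> 0" "\<And>p p'. x p + x p' + \<tau> \<noteq> 0" "\<And>p. x p + \<alpha> \<noteq> 0"
  shows "lowering_operator (\<lambda>p. x p ^ 2) (\<lambda>p. x p ^ 2 + x p) x (\<lambda>p. - x p)
    (\<lambda>p. (x p + \<alpha>) * (x p - x \<sigma>) / (2 * x p)) (\<lambda>p. (\<alpha> - x p) * (x p + x \<sigma>) / (2 * x p))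
    1 1 1 \<tau> (\<alpha> - x \<sigma>) (- (\<alpha> * x \<sigma>)) 1 0 0 0 (- 1) \<sigma>"
proof
  have x_nz: "x p \<noteq> 0" for p using sum_nz(1)[of p p] by auto
  show "inj (\<lambda>p. x p ^ 2)"
  proof (rule injI)
    fix p p' assume "x p ^ 2 = x p' ^ 2"
    then have "(x p - x p') * (x p + x p') = 0" by (simp add: power2_eq_square algebra_simps)
    then show "p = p'" using sum_nz(1) injD[OF inj] by auto
  qed
  show "1 * (x (r, s) ^ 2 - x (r', s') ^ 2) + \<tau> * (x (r, s) - x (r', s')) \<noteq> 0"
    if "s \<noteq> s'" for r r' s s'
  proof -
    have "1 * (x (r, s) ^ 2 - x (r', s') ^ 2) + \<tau> * (x (r, s) - x (r', s')) =
        (x (r, s) - x (r', s')) * (x (r, s) + x (r', s') + \<tau>)"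
      by (simp add: power2_eq_square algebra_simps)
    then show ?thesis using sum_nz(2) that injD[OF inj, of "(r, s)" "(r', s')"] by auto
  qed
  show "(x p + \<alpha>) * (x p - x \<sigma>) / (2 * x p) = 0 \<longleftrightarrow> p = \<sigma>" for p
    using injD[OF inj, of p \<sigma>] x_nz[of p] two sum_nz(3)[of p] by auto
  show "(x p + \<alpha>) * (x p - x \<sigma>) / (2 * x p) + (\<alpha> - x p) * (x p + x \<sigma>) / (2 * x p) = \<alpha> - x \<sigma>" for p
  proof -
    have "(x p + \<alpha>) * (x p - x \<sigma>) + (\<alpha> - x p) * (x p + x \<sigma>) = (\<alpha> - x \<sigma>) * (2 * x p)"
      by (simp add: algebra_simps)
    then show ?thesis using x_nz[of p] two by (simp add: add_divide_distrib[symmetric])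
  qed
  show "(x p + \<alpha>) * (x p - x \<sigma>) / (2 * x p) * x p + (\<alpha> - x p) * (x p + x \<sigma>) / (2 * x p) * - x p =
      - (\<alpha> * x \<sigma>) + 1 * x p ^ 2" for p
  proof -
    have "(x p + \<alpha>) * (x p - x \<sigma>) - (\<alpha> - x p) * (x p + x \<sigma>) = 2 * (- (\<alpha> * x \<sigma>) + x p ^ 2)"
      by (simp add: algebra_simps power2_eq_square)
    moreover have "u / (2 * x p) * x p + v / (2 * x p) * - x p = (u - v) / 2" for u v
      using x_nz[of p] two by (simp add: field_simps)
    ultimately show ?thesis using two by (simp only:) simp
  qed
  show "1 * x (Suc r, s) ^ 2 + 1 * - x (Suc r, s) = x (r, s) ^ 2 + x (r, s)" for r s
    by (simp add: x power2_eq_square algebra_simps)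
  show "1 * (x (r, Suc s) ^ 2 - x (r, s) ^ 2) + \<tau> * (- x (r, Suc s) - x (r, s)) = 0" for r s
    by (simp add: x power2_eq_square algebra_simps)
qed (auto simp: x power2_eq_square)

text \<open>With u = q^(1/2) x one has q x + 1/x = q^(1/2) (u + 1/u): the \<open>W\<close> grid
  belongs to the parameter a q^(1/2), rescaled to avoid the square root. Lowering gives x + q/x, the
  same expression at x/q. Inverting x exchanges the two roots and their weights.\<close>

lemma lowering_operator_BM:
  fixes x :: "nat \<times> nat \<Rightarrow> 'f::field"
  assumes x: "\<And>r s. x (r, s) = a * q ^ r * t ^ s" and inj: "inj x"
    and nz: "q \<noteq> 0" "t \<noteq> 0" "a \<noteq> 0"
    and prod: "\<And>p p'. x p * x p' \<noteq> 1" "\<And>p p'. q * x p * x p' \<noteq> 1" "\<And>p p'. t * x p * x p' \<noteq> 1"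
  shows "lowering_operator (\<lambda>p. x p + 1 / x p) (\<lambda>p. q * x p + 1 / x p) (\<lambda>p. 1 / x p) x
    (\<lambda>p. (1 - a * x p) * (1 - x p / x \<sigma>) / (1 - x p ^ 2))
    (\<lambda>p. (1 - a / x p) * (1 - 1 / (x p * x \<sigma>)) / (1 - 1 / x p ^ 2))
    q (1 - q) t (1 - t) (1 - a / x \<sigma>) (- (a + 1 / x \<sigma>)) 1 0 1 1 0 \<sigma>"
proof
  have x_nz: "x p \<noteq> 0" for p using nz by (cases p) (simp add: x)
  have sq: "1 - x p ^ 2 \<noteq> 0" for p
    using prod(1)[of p p] by (simp add: power2_eq_square)
  \<comment> \<open>The grid \<open>Y\<close> is the case u = 1 and the pair quantity of a kept row
    the case u = t.\<close>
  have factor: "(u * x p + 1 / x p) - (u * x p' + 1 / x p') = (x p - x p') * (u - 1 / (x p * x p'))" for u p p'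
    using x_nz[of p] x_nz[of p'] by (simp add: field_simps)
  have factor_nz: "(x p - x p') * (u - 1 / (x p * x p')) \<noteq> 0" if "p \<noteq> p'" "u * x p * x p' \<noteq> 1" for u p p'
  proof -
    have "u - 1 / (x p * x p') \<noteq> 0"
    proof
      assume "u - 1 / (x p * x p') = 0"
      then have "u = 1 / (x p * x p')" by simp
      then show False using that(2) x_nz[of p] x_nz[of p'] by simp
    qed
    then show ?thesis using that(1) injD[OF inj, of p p'] by auto
  qed
  show "inj (\<lambda>p. x p + 1 / x p)"
  proof (rule injI, rule ccontr)
    fix p p' assume "x p + 1 / x p = x p' + 1 / x p'" "p \<noteq> p'"
    then show False using factor[of 1 p p'] factor_nz[of p p' 1] prod(1)[of p p'] by simp
  qed
  show "t * ((x (r, s) + 1 / x (r, s)) - (x (r', s') + 1 / x (r', s'))) +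
      (1 - t) * (1 / x (r, s) - 1 / x (r', s')) \<noteq> 0" if "s \<noteq> s'" for r r' s s'
  proof -
    have "t * ((x (r, s) + 1 / x (r, s)) - (x (r', s') + 1 / x (r', s'))) +
      (1 - t) * (1 / x (r, s) - 1 / x (r', s')) =
      (t * x (r, s) + 1 / x (r, s)) - (t * x (r', s') + 1 / x (r', s'))"
    proof -
      have "t * ((X + u) - (X' + v)) + (1 - t) * (u - v) = (t * X + u) - (t * X' + v)" for X X' u v
        by (simp add: algebra_simps)
      then show ?thesis by blast
    qed
    then show ?thesis
      unfolding factor using that prod(3)[of "(r, s)" "(r', s')"]
      by (simp only:) (rule factor_nz, auto)
  qed
  show "1 / x p * x p = 1 + 0 * (x p + 1 / x p)" for p using x_nz[of p] by simp
  have a_x: "1 - a * x p \<noteq> 0" for p using prod(1)[of "(0, 0)" p] by (simp add: x)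
  show "(1 - a * x p) * (1 - x p / x \<sigma>) / (1 - x p ^ 2) = 0 \<longleftrightarrow> p = \<sigma>" for p
    using injD[OF inj, of p \<sigma>] x_nz[of \<sigma>] a_x[of p] sq[of p] by auto
  \<comment> \<open>Both weights are brought to the common denominator 1 - x^2.\<close>
  have \<phi>1_eq: "(1 - a / x p) * (1 - 1 / (x p * x \<sigma>)) / (1 - 1 / x p ^ 2) =
      - ((x p - a) * (x p - 1 / x \<sigma>) / (1 - x p ^ 2))" for p
  proof -
    have 1: "1 - 1 / x p ^ 2 = - (1 - x p ^ 2) / x p ^ 2"
      "(1 - a / x p) = (x p - a) / x p" "1 - 1 / (x p * x \<sigma>) = (x p - 1 / x \<sigma>) / x p"
      using x_nz[of p] x_nz[of \<sigma>] by (simp_all add: field_simps)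
    have "u / X * (v / X) / (- w / X ^ 2) = - (u * v / w)" if "X \<noteq> 0" for u v w X :: 'f
      using that by (simp add: power2_eq_square)
    then show ?thesis unfolding 1 using x_nz[of p] by blast
  qed
  define b where "b = 1 / x \<sigma>"
  have b: "x p / x \<sigma> = b * x p" "a / x \<sigma> = a * b" for p by (simp_all add: b_def)
  show "(1 - a * x p) * (1 - x p / x \<sigma>) / (1 - x p ^ 2) +
      (1 - a / x p) * (1 - 1 / (x p * x \<sigma>)) / (1 - 1 / x p ^ 2) = 1 - a / x \<sigma>" for p
  proof -
    have "(1 - a * x p) * (1 - b * x p) - (x p - a) * (x p - b) = (1 - a * b) * (1 - x p ^ 2)"
      by (simp add: algebra_simps power2_eq_square)
    then show ?thesis
      unfolding \<phi>1_eq b b_def[symmetric] using sq[of p]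
      by (simp add: diff_divide_distrib[symmetric])
  qed
  show "(1 - a * x p) * (1 - x p / x \<sigma>) / (1 - x p ^ 2) * (1 / x p) +
      (1 - a / x p) * (1 - 1 / (x p * x \<sigma>)) / (1 - 1 / x p ^ 2) * x p =
      - (a + 1 / x \<sigma>) + 1 * (x p + 1 / x p)" for p
  proof -
    have eq: "(1 - a * x p) * (1 - b * x p) * (1 / x p) - (x p - a) * (x p - b) * x p =
        (- (a + b) + (x p + 1 / x p)) * (1 - x p ^ 2)"
      using x_nz[of p] by (simp add: field_simps power2_eq_square)
    have combine: "u / w * v + - (u' / w) * v' = (u * v - u' * v') / w" for u v w u' v' :: 'f
      by (simp add: diff_divide_distrib)
    show ?thesis
      unfolding \<phi>1_eq b b_def[symmetric] combine eq using sq[of p] by simp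
  qed
  show "q * (x p + 1 / x p) + (1 - q) * (1 / x p) = q * x p + 1 / x p" for p
  proof -
    have "q * (X + u) + (1 - q) * u = q * X + u" for X u by (simp add: algebra_simps)
    then show ?thesis by blast
  qed
  show "q * (x (Suc r, s) + 1 / x (Suc r, s)) + (1 - q) * x (Suc r, s) = q * x (r, s) + 1 / x (r, s)" for r s
  proof -
    have "x (Suc r, s) = q * x (r, s)" by (simp add: x)
    then show ?thesis using nz x_nz[of "(r, s)"] by (simp add: field_simps)
  qed
  show "t * ((x (r, Suc s) + 1 / x (r, Suc s)) - (x (r, s) + 1 / x (r, s))) +
      (1 - t) * (x (r, Suc s) - 1 / x (r, s)) = 0" for r s
  proof -
    have "x (r, Suc s) = t * x (r, s)" by (simp add: x)
    then show ?thesis using nz x_nz[of "(r, s)"] by (simp add: field_simps)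
  qed
  show "(1 - a / x (0, 0)) * (1 - 1 / (x (0, 0) * x \<sigma>)) / (1 - 1 / x (0, 0) ^ 2) = 0"
    using nz by (simp add: x)
qed auto


section \<open>Separation of sizes by the norm, and the families one by one\<close>

lemma sum_parts: "\<kappa> \<in> parts n \<Longrightarrow> (\<Sum>i<n. \<kappa> ! i) = sum_list \<kappa>"
  by (simp add: parts_def sum_list_sum_nth atLeast0LessThan)

text \<open>Different rows carry different exponents, so coefficients recover the rows; in
  \<open>AM\<close> and \<open>BM\<close> the norm thus determines the whole partition.\<close>

lemma coeff_sum_monom_rows:
  assumes "j < n"
  shows "coeff (\<Sum>i<n. monom (c i) (n - 1 - i + S)) (n - 1 - j + S) = c j"
proof -
  have "coeff (\<Sum>i<n. monom (c i) (n - 1 - i + S)) (n - 1 - j + S) = (\<Sum>i<n. if i = j then c i else 0)"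
    unfolding coeff_sum by (rule sum.cong) (use assms in auto)
  then show ?thesis using assms by simp
qed

lemma monom_rows_inj:
  fixes c d :: "nat \<Rightarrow> 'a::comm_monoid_add"
  assumes "(\<Sum>i<n. monom (c i) (n - 1 - i + S)) = (\<Sum>i<n. monom (d i) (n - 1 - i + S))" "j < n"
  shows "c j = d j"
  using coeff_sum_monom_rows[OF assms(2), of c S] coeff_sum_monom_rows[OF assms(2), of d S] assms(1)
  by simp

text \<open>Covers \<open>AJ\<close> and \<open>AM\<close> with \<open>d = 1\<close> and
  \<open>BJ\<close> with \<open>d = 2\<close>. No negative exponents occur, so every point is
  good.\<close>

lemma interp_setup_powers:
  fixes F :: "'f::field interp_family" and Y :: "nat \<times> nat \<Rightarrow> 'f"
  assumes gen: "fgen F = (\<lambda>i. xpow i (int d))" and deg: "fdeg F = d" "0 < d"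
    and char_0: "\<And>k. of_nat k = (0 :: 'f) \<Longrightarrow> k = 0"
    and shift: "\<And>\<kappa> i. fshift F n \<kappa> i ^ d = Y (site n \<kappa> i)"
    and norm: "\<And>x. fnorm F n x = (\<Sum>i<n. x i ^ d)"
    and norm_inj: "\<And>\<kappa> \<mu>. \<kappa> \<in> parts n \<Longrightarrow> \<mu> \<in> parts n \<Longrightarrow> sum_list \<kappa> \<noteq> sum_list \<mu> \<Longrightarrow>
      (\<Sum>i<n. Y (site n \<kappa> i)) \<noteq> (\<Sum>i<n. Y (site n \<mu> i))"
    and inj: "inj Y"
    and witness: "\<And>\<kappa> \<mu>. \<kappa> \<in> parts n \<Longrightarrow> \<mu> \<in> parts n \<Longrightarrow> sum_list \<kappa> = sum_list \<mu> + 1 \<Longrightarrow>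
      \<not> contains \<kappa> \<mu> \<Longrightarrow> vanishing_interpolant n Y \<mu> \<kappa>"
  shows "interp_setup F n (\<lambda>x. x ^ d) (\<lambda>_. True) Y"
proof
  show "permute_laurent \<pi> (fgen F i) \<in> fgen F ` {..<n}" if "\<pi> permutes {..<n}" "i < n" for \<pi> i
    using permutes_in_image[OF that(1), of i] that by (auto simp: gen permute_xpow)
  show "ldegree (fgen F i) \<le> fdeg F" for i
    using ldegree_xpow[of i "int d", where 'a = 'f] by (simp add: gen deg)
  show "leval (fgen F i) y = y i ^ d" for i y by (simp add: gen leval_xpow)
  show "leval (p * r) y = leval p y * leval r y"
    if "p \<in> gen_algebra (fgen F ` {..<n})" "r \<in> gen_algebra (fgen F ` {..<n})" for p r y
    by (rule eval_mult_powers) (use that in \<open>simp_all only: gen\<close>)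
  show "\<exists>a. coef p (expo n (fdeg F) a) = coef p m \<and>
      (\<Sum>i<n. fdeg F * a i) = exponent_size m"
    if "p \<in> gen_algebra (fgen F ` {..<n})" "m \<in> supp p" for p m
    unfolding deg by (rule dominant_powers) (use that in \<open>simp_all only: gen\<close>)
qed (use deg char_0 shift norm norm_inj inj witness in auto)

lemma interp_setup_AJ: "interp_setup AJ n (\<lambda>x. x ^ 1) (\<lambda>_. True) (\<lambda>(r, s). to_fract [:of_nat r, of_nat s:])"
proof -
  define x :: "nat \<times> nat \<Rightarrow> rat poly fract" where "x = (\<lambda>(r, s). to_fract [:of_nat r, of_nat s:])"
  define \<tau> :: "rat poly fract" where "\<tau> = to_fract [:0, 1:]"
  have x_eq: "x (r, s) = of_nat r + of_nat s * \<tau>" for r s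
    by (simp add: x_def \<tau>_def of_nat_fract of_nat_poly flip: to_fract_add to_fract_mult)
  have inj: "inj x" by (auto simp: inj_def x_def)
  have gen: "fgen AJ = (\<lambda>i. xpow i (int 1))" and deg: "fdeg AJ = 1" by (simp_all add: AJ_def Let_def)
  note char_0 = fract_char_0[where 'a = "rat poly"]
  have "interp_setup AJ n (\<lambda>x. x ^ 1) (\<lambda>_. True) x"
  proof (rule interp_setup_powers[OF gen deg _ char_0])
    show "fshift AJ n \<kappa> i ^ 1 = x (site n \<kappa> i)" for \<kappa> i
      by (simp add: AJ_def Let_def site_def x_eq \<tau>_def)
    show "fnorm AJ n y = (\<Sum>i<n. y i ^ 1)" for y by (simp add: AJ_def Let_def)
    show "(\<Sum>i<n. x (site n \<kappa> i)) \<noteq> (\<Sum>i<n. x (site n \<mu> i))"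
      if "\<kappa> \<in> parts n" "\<mu> \<in> parts n" "sum_list \<kappa> \<noteq> sum_list \<mu>" for \<kappa> \<mu>
    proof
      \<comment> \<open>As a polynomial in \<tau>, the norm depends on the partition only through
        its constant coefficient.\<close>
      have C: "coeff (\<Sum>i<n. [:of_nat (\<rho> ! i), of_nat (n - 1 - i):] :: rat poly) 0 = of_nat (sum_list \<rho>)"
        if "\<rho> \<in> parts n" for \<rho>
        by (simp add: coeff_sum sum_parts[OF that] flip: of_nat_sum)
      assume "(\<Sum>i<n. x (site n \<kappa> i)) = (\<Sum>i<n. x (site n \<mu> i))"
      then have eq: "(\<Sum>i<n. [:of_nat (\<kappa> ! i), of_nat (n - 1 - i):] :: rat poly) =
          (\<Sum>i<n. [:of_nat (\<mu> ! i), of_nat (n - 1 - i):])"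
        by (simp add: x_def site_def flip: to_fract_sum)
      have "of_nat (sum_list \<kappa>) = (of_nat (sum_list \<mu>) :: rat)"
        unfolding C[OF that(1), symmetric] C[OF that(2), symmetric] eq by (rule refl)
      then show False using that(3) by simp
    qed
    show "inj x" by (rule inj)
    show "vanishing_interpolant n x \<mu> \<kappa>"
      if "\<kappa> \<in> parts n" "\<mu> \<in> parts n" "sum_list \<kappa> = sum_list \<mu> + 1" "\<not> contains \<kappa> \<mu>" for \<kappa> \<mu>
      by (rule vanishing_interpolant_exists[OF lowering_operator_AJ[OF x_eq inj] inj two_nonzero[OF char_0] that])
  qed simp_all
  then show ?thesis by (simp only: x_def)
qed

lemma interp_setup_BJ:
  "interp_setup BJ n (\<lambda>x. x ^ 2) (\<lambda>_. True) (\<lambda>(r, s). to_fract [:[:of_nat r, of_nat s:], 1:] ^ 2)"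
proof -
  define x :: "nat \<times> nat \<Rightarrow> rat poly poly fract" where "x = (\<lambda>(r, s). to_fract [:[:of_nat r, of_nat s:], 1:])"
  define \<tau> \<alpha> :: "rat poly poly fract" where "\<tau> = to_fract [:[:0, 1:]:]" and "\<alpha> = to_fract [:0, 1:]"
  have x_eq: "x (r, s) = of_nat r + of_nat s * \<tau> + \<alpha>" for r s
    by (simp add: x_def \<tau>_def \<alpha>_def of_nat_fract of_nat_poly flip: to_fract_add to_fract_mult)
  have inj: "inj x" by (auto simp: inj_def x_def)
  have gen: "fgen BJ = (\<lambda>i. xpow i (int 2))" and deg: "fdeg BJ = 2" by (simp_all add: BJ_def Let_def)
  note char_0 = fract_char_0[where 'a = "rat poly poly"]
  note two = two_nonzero[OF char_0]
  \<comment> \<open>Each of these sums has 2 as coefficient of \<alpha>.\<close>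
  have sum_nz: "x p + x p' \<noteq> 0" "x p + x p' + \<tau> \<noteq> 0" "x p + \<alpha> \<noteq> 0" for p p'
    by (cases p; cases p'; simp add: x_def \<tau>_def \<alpha>_def flip: to_fract_add)+
  have op: "lowering_operator (\<lambda>p. x p ^ 2) (\<lambda>p. x p ^ 2 + x p) x (\<lambda>p. - x p)
    (\<lambda>p. (x p + \<alpha>) * (x p - x \<sigma>) / (2 * x p)) (\<lambda>p. (\<alpha> - x p) * (x p + x \<sigma>) / (2 * x p))
    1 1 1 \<tau> (\<alpha> - x \<sigma>) (- (\<alpha> * x \<sigma>)) 1 0 0 0 (- 1) \<sigma>" for \<sigma>
    by (rule lowering_operator_BJ[OF x_eq inj two sum_nz])
  have inj_Y: "inj (\<lambda>p. x p ^ 2)" using op[of "(0, 0)"] by (rule lowering_operator.Y_inj)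
  have inj_W: "inj (\<lambda>p. x p ^ 2 + x p)"
  proof (rule injI)
    fix p p' assume "x p ^ 2 + x p = x p' ^ 2 + x p'"
    then have "(x p - x p') * (x p + x p' + 1) = 0" by (simp add: power2_eq_square algebra_simps)
    moreover have "x p + x p' + 1 \<noteq> 0"
      by (cases p; cases p'; simp add: x_def one_pCons flip: to_fract_add to_fract_1)
    ultimately show "p = p'" using injD[OF inj] by auto
  qed
  have "interp_setup BJ n (\<lambda>x. x ^ 2) (\<lambda>_. True) (\<lambda>p. x p ^ 2)"
  proof (rule interp_setup_powers[OF gen deg _ char_0])
    show "fshift BJ n \<kappa> i ^ 2 = x (site n \<kappa> i) ^ 2" for \<kappa> i
      by (simp add: BJ_def Let_def site_def x_eq \<tau>_def \<alpha>_def)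
    show "fnorm BJ n y = (\<Sum>i<n. y i ^ 2)" for y by (simp add: BJ_def Let_def)
    show "(\<Sum>i<n. x (site n \<kappa> i) ^ 2) \<noteq> (\<Sum>i<n. x (site n \<mu> i) ^ 2)"
      if "\<kappa> \<in> parts n" "\<mu> \<in> parts n" "sum_list \<kappa> \<noteq> sum_list \<mu>" for \<kappa> \<mu>
    proof
      \<comment> \<open>The monomial \<alpha>, free of \<tau>, arises only from the cross terms of
        \<alpha> with the row lengths.\<close>
      have C: "coeff (coeff (\<Sum>i<n. [:[:of_nat (\<rho> ! i), of_nat (n - 1 - i):], 1:] ^ 2 :: rat poly poly) 1) 0 =
          2 * of_nat (sum_list \<rho>)" if "\<rho> \<in> parts n" for \<rho>
      proof -
        have "coeff (coeff ([:[:a, b:], 1:] ^ 2) 1) 0 = 2 * a" for a b :: rat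
          by (simp add: power2_eq_square)
        then show ?thesis
          by (simp add: coeff_sum sum_parts[OF that] flip: of_nat_sum sum_distrib_left)
      qed
      assume "(\<Sum>i<n. x (site n \<kappa> i) ^ 2) = (\<Sum>i<n. x (site n \<mu> i) ^ 2)"
      then have eq: "(\<Sum>i<n. [:[:of_nat (\<kappa> ! i), of_nat (n - 1 - i):], 1:] ^ 2 :: rat poly poly) =
          (\<Sum>i<n. [:[:of_nat (\<mu> ! i), of_nat (n - 1 - i):], 1:] ^ 2)"
        by (simp add: x_def site_def flip: to_fract_sum to_fract_power)
      have "2 * of_nat (sum_list \<kappa>) = (2 * of_nat (sum_list \<mu>) :: rat)"
        unfolding C[OF that(1), symmetric] C[OF that(2), symmetric] eq by (rule refl)
      then show False using that(3) by simp
    qed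
    show "inj (\<lambda>p. x p ^ 2)" by (rule inj_Y)
    show "vanishing_interpolant n (\<lambda>p. x p ^ 2) \<mu> \<kappa>"
      if "\<kappa> \<in> parts n" "\<mu> \<in> parts n" "sum_list \<kappa> = sum_list \<mu> + 1" "\<not> contains \<kappa> \<mu>" for \<kappa> \<mu>
      by (rule vanishing_interpolant_exists[OF op inj_W two that])
  qed simp_all
  then show ?thesis by (simp add: x_def case_prod_unfold)
qed

lemma monom_monom_power:
  "[:[:0, 1:]:] ^ r = (monom (monom 1 r) 0 :: 'a::comm_semiring_1 poly poly)"
  "[:0, 1:] ^ s = (monom 1 s :: 'a poly)"
  "[:[:[:0, 1:]:]:] ^ r = (monom (monom (monom 1 r) 0) 0 :: 'a poly poly poly)"
proof -
  have X: "[:0, 1:] = (monom 1 1 :: 'b::comm_semiring_1 poly)" by (simp add: monom_Suc monom_0)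
  show "[:0, 1:] ^ s = (monom 1 s :: 'a poly)"
    unfolding X by (simp only: monom_power power_one mult_1_left)
  show "[:[:0, 1:]:] ^ r = (monom (monom 1 r) 0 :: 'a poly poly)"
    unfolding X unfolding monom_0[symmetric] by (simp only: monom_power power_one mult_1_left mult_0)
  show "[:[:[:0, 1:]:]:] ^ r = (monom (monom (monom 1 r) 0) 0 :: 'a poly poly poly)"
    unfolding X unfolding monom_0[symmetric] by (simp only: monom_power power_one mult_1_left mult_0)
qed

lemma interp_setup_AM:
  "interp_setup AM n (\<lambda>x. x ^ 1) (\<lambda>_. True) (\<lambda>(r, s). to_fract (monom (monom 1 r) s))"
proof -
  define x :: "nat \<times> nat \<Rightarrow> rat poly poly fract" where "x = (\<lambda>(r, s). to_fract (monom (monom 1 r) s))"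
  define q t :: "rat poly poly fract" where "q = to_fract [:[:0, 1:]:]" and "t = to_fract [:0, 1:]"
  have x_eq: "x (r, s) = q ^ r * t ^ s" for r s
    by (simp add: x_def q_def t_def monom_monom_power mult_monom flip: to_fract_power to_fract_mult)
  have inj: "inj x" by (auto simp: inj_def x_def monom_eq_iff')
  have nz: "q \<noteq> 0" "t \<noteq> 0" by (simp_all add: q_def t_def)
  have gen: "fgen AM = (\<lambda>i. xpow i (int 1))" and deg: "fdeg AM = 1" by (simp_all add: AM_def Let_def)
  note char_0 = fract_char_0[where 'a = "rat poly poly"]
  have "interp_setup AM n (\<lambda>x. x ^ 1) (\<lambda>_. True) x"
  proof (rule interp_setup_powers[OF gen deg _ char_0])
    show "fshift AM n \<kappa> i ^ 1 = x (site n \<kappa> i)" for \<kappa> i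
      by (simp add: AM_def Let_def site_def x_eq q_def t_def)
    show "fnorm AM n y = (\<Sum>i<n. y i ^ 1)" for y by (simp add: AM_def Let_def)
    show "(\<Sum>i<n. x (site n \<kappa> i)) \<noteq> (\<Sum>i<n. x (site n \<mu> i))"
      if "\<kappa> \<in> parts n" "\<mu> \<in> parts n" "sum_list \<kappa> \<noteq> sum_list \<mu>" for \<kappa> \<mu>
    proof
      assume "(\<Sum>i<n. x (site n \<kappa> i)) = (\<Sum>i<n. x (site n \<mu> i))"
      then have eq: "(\<Sum>i<n. monom (monom 1 (\<kappa> ! i)) (n - 1 - i + 0) :: rat poly poly) =
          (\<Sum>i<n. monom (monom 1 (\<mu> ! i)) (n - 1 - i + 0))"
        by (simp add: x_def site_def flip: to_fract_sum)
      have "\<kappa> ! j = \<mu> ! j" if "j < n" for j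
        using monom_rows_inj[OF eq that] by (simp add: monom_eq_iff')
      then have "\<kappa> = \<mu>" using that by (intro nth_equalityI) (auto simp: parts_def)
      then show False using that(3) by simp
    qed
    show "inj x" by (rule inj)
    show "vanishing_interpolant n x \<mu> \<kappa>"
      if "\<kappa> \<in> parts n" "\<mu> \<in> parts n" "sum_list \<kappa> = sum_list \<mu> + 1" "\<not> contains \<kappa> \<mu>" for \<kappa> \<mu>
      by (rule vanishing_interpolant_exists[OF lowering_operator_AM[OF x_eq inj nz] inj two_nonzero[OF char_0] that])
  qed simp_all
  then show ?thesis by (simp only: x_def)
qed

lemma interp_setup_BM:
  "interp_setup BM n (\<lambda>x. x + inverse x) (\<lambda>x. x \<noteq> 0)
    (\<lambda>(r, s). to_fract (monom (monom (monom 1 r) s) 1) + 1 / to_fract (monom (monom (monom 1 r) s) 1))"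
proof -
  define x :: "nat \<times> nat \<Rightarrow> rat poly poly poly fract"
    where "x = (\<lambda>(r, s). to_fract (monom (monom (monom 1 r) s) 1))"
  define q t a :: "rat poly poly poly fract"
    where "q = to_fract [:[:[:0, 1:]:]:]" and "t = to_fract [:[:0, 1:]:]" and "a = to_fract [:0, 1:]"
  have q_pow: "q ^ r = to_fract (monom (monom (monom 1 r) 0) 0)" for r
    by (simp add: q_def monom_monom_power flip: to_fract_power)
  have t_pow: "t ^ s = to_fract (monom (monom 1 s) 0)" for s
    by (simp add: t_def monom_monom_power flip: to_fract_power)
  have a_eq: "a = to_fract (monom 1 1)" by (simp add: a_def monom_Suc monom_0)
  have x_eq: "x (r, s) = a * q ^ r * t ^ s" for r s
    by (simp add: x_def q_pow t_pow a_eq mult_monom flip: to_fract_mult)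
  have inj: "inj x" by (auto simp: inj_def x_def monom_eq_iff')
  have nz: "q \<noteq> 0" "t \<noteq> 0" "a \<noteq> 0" by (simp_all add: q_def t_def a_def)
  have x_nz: "x p \<noteq> 0" for p by (cases p) (simp add: x_eq nz)
  \<comment> \<open>Such a product is a monomial of degree 2 in \<open>a\<close>.\<close>
  have prod_nz: "q ^ i * t ^ j * x p * x p' \<noteq> 1" for i j p p'
    by (cases p; cases p')
      (simp add: x_def q_pow t_pow mult_monom monom_eq_1_iff flip: to_fract_mult to_fract_1)
  have prod: "x p * x p' \<noteq> 1" "q * x p * x p' \<noteq> 1" "t * x p * x p' \<noteq> 1" for p p'
    using prod_nz[of 0 0 p p'] prod_nz[of 1 0 p p'] prod_nz[of 0 1 p p'] by simp_all
  have gen: "fgen BM = (\<lambda>i. xpow i 1 + xpow i (- 1))" and deg: "fdeg BM = 1"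
    by (simp_all add: BM_def Let_def)
  note char_0 = fract_char_0[where 'a = "rat poly poly poly"]
  note op = lowering_operator_BM[OF x_eq inj nz prod]
  have inj_Y: "inj (\<lambda>p. x p + 1 / x p)" using op[of "(0, 0)"] by (rule lowering_operator.Y_inj)
  have inj_W: "inj (\<lambda>p. q * x p + 1 / x p)"
  proof (rule injI)
    fix p p' assume "q * x p + 1 / x p = q * x p' + 1 / x p'"
    then have "(x p - x p') * (q * x p * x p' - 1) = 0"
      using x_nz[of p] x_nz[of p'] by (simp add: field_simps)
    then show "p = p'" using prod(2)[of p p'] injD[OF inj] by auto
  qed
  have "interp_setup BM n (\<lambda>x. x + inverse x) (\<lambda>x. x \<noteq> 0) (\<lambda>p. x p + 1 / x p)"
  proof
    show "of_nat k = (0 :: rat poly poly poly fract) \<Longrightarrow> k = 0" for k by (rule char_0)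
    show "0 < fdeg BM" by (simp add: deg)
    show "permute_laurent \<pi> (fgen BM i) \<in> fgen BM ` {..<n}" if "\<pi> permutes {..<n}" "i < n" for \<pi> i
      using permutes_in_image[OF that(1), of i] that
      by (auto simp: gen permute_xpow permute_laurent_add[OF that(1)])
    show "ldegree (fgen BM i) \<le> fdeg BM" for i
      using ldegree_xpow[of i 1, where 'a = "rat poly poly poly fract"]
        ldegree_xpow[of i "- 1", where 'a = "rat poly poly poly fract"]
      by (auto simp: gen deg intro!: ldegree_add_le)
    show "leval (fgen BM i) y = y i + inverse (y i)" for i y
      by (simp add: gen leval_add leval_xpow power_int_minus)
    show "leval (p * r) y = leval p y * leval r y" if "\<forall>j. y j \<noteq> 0" for p r y
      using that by (rule eval_mult_nonzero)
    show "\<exists>b. coef p (expo n (fdeg BM) b) = coef p m \<and>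
        (\<Sum>i<n. fdeg BM * b i) = exponent_size m"
      if "p \<in> gen_algebra (fgen BM ` {..<n})" "m \<in> supp p" for p m
      unfolding deg by (rule dominant_reciprocal) (use that in \<open>simp_all only: gen\<close>)
    have shift: "fshift BM n \<kappa> i = x (site n \<kappa> i)" for \<kappa> i
      by (simp add: BM_def Let_def site_def x_eq q_def t_def a_def)
    show "fshift BM n \<kappa> i \<noteq> 0" for \<kappa> i by (simp add: shift x_nz)
    show "fshift BM n \<kappa> i + inverse (fshift BM n \<kappa> i) = x (site n \<kappa> i) + 1 / x (site n \<kappa> i)" for \<kappa> i
      by (simp add: shift inverse_eq_divide)
    show "fnorm BM n y = (\<Sum>i<n. y i + inverse (y i))" for y by (simp add: BM_def Let_def)
    show "(\<Sum>i<n. x (site n \<kappa> i) + 1 / x (site n \<kappa> i)) \<noteq> (\<Sum>i<n. x (site n \<mu> i) + 1 / x (site n \<mu> i))"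
      if "\<kappa> \<in> parts n" "\<mu> \<in> parts n" "sum_list \<kappa> \<noteq> sum_list \<mu>" for \<kappa> \<mu>
    proof
      assume eq: "(\<Sum>i<n. x (site n \<kappa> i) + 1 / x (site n \<kappa> i)) =
        (\<Sum>i<n. x (site n \<mu> i) + 1 / x (site n \<mu> i))"
      \<comment> \<open>The factor \<open>a * q ^ R * t ^ n\<close> clears denominators for both
        partitions. Terms from x and from 1/x then have degree 2 and 0 in \<open>a\<close>, so they
        can be told apart.\<close>
      define R where "R = sum_list \<kappa> + sum_list \<mu>"
      define rows :: "nat list \<Rightarrow> rat poly poly poly" where
        "rows = (\<lambda>\<rho>. \<Sum>i<n. monom (monom (monom 1 (\<rho> ! i + R)) (n - 1 - i + n)) 2 +
          monom (monom (monom 1 (R - \<rho> ! i)) (n - (n - 1 - i))) 0)"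
      have clear: "a * q ^ R * t ^ n * (\<Sum>i<n. x (site n \<rho> i) + 1 / x (site n \<rho> i)) = to_fract (rows \<rho>)"
        if "\<rho> \<in> parts n" "sum_list \<rho> \<le> R" for \<rho>
      proof -
        have "a * q ^ R * t ^ n * (x (site n \<rho> i) + 1 / x (site n \<rho> i)) =
            to_fract (monom (monom (monom 1 (\<rho> ! i + R)) (n - 1 - i + n)) 2 +
              monom (monom (monom 1 (R - \<rho> ! i)) (n - (n - 1 - i))) 0)" if i: "i < n" for i
        proof -
          have "\<rho> ! i \<le> R"
            using elem_le_sum_list[of i \<rho>] i \<open>\<rho> \<in> parts n\<close> \<open>sum_list \<rho> \<le> R\<close> by (simp add: parts_def)
          then have pows: "q ^ R = q ^ (\<rho> ! i) * q ^ (R - \<rho> ! i)"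
            "t ^ n = t ^ (n - 1 - i) * t ^ (n - (n - 1 - i))"
            by (simp_all flip: power_add)
          have "a * q ^ R * t ^ n * (1 / x (site n \<rho> i)) = q ^ (R - \<rho> ! i) * t ^ (n - (n - 1 - i))"
            unfolding site_def x_eq pows using nz by simp
          also have "\<dots> = to_fract (monom (monom (monom 1 (R - \<rho> ! i)) (n - (n - 1 - i))) 0)"
            unfolding q_pow t_pow by (simp add: mult_monom flip: to_fract_mult)
          finally have "a * q ^ R * t ^ n * (1 / x (site n \<rho> i)) = \<dots>" .
          moreover have "a * q ^ R * t ^ n * x (site n \<rho> i) =
              to_fract (monom (monom (monom 1 (\<rho> ! i + R)) (n - 1 - i + n)) 2)"
            unfolding site_def x_def q_pow t_pow a_eq
            by (simp add: mult_monom add.commute numeral_2_eq_2 flip: to_fract_mult)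
          ultimately show ?thesis by (simp only: distrib_left to_fract_add)
        qed
        then show ?thesis by (simp add: rows_def sum_distrib_left)
      qed
      have "to_fract (rows \<kappa>) = to_fract (rows \<mu>)"
        using clear[of \<kappa>] clear[of \<mu>] eq that R_def by simp
      then have "coeff (rows \<kappa>) 2 = coeff (rows \<mu>) 2" by simp
      then have rows_eq: "(\<Sum>i<n. monom (monom 1 (\<kappa> ! i + R)) (n - 1 - i + n) :: rat poly poly) =
          (\<Sum>i<n. monom (monom 1 (\<mu> ! i + R)) (n - 1 - i + n))"
        by (simp add: rows_def coeff_sum)
      have "\<kappa> ! j = \<mu> ! j" if "j < n" for j
        using monom_rows_inj[OF rows_eq that] by (simp add: monom_eq_iff')
      then have "\<kappa> = \<mu>" using that by (intro nth_equalityI) (auto simp: parts_def)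
      then show False using that(3) by simp
    qed
    show "inj (\<lambda>p. x p + 1 / x p)" by (rule inj_Y)
    show "vanishing_interpolant n (\<lambda>p. x p + 1 / x p) \<mu> \<kappa>"
      if "\<kappa> \<in> parts n" "\<mu> \<in> parts n" "sum_list \<kappa> = sum_list \<mu> + 1" "\<not> contains \<kappa> \<mu>" for \<kappa> \<mu>
      by (rule vanishing_interpolant_exists[OF op inj_W two_nonzero[OF char_0] that])
  qed
  then show ?thesis by (simp add: x_def case_prod_unfold)
qed

theorem theorem5:
  fixes n k :: nat and \<kappa> \<mu> \<nu> :: "nat list"
  assumes "n \<ge> 1"
    and "\<kappa> \<in> parts n" and "\<mu> \<in> parts n" and "\<nu> \<in> parts n"
    and "k = sum_list \<kappa> - sum_list \<mu>"
  shows "LR_coeff AJ n \<kappa> \<mu> \<nu> =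
           (\<Sum>\<zeta>\<in>sat_chains n \<kappa> \<mu>. wt_LR AJ n \<nu> \<zeta> * (\<Prod>i<k. binom AJ n (\<zeta> ! i) (\<zeta> ! (i + 1)))) \<and>
         LR_coeff BJ n \<kappa> \<mu> \<nu> =
           (\<Sum>\<zeta>\<in>sat_chains n \<kappa> \<mu>. wt_LR BJ n \<nu> \<zeta> * (\<Prod>i<k. binom BJ n (\<zeta> ! i) (\<zeta> ! (i + 1)))) \<and>
         LR_coeff AM n \<kappa> \<mu> \<nu> =
           (\<Sum>\<zeta>\<in>sat_chains n \<kappa> \<mu>. wt_LR AM n \<nu> \<zeta> * (\<Prod>i<k. binom AM n (\<zeta> ! i) (\<zeta> ! (i + 1)))) \<and>
         LR_coeff BM n \<kappa> \<mu> \<nu> =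
           (\<Sum>\<zeta>\<in>sat_chains n \<kappa> \<mu>. wt_LR BM n \<nu> \<zeta> * (\<Prod>i<k. binom BM n (\<zeta> ! i) (\<zeta> ! (i + 1))))"
  by (intro conjI interp_setup.LR_coeff_chain_formula[OF interp_setup_AJ assms(2,3,5)]
      interp_setup.LR_coeff_chain_formula[OF interp_setup_BJ assms(2,3,5)]
      interp_setup.LR_coeff_chain_formula[OF interp_setup_AM assms(2,3,5)]
      interp_setup.LR_coeff_chain_formula[OF interp_setup_BM assms(2,3,5)])

end
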